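(* Let $N\geq3$ and $2^*=\frac{2N}{N-2}$. Suppose that $(u_n)\subset H^1(\mathbb{R}^N)$ is bounded. Then there are sequences $(\widetilde u_i)_{i=0}^\infty\subset H^1(\mathbb{R}^N)$ and, for any $n\geq1$, $(y_n^i)_{i=0}^\infty\subset\mathbb{R}^N$, such that $y_n^0=0$, $|y_n^i-y_n^j|\to\infty$ as $n\to\infty$ for $i\neq j$, and, passing to a subsequence (in $n$), the following conditions hold for any $i\geq0$: $$u_n(\cdot+y_n^i)\rightharpoonup\widetilde u_i\ \text{ in }H^1(\mathbb{R}^N)\text{ as }n\to\infty,$$ $$\lim_{n\to\infty}\int_{\mathbb{R}^N}|\nabla u_n|^2\,dx=\sum_{j=0}^i\int_{\mathbb{R}^N}|\nabla\widetilde u_j|^2\,dx+\lim_{n\to\infty}\int_{\mathbb{R}^N}|\nabla v_n^i|^2\,dx,$$ where $v_n^i:=u_n-\sum_{j=0}^i\widetilde u_j(\cdot-y_n^j)$, and $$\limsup_{n\to\infty}\int_{\mathbb{R}^N}\Psi(u_n)\,dx=\sum_{j=0}^i\int_{\mathbb{R}^N}\Psi(\widetilde u_j)\,dx+\limsup_{n\to\infty}\int_{\mathbb{R}^N}\Psi(v_n^i)\,dx$$ for any function $\Psi:\mathbb{R}\to[0,\infty)$ of class $\mathcal{C}^1$ such that $|\Psi'(s)|\leq C(|s|+|s|^{2^*-1})$ for any $s\in\mathbb{R}$ and some constant $C>0$. Moreover, if in addition $\Psi$ satisfies $$\lim_{s\to0}\frac{\Psi(s)}{|s|^2}=\lim_{|s|\to\infty}\frac{\Psi(s)}{|s|^{2^*}}=0,$$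 then $$\lim_{i\to\infty}\Big(\limsup_{n\to\infty}\int_{\mathbb{R}^N}\Psi(v_n^i)\,dx\Big)=0.$$
   Context: $\rightharpoonup$ denotes weak convergence. The subsequence and the sequences $(\widetilde u_i)$, $(y_n^i)$ do not depend on $\Psi$. *)

theory Defs
  imports "HOL-Analysis.Analysis"
begin

fun C_k :: "nat \<Rightarrow> ('a::euclidean_space \<Rightarrow> real) \<Rightarrow> bool" where
  "C_k 0 f \<longleftrightarrow> continuous_on UNIV f"
| "C_k (Suc k) f \<longleftrightarrow>
     (\<forall>x. f differentiable (at x)) \<and>
     (\<forall>b\<in>Basis. C_k k (\<lambda>x. frechet_derivative f (at x) b))"

definition test_function :: "('a::euclidean_space \<Rightarrow> real) \<Rightarrow> bool" where
  "test_function \<phi> \<longleftrightarrow> (\<forall>k. C_k k \<phi>) \<and> compact (closure {x. \<phi> x \<noteq> 0})"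

(* Elements of Lebesgue and Sobolev spaces are given by Borel representatives;
   every class modulo null sets has one. *)

definition L2 :: "('a::euclidean_space \<Rightarrow> 'b::euclidean_space) set" where
  "L2 = {f \<in> borel_measurable lborel. integrable lborel (\<lambda>x. (norm (f x))\<^sup>2)}"

(* The integrands below are integrable whenever u and g are in L2 (or just locally
   integrable); the predicate is only used for such u and g. *)
definition is_weak_gradient :: "('a::euclidean_space \<Rightarrow> real) \<Rightarrow> ('a \<Rightarrow> 'a) \<Rightarrow> bool" where
  "is_weak_gradient u g \<longleftrightarrow>
     (\<forall>\<phi>. test_function \<phi> \<longrightarrow> (\<forall>b\<in>Basis.
        (\<integral>x. u x * frechet_derivative \<phi> (at x) b \<partial>lborel) = - (\<integral>x. (g x \<bullet> b) * \<phi> x \<partial>lborel)))"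

definition H1 :: "('a::euclidean_space \<Rightarrow> real) set" where
  "H1 = {u \<in> L2. \<exists>g\<in>L2. is_weak_gradient u g}"

(* For u in H1 the weak gradient exists and is unique up to a null set. *)
definition weak_gradient :: "('a::euclidean_space \<Rightarrow> real) \<Rightarrow> ('a \<Rightarrow> 'a)" where
  "weak_gradient u = (SOME g. g \<in> L2 \<and> is_weak_gradient u g)"

definition dirichlet_integral :: "('a::euclidean_space \<Rightarrow> real) \<Rightarrow> real" where
  "dirichlet_integral u = (\<integral>x. (norm (weak_gradient u x))\<^sup>2 \<partial>lborel)"

definition H1_norm :: "('a::euclidean_space \<Rightarrow> real) \<Rightarrow> real" where
  "H1_norm u = sqrt (dirichlet_integral u + (\<integral>x. (u x)\<^sup>2 \<partial>lborel))"

(* The bound forces L to agree on functions that are equal almost everywhere, so these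
   are exactly the elements of the dual of the space of equivalence classes. *)
definition H1_dual :: "(('a::euclidean_space \<Rightarrow> real) \<Rightarrow> real) set" where
  "H1_dual = {L.
     (\<forall>u\<in>H1. \<forall>v\<in>H1. L (\<lambda>x. u x + v x) = L u + L v) \<and>
     (\<forall>c. \<forall>u\<in>H1. L (\<lambda>x. c * u x) = c * L u) \<and>
     (\<exists>C. \<forall>u\<in>H1. \<bar>L u\<bar> \<le> C * H1_norm u)}"

definition H1_weakly_converges ::
  "(nat \<Rightarrow> 'a::euclidean_space \<Rightarrow> real) \<Rightarrow> ('a \<Rightarrow> real) \<Rightarrow> bool" where
  "H1_weakly_converges f g \<longleftrightarrow>
     (\<forall>n. f n \<in> H1) \<and> g \<in> H1 \<and> (\<forall>L\<in>H1_dual. (\<lambda>n. L (f n)) \<longlonglongrightarrow> L g)"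

definition sobolev_exponent :: "nat \<Rightarrow> real" where
  "sobolev_exponent N = 2 * real N / (real N - 2)"

(* Integral of a nonnegative function composed with u, possibly infinite: the growth
   condition bounds only the derivative of Psi, so Psi 0 > 0 is allowed. *)
definition Psi_integral :: "(real \<Rightarrow> real) \<Rightarrow> ('a::euclidean_space \<Rightarrow> real) \<Rightarrow> ennreal" where
  "Psi_integral \<Psi> u = (\<integral>\<^sup>+x. ennreal (\<Psi> (u x)) \<partial>lborel)"

definition profile_remainder ::
  "(nat \<Rightarrow> 'a::euclidean_space \<Rightarrow> real) \<Rightarrow> (nat \<Rightarrow> 'a \<Rightarrow> real) \<Rightarrow> (nat \<Rightarrow> nat \<Rightarrow> 'a) \<Rightarrow>
     nat \<Rightarrow> nat \<Rightarrow> 'a \<Rightarrow> real" where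
  "profile_remainder u U y n i = (\<lambda>x. u n x - (\<Sum>j\<le>i. U j (x - y n j)))"

end

theory Submission
  imports Defs "HOL-Library.Diagonal_Subsequence"
begin

text \<open>
The profiles are extracted one at a time. Suppose that along some subsequence the centres
\<open>y\<^sub>n\<^sup>0, ..., y\<^sub>n\<^sup>k\<close> separate from one another. Consider all weak limits, along further
subsequences, of \<open>u\<^sub>n(\<cdot> + x\<^sub>n)\<close> with centres \<open>x\<^sub>n\<close> that run away from the earlier ones, and take as
next profile one whose L2 norm is the largest possible up to a factor 2
(\<open>profile_limit_near_maximal\<close>). A diagonal subsequence serves all steps at once (\<open>profiles_exist\<close>).
Functions translated to infinity converge weakly to 0, so the remainder, recentred at the next
centre, converges weakly to the next profile (\<open>R_weak_next\<close>). Expanding the square then gives a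
Pythagorean identity for every translation-invariant quadratic form (\<open>form_split\<close>). For the Dirichlet
form this is the identity for the gradients; for the L2 form it shows that the norms of the profiles
tend to 0 (\<open>profiles_vanish\<close>).

The identity for a nonlinear \<open>\<Psi>\<close> is the Brezis-Lieb lemma applied to the recentred remainders
(\<open>weak_Brezis_Lieb\<close>). It needs convergence almost everywhere along a subsequence and a bound of the
critical norm. For the last claim, the near-maximality of the profiles bounds the averages of the
remainder over all balls of a fixed radius by the norm of the next profile (\<open>R_averages_small\<close>). A
function in H1 whose averages over sufficiently small balls are small is itself small outside a set of
small measure, and subcriticality bounds \<open>\<Psi>\<close> by a small multiple of the critical growth plus a constant
on that set (\<open>Psi_integral_small\<close>).

The analysis rests on a single property of functions in H1: their translation by a vector h moves
them in L2 by at most the norm of h times the norm of the gradient (\<open>translation_estimate\<close>). It makes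
averages over small balls close to the function (\<open>avg_close\<close>). Since the averages of a weakly null
sequence converge to 0 pointwise, this yields local compactness (\<open>weakly_null_AE_subseq\<close>) and the
passage from small averages to small level sets (\<open>small_averages_small_levels\<close>). Applied to the dyadic
truncations of a function, it also yields the Sobolev bound with the critical exponent
(\<open>critical_bound\<close>).

Weak convergence is tested on all bounded functionals. The locale \<open>semi_hilbert\<close> provides the Riesz
representation and weak sequential compactness in complete spaces of functions with a semi-inner
product; L2 and H1 are its two instances.
\<close>

section \<open>Complete semi-inner product spaces of functions\<close>

lemma bounded_double_subseq:
  fixes a :: "nat \<Rightarrow> nat \<Rightarrow> real"
  assumes "\<And>n m. \<bar>a n m\<bar> \<le> M m"
  obtains r :: "nat \<Rightarrow> nat" where "strict_mono r" "\<And>m. convergent (\<lambda>n. a (r n) m)"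
proof -
  interpret subseqs "\<lambda>m s. convergent (\<lambda>n. a (s n) m)"
  proof
    fix m and s :: "nat \<Rightarrow> nat"
    have "bounded (range (\<lambda>n. a (s n) m))" by (rule boundedI[of _ "M m"]) (auto simp: assms)
    then obtain l r where "strict_mono r" "((\<lambda>n. a (s n) m) \<circ> r) \<longlonglongrightarrow> l"
      using bounded_imp_convergent_subsequence by blast
    then show "\<exists>r'. strict_mono r' \<and> convergent (\<lambda>n. a ((s \<circ> r') n) m)"
      by (auto simp: convergent_def o_def)
  qed
  have c: "convergent (\<lambda>n. a ((diagseq \<circ> (+) (Suc m)) n) m)" for m
    by (rule diagseq_holds) (auto simp: o_def dest: convergent_subseq_convergent)
  have "convergent (\<lambda>n. a (diagseq n) m)" for m
    using c[of m] convergent_ignore_initial_segment[of "\<lambda>n. a (diagseq n) m" "Suc m"]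
    by (simp add: o_def add.commute)
  then show ?thesis using that subseq_diagseq by blast
qed

lemma le_mult_sqrt_imp_sqrt_le:
  fixes s A :: real
  assumes "s \<le> A * sqrt s" "0 \<le> A" "0 \<le> s" shows "sqrt s \<le> A"
proof (cases "s = 0")
  case False
  then have "sqrt s > 0" using assms(3) by simp
  moreover have "sqrt s * sqrt s \<le> A * sqrt s" using assms by simp
  ultimately show ?thesis by (rule mult_right_le_imp_le[rotated])
qed (simp add: assms)

lemma not_eventually_subseq:
  assumes "\<not> (\<forall>\<^sub>F n in sequentially. P n)"
  obtains s where "strict_mono (s :: nat \<Rightarrow> nat)" "\<And>n. \<not> P (s n)"
proof -
  have "\<exists>\<^sub>F n in sequentially. \<not> P n" using assms by (simp add: not_eventually)
  then have "infinite {n. \<not> P n}" by (simp add: frequently_cofinite[symmetric] cofinite_eq_sequentially)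
  then show ?thesis using infinite_enumerate that by blast
qed

text \<open>A space V of functions with a positive semidefinite form that is complete for the seminorm of the
form. Functions are not identified when their difference has seminorm 0, so limits and representing
elements are unique only up to seminorm 0.\<close>
locale semi_hilbert =
  fixes V :: "('a \<Rightarrow> 'b::real_vector) set" and ip :: "('a \<Rightarrow> 'b) \<Rightarrow> ('a \<Rightarrow> 'b) \<Rightarrow> real"
  assumes zero_mem: "(\<lambda>x. 0) \<in> V"
    and lin_mem: "\<And>a b u v. u \<in> V \<Longrightarrow> v \<in> V \<Longrightarrow> (\<lambda>x. a *\<^sub>R u x + b *\<^sub>R v x) \<in> V"
    and ip_lin: "\<And>a b u v w. u \<in> V \<Longrightarrow> v \<in> V \<Longrightarrow> w \<in> V \<Longrightarrow>
       ip (\<lambda>x. a *\<^sub>R u x + b *\<^sub>R v x) w = a * ip u w + b * ip v w"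
    and ip_commute: "\<And>u v. u \<in> V \<Longrightarrow> v \<in> V \<Longrightarrow> ip u v = ip v u"
    and ip_nonneg: "\<And>u. u \<in> V \<Longrightarrow> 0 \<le> ip u u"
    and complete: "\<And>f. (\<And>n. f n \<in> V) \<Longrightarrow>
       (\<And>e. e > 0 \<Longrightarrow> \<exists>N. \<forall>m\<ge>N. \<forall>n\<ge>N. ip (\<lambda>x. f m x - f n x) (\<lambda>x. f m x - f n x) < e) \<Longrightarrow>
       \<exists>g\<in>V. (\<lambda>n::nat. ip (\<lambda>x. f n x - g x) (\<lambda>x. f n x - g x)) \<longlonglongrightarrow> 0"
begin

text \<open>The square of the seminorm.\<close>
definition sq :: "('a \<Rightarrow> 'b) \<Rightarrow> real" where "sq u = ip u u"

lemma add_mem: "u \<in> V \<Longrightarrow> v \<in> V \<Longrightarrow> (\<lambda>x. u x + v x) \<in> V"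
  using lin_mem[of u v 1 1] by simp
lemma diff_mem: "u \<in> V \<Longrightarrow> v \<in> V \<Longrightarrow> (\<lambda>x. u x - v x) \<in> V"
  using lin_mem[of u v 1 "-1"] by simp
lemma scale_mem: "u \<in> V \<Longrightarrow> (\<lambda>x. c *\<^sub>R u x) \<in> V"
  using lin_mem[of u u c 0] by simp

lemma ip_lin_right: "u \<in> V \<Longrightarrow> v \<in> V \<Longrightarrow> w \<in> V \<Longrightarrow>
   ip w (\<lambda>x. a *\<^sub>R u x + b *\<^sub>R v x) = a * ip w u + b * ip w v"
  by (subst ip_commute) (simp_all add: lin_mem ip_lin ip_commute[of w])

lemma ip_diff: "u \<in> V \<Longrightarrow> v \<in> V \<Longrightarrow> w \<in> V \<Longrightarrow> ip (\<lambda>x. u x - v x) w = ip u w - ip v w"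
  using ip_lin[of u v w 1 "-1"] by simp
lemma ip_diff_right: "u \<in> V \<Longrightarrow> v \<in> V \<Longrightarrow> w \<in> V \<Longrightarrow> ip w (\<lambda>x. u x - v x) = ip w u - ip w v"
  using ip_lin_right[of u v w 1 "-1"] by simp
lemma ip_scale: "u \<in> V \<Longrightarrow> v \<in> V \<Longrightarrow> ip (\<lambda>x. c *\<^sub>R u x) v = c * ip u v"
  using ip_lin[of u u v c 0] by simp

lemma sq_nonneg: "u \<in> V \<Longrightarrow> 0 \<le> sq u"
  by (simp add: sq_def ip_nonneg)

lemma sq_lin: "u \<in> V \<Longrightarrow> v \<in> V \<Longrightarrow>
   sq (\<lambda>x. a *\<^sub>R u x + b *\<^sub>R v x) = a\<^sup>2 * sq u + 2 * a * b * ip u v + b\<^sup>2 * sq v"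
  by (simp add: sq_def ip_lin ip_lin_right lin_mem ip_commute[of v u] power2_eq_square algebra_simps)

lemma sq_diff: "u \<in> V \<Longrightarrow> v \<in> V \<Longrightarrow> sq (\<lambda>x. u x - v x) = sq u - 2 * ip u v + sq v"
  using sq_lin[of u v 1 "-1"] by simp
lemma sq_add: "u \<in> V \<Longrightarrow> v \<in> V \<Longrightarrow> sq (\<lambda>x. u x + v x) = sq u + 2 * ip u v + sq v"
  using sq_lin[of u v 1 1] by simp
lemma Cauchy_Schwarz_sq:
  assumes "u \<in> V" "v \<in> V" shows "(ip u v)\<^sup>2 \<le> sq u * sq v"
proof -
  have *: "0 \<le> a\<^sup>2 * sq u + 2 * a * b * ip u v + b\<^sup>2 * sq v" for a b
    using sq_nonneg[OF lin_mem[OF assms, of a b]] by (simp add: sq_lin assms)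
  show ?thesis
  proof (cases "sq v = 0")
    case True
    have "ip u v = 0"
    proof (rule ccontr)
      assume n: "ip u v \<noteq> 0"
      have "0 \<le> sq u + 2 * (-(sq u + 1) / (2 * ip u v)) * ip u v"
        using *[of 1 "-(sq u + 1) / (2 * ip u v)"] True by simp
      also have "\<dots> = -1" using n by (simp add: field_simps)
      finally show False by simp
    qed
    then show ?thesis by (simp add: True)
  next
    case False
    then have p: "sq v > 0" using sq_nonneg[OF assms(2)] by simp
    have "0 \<le> sq v * (sq v * sq u - (ip u v)\<^sup>2)"
      using *[of "sq v" "- ip u v"] by (simp add: power2_eq_square algebra_simps)
    then have "0 \<le> sq v * sq u - (ip u v)\<^sup>2" using p by (simp add: zero_le_mult_iff)
    then show ?thesis by (simp add: mult.commute)
  qed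
qed

lemma Cauchy_Schwarz: "u \<in> V \<Longrightarrow> v \<in> V \<Longrightarrow> \<bar>ip u v\<bar> \<le> sqrt (sq u) * sqrt (sq v)"
  using Cauchy_Schwarz_sq[of u v] by (metis real_sqrt_abs real_sqrt_le_iff real_sqrt_mult)

lemma seminorm_triangle:
  assumes "u \<in> V" "v \<in> V" shows "sqrt (sq (\<lambda>x. u x + v x)) \<le> sqrt (sq u) + sqrt (sq v)"
proof (rule real_le_lsqrt)
  have "ip u v \<le> sqrt (sq u) * sqrt (sq v)" using Cauchy_Schwarz[OF assms] by simp
  then show "sq (\<lambda>x. u x + v x) \<le> (sqrt (sq u) + sqrt (sq v))\<^sup>2"
    by (simp add: sq_add assms power2_sum sq_nonneg)
qed (simp add: sq_nonneg assms)

lemma sq_add_le: "u \<in> V \<Longrightarrow> v \<in> V \<Longrightarrow> sq (\<lambda>x. u x + v x) \<le> 2 * sq u + 2 * sq v"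
  using sq_nonneg[OF diff_mem, of u v] by (simp add: sq_diff sq_add)

lemma sq_diff_le: "u \<in> V \<Longrightarrow> v \<in> V \<Longrightarrow> sq (\<lambda>x. u x - v x) \<le> 2 * sq u + 2 * sq v"
  using sq_nonneg[OF add_mem, of u v] by (simp add: sq_diff sq_add)

lemma ip_tendsto:
  assumes f: "\<And>n. f n \<in> V" and g: "g \<in> V" and w: "w \<in> V"
    and lim: "(\<lambda>n. sq (\<lambda>x. f n x - g x)) \<longlonglongrightarrow> 0"
  shows "(\<lambda>n. ip (f n) w) \<longlonglongrightarrow> ip g w"
proof -
  have "(\<lambda>n. sqrt (sq (\<lambda>x. f n x - g x)) * sqrt (sq w)) \<longlonglongrightarrow> sqrt 0 * sqrt (sq w)"
    by (intro tendsto_intros lim)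
  then have l0: "(\<lambda>n. sqrt (sq (\<lambda>x. f n x - g x)) * sqrt (sq w)) \<longlonglongrightarrow> 0" by simp
  have "(\<lambda>n. ip (f n) w - ip g w) \<longlonglongrightarrow> 0"
    by (rule Lim_null_comparison[OF _ l0])
       (use Cauchy_Schwarz[OF diff_mem[OF f g] w] in \<open>simp add: ip_diff f g w\<close>)
  then show ?thesis by (rule LIM_zero_cancel)
qed

lemma sq_tendsto:
  assumes f: "\<And>n. f n \<in> V" and g: "g \<in> V"
    and lim: "(\<lambda>n. sq (\<lambda>x. f n x - g x)) \<longlonglongrightarrow> 0"
  shows "(\<lambda>n. sq (f n)) \<longlonglongrightarrow> sq g"
proof -
  have "(\<lambda>n. sq (\<lambda>x. f n x - g x) + 2 * ip (f n) g - sq g) \<longlonglongrightarrow> 0 + 2 * ip g g - sq g"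
    by (intro tendsto_intros lim ip_tendsto f g)
  then show ?thesis by (simp add: sq_diff f g) (simp add: sq_def)
qed

text \<open>Linear subspaces of V; they need not be closed.\<close>
definition subsp :: "('a \<Rightarrow> 'b) set \<Rightarrow> bool" where
  "subsp W \<longleftrightarrow> W \<subseteq> V \<and> (\<lambda>x. 0) \<in> W \<and> (\<forall>u\<in>W. \<forall>v\<in>W. \<forall>a b. (\<lambda>x. a *\<^sub>R u x + b *\<^sub>R v x) \<in> W)"

lemma subsp_V: "subsp V" by (simp add: subsp_def lin_mem zero_mem)

text \<open>The functional is represented by a minimizer of \<open>sq w - 2 * L w\<close> over W. By the parallelogram identity
every minimizing sequence is Cauchy. As W may fail to be closed, the minimizer p is only a limit of
elements of W.\<close>
lemma Riesz_subspace:
  assumes W: "subsp W"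
    and Llin: "\<And>u v a b. u \<in> W \<Longrightarrow> v \<in> W \<Longrightarrow> L (\<lambda>x. a *\<^sub>R u x + b *\<^sub>R v x) = a * L u + b * L v"
    and Lbd: "\<And>u. u \<in> W \<Longrightarrow> \<bar>L u\<bar> \<le> C * sqrt (sq u)"
  shows "\<exists>p\<in>V. \<exists>w. (\<forall>n::nat. w n \<in> W) \<and> (\<lambda>n. sq (\<lambda>x. w n x - p x)) \<longlonglongrightarrow> 0 \<and> (\<forall>v\<in>W. ip p v = L v)"
proof -
  define J where "J w = sq w - 2 * L w" for w
  define d where "d = (INF w\<in>W. J w)"
  have WV: "\<And>w. w \<in> W \<Longrightarrow> w \<in> V" and W0: "W \<noteq> {}" using W by (auto simp: subsp_def)
  have Wlin: "\<And>u v a b. u \<in> W \<Longrightarrow> v \<in> W \<Longrightarrow> (\<lambda>x. a *\<^sub>R u x + b *\<^sub>R v x) \<in> W"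
    using W by (auto simp: subsp_def)
  have lower: "- C\<^sup>2 \<le> J w" if w: "w \<in> W" for w
  proof -
    have "L w \<le> C * sqrt (sq w)" using Lbd[OF w] by simp
    moreover have "sq w = (sqrt (sq w))\<^sup>2" by (simp add: sq_nonneg WV w)
    moreover have "0 \<le> (sqrt (sq w) - C)\<^sup>2" by simp
    ultimately show ?thesis unfolding J_def power2_diff by (simp add: mult.commute)
  qed
  have bdd: "bdd_below (J ` W)" by (rule bdd_belowI[of _ "-C\<^sup>2"]) (auto simp: lower)
  have dle: "d \<le> J w" if "w \<in> W" for w unfolding d_def by (rule cINF_lower[OF bdd that])
  have "\<exists>w\<in>W. J w < d + 1 / (real n + 1)" for n
  proof -
    have "(INF w\<in>W. J w) < d + 1 / (real n + 1)" by (simp add: d_def add_pos_pos)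
    then show ?thesis by (subst (asm) cINF_less_iff[OF W0 bdd]) auto
  qed
  then obtain w where wW: "\<And>n. w n \<in> W" and wJ: "\<And>n. J (w n) < d + 1 / (real n + 1)" by metis
  note wV = WV[OF wW]
  \<comment> \<open>The parallelogram identity: the midpoint of u and v cannot have a value of J below the infimum d.\<close>
  have par: "sq (\<lambda>x. u x - v x) \<le> 2 * (J u + J v - 2 * d)" if "u \<in> W" "v \<in> W" for u v
  proof -
    have "d \<le> J (\<lambda>x. (1/2) *\<^sub>R u x + (1/2) *\<^sub>R v x)" by (intro dle Wlin that)
    also have "\<dots> = (1/4) * sq u + (1/2) * ip u v + (1/4) * sq v - L u - L v"
      unfolding J_def using that
      by (subst Llin, simp, simp) (simp add: sq_lin WV power2_eq_square)
    finally show ?thesis using that by (simp add: J_def sq_diff WV)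
  qed
  have "\<exists>p\<in>V. (\<lambda>n. ip (\<lambda>x. w n x - p x) (\<lambda>x. w n x - p x)) \<longlonglongrightarrow> 0"
  proof (rule complete)
    fix e :: real assume e: "e > 0"
    obtain N where N: "1 / (real N + 1) < e / 4"
      using e reals_Archimedean[of "e/4"] by (auto simp: inverse_eq_divide add.commute)
    show "\<exists>N. \<forall>m\<ge>N. \<forall>n\<ge>N. ip (\<lambda>x. w m x - w n x) (\<lambda>x. w m x - w n x) < e"
    proof (intro exI allI impI)
      fix m n assume mn: "N \<le> m" "N \<le> n"
      have "1 / (real m + 1) \<le> 1 / (real N + 1)" "1 / (real n + 1) \<le> 1 / (real N + 1)"
        using mn by (auto intro!: divide_left_mono)
      then have "2 * (J (w m) + J (w n) - 2 * d) < e" using wJ[of m] wJ[of n] N by simp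
      then show "ip (\<lambda>x. w m x - w n x) (\<lambda>x. w m x - w n x) < e"
        using par[OF wW[of m] wW[of n]] by (simp add: sq_def)
    qed
  qed (rule wV)
  then obtain p where p: "p \<in> V" and wp: "(\<lambda>n. sq (\<lambda>x. w n x - p x)) \<longlonglongrightarrow> 0"
    by (auto simp: sq_def)
  have "ip p v = L v" if v: "v \<in> W" for v
  proof -
    \<comment> \<open>First variation of J at the minimizer in the direction v.\<close>
    have q: "0 \<le> 2 * t * (ip p v - L v) + t\<^sup>2 * sq v" for t
    proof -
      have le: "d \<le> (d + 1 / (real n + 1)) + 2 * t * (ip (w n) v - L v) + t\<^sup>2 * sq v" for n
      proof -
        have "d \<le> J (\<lambda>x. 1 *\<^sub>R w n x + t *\<^sub>R v x)" by (intro dle Wlin wW v)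
        also have "\<dots> = J (w n) + 2 * t * (ip (w n) v - L v) + t\<^sup>2 * sq v"
          unfolding J_def by (subst Llin, rule wW, rule v) (subst sq_lin, rule wV, rule WV[OF v], simp add: algebra_simps)
        finally show ?thesis using wJ[of n] by simp
      qed
      have "(\<lambda>n. (d + 1 / (real n + 1)) + 2 * t * (ip (w n) v - L v) + t\<^sup>2 * sq v)
          \<longlonglongrightarrow> (d + 0) + 2 * t * (ip p v - L v) + t\<^sup>2 * sq v"
      proof (intro tendsto_intros ip_tendsto[OF wV p WV[OF v] wp])
        show "(\<lambda>n. 1 / (real n + 1)) \<longlonglongrightarrow> 0"
          using LIMSEQ_inverse_real_of_nat by (simp add: inverse_eq_divide add.commute)
      qed
      from LIMSEQ_le_const[OF this, of d] le show ?thesis by auto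
    qed
    show ?thesis
    proof (rule ccontr)
      assume n: "ip p v \<noteq> L v"
      define z where "z = ip p v - L v"
      have z: "z \<noteq> 0" using n by (simp add: z_def)
      have s: "sq v \<ge> 0" using v by (simp add: sq_nonneg WV)
      have "0 \<le> 2 * (- z / (sq v + 1)) * z + (- z / (sq v + 1))\<^sup>2 * sq v"
        using q[of "- z / (sq v + 1)"] by (simp add: z_def)
      also have "\<dots> = - (z\<^sup>2 * (sq v + 2) / (sq v + 1)\<^sup>2)"
        using s by (simp add: power2_eq_square divide_simps) (simp add: algebra_simps)
      also have "\<dots> < 0" using z s by (simp add: add_nonneg_pos)
      finally show False by simp
    qed
  qed
  then show ?thesis using p wW wp by blast
qed

lemma Riesz:
  assumes "\<And>u v a b. u \<in> V \<Longrightarrow> v \<in> V \<Longrightarrow> L (\<lambda>x. a *\<^sub>R u x + b *\<^sub>R v x) = a * L u + b * L v"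
    and "\<And>u. u \<in> V \<Longrightarrow> \<bar>L u\<bar> \<le> C * sqrt (sq u)"
  obtains p where "p \<in> V" "\<And>v. v \<in> V \<Longrightarrow> L v = ip p v"
  using Riesz_subspace[OF subsp_V, of L C] assms by metis

lemma projection:
  assumes W: "subsp W" and \<phi>: "\<phi> \<in> V"
  obtains p w where "p \<in> V" "\<And>n::nat. w n \<in> W" "(\<lambda>n. sq (\<lambda>x. w n x - p x)) \<longlonglongrightarrow> 0"
    "\<And>v. v \<in> W \<Longrightarrow> ip p v = ip \<phi> v"
proof -
  have WV: "\<And>w. w \<in> W \<Longrightarrow> w \<in> V" using W by (auto simp: subsp_def)
  have "\<exists>p\<in>V. \<exists>w. (\<forall>n::nat. w n \<in> W) \<and> (\<lambda>n. sq (\<lambda>x. w n x - p x)) \<longlonglongrightarrow> 0 \<and> (\<forall>v\<in>W. ip p v = ip \<phi> v)"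
    by (rule Riesz_subspace[OF W, where C="sqrt (sq \<phi>)"])
       (auto simp: WV \<phi> ip_lin_right Cauchy_Schwarz)
  then show ?thesis using that by blast
qed

lemma dense_subspace:
  assumes W: "subsp W" and \<phi>: "\<phi> \<in> V"
    and orth: "\<And>v. v \<in> V \<Longrightarrow> (\<And>w. w \<in> W \<Longrightarrow> ip v w = 0) \<Longrightarrow> sq v = 0"
  obtains w where "\<And>n::nat. w n \<in> W" "(\<lambda>n. sq (\<lambda>x. w n x - \<phi> x)) \<longlonglongrightarrow> 0"
proof -
  have WV: "\<And>w. w \<in> W \<Longrightarrow> w \<in> V" using W by (auto simp: subsp_def)
  obtain p w where p: "p \<in> V" and w: "\<And>n::nat. w n \<in> W" "(\<lambda>n. sq (\<lambda>x. w n x - p x)) \<longlonglongrightarrow> 0"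
    "\<And>v. v \<in> W \<Longrightarrow> ip p v = ip \<phi> v" by (rule projection[OF W \<phi>], rule that)
  have 0: "sq (\<lambda>x. p x - \<phi> x) = 0" by (rule orth) (auto simp: diff_mem p \<phi> ip_diff w(3) WV)
  have 1: "sq (\<lambda>x. w n x - \<phi> x) \<le> 2 * sq (\<lambda>x. w n x - p x)" for n
    using sq_add_le[OF diff_mem[OF WV[OF w(1)[of n]] p] diff_mem[OF p \<phi>]] 0 by simp
  have "(\<lambda>n. 2 * sq (\<lambda>x. w n x - p x)) \<longlonglongrightarrow> 0" using tendsto_mult_right_zero[OF w(2)] by blast
  then have "(\<lambda>n. sq (\<lambda>x. w n x - \<phi> x)) \<longlonglongrightarrow> 0"
    by (rule Lim_null_comparison[rotated]) (use 1 in \<open>auto simp: sq_nonneg diff_mem WV w \<phi>\<close>)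
  with w(1) that show ?thesis by blast
qed

text \<open>No separability is needed. Along a subsequence the pairings of f with each of its own members converge.
The set W of all functions against which the pairings converge is a closed subspace that contains the
whole sequence f. Hence pairing f with any function is the same as pairing f with the projection of
that function onto W, so that W is everything.\<close>
theorem weak_compactness:
  assumes f: "\<And>n. f n \<in> V" and bd: "\<And>n. sq (f n) \<le> M"
  obtains r g where "strict_mono (r::nat\<Rightarrow>nat)" "g \<in> V" "\<And>\<phi>. \<phi> \<in> V \<Longrightarrow> (\<lambda>n. ip (f (r n)) \<phi>) \<longlonglongrightarrow> ip g \<phi>"
proof -
  have M: "\<bar>ip (f n) \<phi>\<bar> \<le> sqrt M * sqrt (sq \<phi>)" if "\<phi> \<in> V" for \<phi> n
    by (rule order_trans[OF Cauchy_Schwarz[OF f that]]) (simp add: mult_right_mono sq_nonneg that bd)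
  obtain r :: "nat \<Rightarrow> nat" where r: "strict_mono r" and c: "\<And>m. convergent (\<lambda>n. ip (f (r n)) (f m))"
    using bounded_double_subseq[of "\<lambda>n m. ip (f n) (f m)", OF M[OF f]] by blast
  define W where "W = {\<phi> \<in> V. convergent (\<lambda>n. ip (f (r n)) \<phi>)}"
  define L where "L \<phi> = lim (\<lambda>n. ip (f (r n)) \<phi>)" for \<phi>
  have Llim: "(\<lambda>n. ip (f (r n)) \<phi>) \<longlonglongrightarrow> L \<phi>" if "\<phi> \<in> W" for \<phi>
    using that by (simp add: W_def L_def convergent_LIMSEQ_iff)
  have lin: "(\<lambda>n. ip (f (r n)) (\<lambda>x. a *\<^sub>R u x + b *\<^sub>R v x)) \<longlonglongrightarrow> a * L u + b * L v"
    if "u \<in> W" "v \<in> W" for u v a b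
  proof -
    have "(\<lambda>n. a * ip (f (r n)) u + b * ip (f (r n)) v) \<longlonglongrightarrow> a * L u + b * L v"
      by (intro tendsto_intros Llim that)
    then show ?thesis using that by (simp add: ip_lin_right f W_def)
  qed
  have z: "ip w (\<lambda>x. 0) = 0" if "w \<in> V" for w
    using ip_lin_right[OF zero_mem zero_mem that, of 0 0] by simp
  have W: "subsp W"
    unfolding subsp_def
  proof (intro conjI ballI allI)
    show "W \<subseteq> V" "(\<lambda>x. 0) \<in> W" by (auto simp: W_def zero_mem z f convergent_const)
    show "(\<lambda>x. a *\<^sub>R u x + b *\<^sub>R v x) \<in> W" if "u \<in> W" "v \<in> W" for u v a b
      using lin[OF that, of a b] that by (auto simp: W_def lin_mem convergent_def)
  qed
  have WV: "\<And>w. w \<in> W \<Longrightarrow> w \<in> V" by (simp add: W_def)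
  have Llin: "L (\<lambda>x. a *\<^sub>R u x + b *\<^sub>R v x) = a * L u + b * L v" if "u \<in> W" "v \<in> W" for u v a b
    unfolding L_def[of "\<lambda>x. a *\<^sub>R u x + b *\<^sub>R v x"] using lin[OF that] by (rule limI)
  have Lbd: "\<bar>L u\<bar> \<le> sqrt M * sqrt (sq u)" if "u \<in> W" for u
    by (rule LIMSEQ_le_const2[OF tendsto_rabs[OF Llim[OF that]]]) (use M[OF WV[OF that]] in auto)
  obtain g where g: "g \<in> V" and gL: "\<And>v. v \<in> W \<Longrightarrow> ip g v = L v" and
     gw: "\<exists>w. (\<forall>n::nat. w n \<in> W) \<and> (\<lambda>n. sq (\<lambda>x. w n x - g x)) \<longlonglongrightarrow> 0"
    using Riesz_subspace[OF W Llin Lbd] by blast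
  then obtain w where w: "\<And>n::nat. w n \<in> W" "(\<lambda>n. sq (\<lambda>x. w n x - g x)) \<longlonglongrightarrow> 0" by blast
  have fW: "f n \<in> W" for n using c by (simp add: W_def f)
  have closed: "p \<in> W" if p: "p \<in> V" and v: "\<And>n::nat. v n \<in> W" "(\<lambda>n. sq (\<lambda>x. v n x - p x)) \<longlonglongrightarrow> 0" for p v
  proof -
    have "Cauchy (\<lambda>n. ip (f (r n)) p)"
    proof (rule CauchyI')
      fix e :: real assume e: "e > 0"
      have "(\<lambda>n. sqrt M * sqrt (sq (\<lambda>x. v n x - p x))) \<longlonglongrightarrow> sqrt M * sqrt 0" by (intro tendsto_intros v)
      then have "\<forall>\<^sub>F n in sequentially. sqrt M * sqrt (sq (\<lambda>x. v n x - p x)) < e / 3"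
        using e by (intro order_tendstoD) auto
      then obtain k where k: "sqrt M * sqrt (sq (\<lambda>x. v k x - p x)) < e / 3"
        using eventually_sequentially by auto
      have d: "\<bar>ip (f n) (v k) - ip (f n) p\<bar> < e / 3" for n
        using M[OF diff_mem[OF WV[OF v(1)] p], of n k] k by (simp add: ip_diff_right WV v p f)
      have "Cauchy (\<lambda>n. ip (f (r n)) (v k))" using Llim[OF v(1)] by (rule LIMSEQ_imp_Cauchy)
      then obtain N where N: "\<And>m n. m \<ge> N \<Longrightarrow> n \<ge> N \<Longrightarrow> \<bar>ip (f (r m)) (v k) - ip (f (r n)) (v k)\<bar> < e / 3"
        using e by (metis CauchyD[where e="e/3"] divide_pos_pos real_norm_def zero_less_numeral)
      show "\<exists>N. \<forall>m\<ge>N. \<forall>n>m. dist (ip (f (r m)) p) (ip (f (r n)) p) < e"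
      proof (intro exI[of _ N] allI impI)
        fix m n assume "N \<le> m" "m < n"
        then have "\<bar>ip (f (r m)) (v k) - ip (f (r n)) (v k)\<bar> < e / 3" using N by simp
        then show "dist (ip (f (r m)) p) (ip (f (r n)) p) < e"
          using d[of "r m"] d[of "r n"] unfolding dist_real_def by linarith
      qed
    qed
    then show ?thesis using p by (simp add: W_def Cauchy_convergent_iff)
  qed
  have gW: "g \<in> W" by (rule closed[OF g w])
  have "(\<lambda>n. ip (f (r n)) \<phi>) \<longlonglongrightarrow> ip g \<phi>" if \<phi>: "\<phi> \<in> V" for \<phi>
  proof -
    obtain p v where p: "p \<in> V" and v: "\<And>n::nat. v n \<in> W" "(\<lambda>n. sq (\<lambda>x. v n x - p x)) \<longlonglongrightarrow> 0"
      "\<And>v. v \<in> W \<Longrightarrow> ip p v = ip \<phi> v" by (rule projection[OF W \<phi>], rule that)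
    have pW: "p \<in> W" by (rule closed[OF p v(1,2)])
    have "(\<lambda>n. ip (f (r n)) p) \<longlonglongrightarrow> ip g p" using Llim[OF pW] gL[OF pW] by simp
    then show ?thesis using v(3)[OF fW] v(3)[OF gW] by (simp add: ip_commute f g p \<phi>)
  qed
  then show ?thesis using that r g by blast
qed

end

section \<open>Square-integrable functions\<close>

definition l2_ip :: "('a::euclidean_space \<Rightarrow> 'b::euclidean_space) \<Rightarrow> ('a \<Rightarrow> 'b) \<Rightarrow> real" where
  "l2_ip f g = (\<integral>x. f x \<bullet> g x \<partial>lborel)"

lemma L2_measurable [measurable_dest]: "f \<in> L2 \<Longrightarrow> f \<in> borel_measurable borel"
  by (simp add: L2_def)

lemma L2_integrable: "f \<in> L2 \<Longrightarrow> integrable lborel (\<lambda>x. (norm (f x))\<^sup>2)"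
  by (simp add: L2_def)

lemma L2I:
  "f \<in> borel_measurable borel \<Longrightarrow> integrable lborel (\<lambda>x. (norm (f x))\<^sup>2) \<Longrightarrow> f \<in> L2"
  by (simp add: L2_def)

lemma L2_nn_integral:
  fixes f :: "'a::euclidean_space \<Rightarrow> 'b::euclidean_space"
  assumes "f \<in> L2"
  shows "(\<integral>\<^sup>+x. ennreal ((norm (f x))\<^sup>2) \<partial>lborel) = ennreal (\<integral>x. (norm (f x))\<^sup>2 \<partial>lborel)"
  by (rule nn_integral_eq_integral) (use assms in \<open>auto simp: L2_integrable\<close>)

lemma L2I_nn:
  assumes [measurable]: "f \<in> borel_measurable borel"
    and fin: "(\<integral>\<^sup>+x. ennreal ((norm (f x))\<^sup>2) \<partial>lborel) < \<infinity>"
  shows "f \<in> L2"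
  by (intro L2I assms(1) integrableI_bounded) (use fin in auto)

lemma L2_bound:
  fixes f :: "'a::euclidean_space \<Rightarrow> 'b::euclidean_space"
  assumes [measurable]: "f \<in> borel_measurable borel" and g: "g \<in> L2" and "\<And>x. norm (f x) \<le> norm (g x)"
  shows "f \<in> L2"
proof (rule L2I)
  show "integrable lborel (\<lambda>x. (norm (f x))\<^sup>2)"
    by (rule Bochner_Integration.integrable_bound[OF L2_integrable[OF g]])
       (auto intro!: power_mono assms)
qed fact

lemma norm_sq_lin_le: "(norm (a *\<^sub>R u + b *\<^sub>R v :: 'b::real_inner))\<^sup>2 \<le> 2 * a\<^sup>2 * (norm u)\<^sup>2 + 2 * b\<^sup>2 * (norm v)\<^sup>2"
proof -
  have "(norm (a *\<^sub>R u + b *\<^sub>R v))\<^sup>2 \<le> (\<bar>a\<bar> * norm u + \<bar>b\<bar> * norm v)\<^sup>2"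
    by (rule power_mono) (use norm_triangle_ineq[of "a *\<^sub>R u" "b *\<^sub>R v"] in auto)
  also have "\<dots> \<le> 2 * (\<bar>a\<bar> * norm u)\<^sup>2 + 2 * (\<bar>b\<bar> * norm v)\<^sup>2"
    using sum_squares_ge_zero[of "\<bar>a\<bar> * norm u - \<bar>b\<bar> * norm v" 0] by (simp add: power2_eq_square algebra_simps)
  finally show ?thesis by (simp add: power_mult_distrib)
qed

lemma L2_lin:
  fixes u v :: "'a::euclidean_space \<Rightarrow> 'b::euclidean_space"
  assumes [measurable]: "u \<in> L2" "v \<in> L2" shows "(\<lambda>x. a *\<^sub>R u x + b *\<^sub>R v x) \<in> L2"
proof (rule L2I)
  show "integrable lborel (\<lambda>x. (norm (a *\<^sub>R u x + b *\<^sub>R v x))\<^sup>2)"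
    by (rule Bochner_Integration.integrable_bound[where f="\<lambda>x. 2 * a\<^sup>2 * (norm (u x))\<^sup>2 + 2 * b\<^sup>2 * (norm (v x))\<^sup>2"])
       (auto intro!: norm_sq_lin_le simp: L2_integrable assms)
qed measurable

lemma L2_zero: "(\<lambda>x. 0) \<in> L2" by (rule L2I) auto

lemma L2_ip_integrable:
  fixes u v :: "'a::euclidean_space \<Rightarrow> 'b::euclidean_space"
  assumes [measurable]: "u \<in> L2" "v \<in> L2" shows "integrable lborel (\<lambda>x. u x \<bullet> v x)"
proof (rule Bochner_Integration.integrable_bound[where f="\<lambda>x. (norm (u x))\<^sup>2 + (norm (v x))\<^sup>2"])
  have "\<bar>a \<bullet> b\<bar> \<le> (norm a)\<^sup>2 + (norm b)\<^sup>2" for a b :: 'b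
  proof -
    have "\<bar>a \<bullet> b\<bar> \<le> norm a * norm b" by (rule Cauchy_Schwarz_ineq2)
    also have "\<dots> \<le> (norm a)\<^sup>2 + (norm b)\<^sup>2"
      using zero_le_power2[of "norm a - norm b"] zero_le_power2[of "norm a"] zero_le_power2[of "norm b"]
      unfolding power2_diff by linarith
    finally show ?thesis .
  qed
  then show "AE x in lborel. norm (u x \<bullet> v x) \<le> norm ((norm (u x))\<^sup>2 + (norm (v x))\<^sup>2)" by auto
qed (auto simp: L2_integrable assms)

lemma l2_ip_self: "l2_ip f f = (\<integral>x. (norm (f x))\<^sup>2 \<partial>lborel)"
  by (simp add: l2_ip_def power2_norm_eq_inner)

text \<open>A Cauchy sequence has a subsequence whose consecutive differences \<open>d\<^sub>k\<close> have squared norm at most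
\<open>4\<^sup>-\<^sup>k\<close>. Then the sum of \<open>2\<^sup>k |d\<^sub>k|\<^sup>2\<close> is integrable, so that \<open>d\<^sub>k\<close> decays geometrically almost everywhere
and the subsequence converges almost everywhere. Fatou's lemma turns this into convergence in L2.\<close>
lemma L2_complete:
  fixes f :: "nat \<Rightarrow> 'a::euclidean_space \<Rightarrow> 'b::euclidean_space"
  assumes f: "\<And>n. f n \<in> L2"
    and Cauchy: "\<And>e. e > 0 \<Longrightarrow> \<exists>N. \<forall>m\<ge>N. \<forall>n\<ge>N. (\<integral>x. (norm (f m x - f n x))\<^sup>2 \<partial>lborel) < e"
  shows "\<exists>g\<in>L2. (\<lambda>n. \<integral>x. (norm (f n x - g x))\<^sup>2 \<partial>lborel) \<longlonglongrightarrow> 0"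
proof -
  note [measurable] = L2_measurable[OF f]
  have fd: "(\<lambda>x. f m x - f n x) \<in> L2" for m n using L2_lin[OF f f, of 1 m "-1" n] by simp
  have "\<exists>N. \<forall>m\<ge>N. \<forall>n\<ge>N. (\<integral>x. (norm (f m x - f n x))\<^sup>2 \<partial>lborel) < (1/4)^k" for k :: nat
    by (rule Cauchy) simp
  then obtain N where N: "\<And>k m n. m \<ge> N k \<Longrightarrow> n \<ge> N k \<Longrightarrow> (\<integral>x. (norm (f m x - f n x))\<^sup>2 \<partial>lborel) < (1/4)^k"
    by metis
  define r where "r k = k + (\<Sum>j\<le>k. N j)" for k
  have rN: "N k \<le> r k" "N k \<le> r (Suc k)" for k
    using member_le_sum[of k "{..k}" N] by (auto simp: r_def)
  have rm: "strict_mono r" by (auto simp: strict_mono_Suc_iff r_def)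
  define d where "d k x = f (r (Suc k)) x - f (r k) x" for k x
  have [measurable]: "d k \<in> borel_measurable borel" for k unfolding d_def by measurable
  have dL: "d k \<in> L2" for k unfolding d_def by (rule fd)
  have dint: "(\<integral>\<^sup>+x. ennreal ((norm (d k x))\<^sup>2) \<partial>lborel) \<le> ennreal ((1/4)^k)" for k
    unfolding L2_nn_integral[OF dL] using N[OF rN(2)[of k] rN(1)[of k]]
    by (auto simp: d_def intro!: ennreal_leI)
  have "(\<integral>\<^sup>+x. (\<Sum>k. ennreal (2^k * (norm (d k x))\<^sup>2)) \<partial>lborel)
      = (\<Sum>k. \<integral>\<^sup>+x. ennreal (2^k * (norm (d k x))\<^sup>2) \<partial>lborel)"
    by (rule nn_integral_suminf) measurable
  also have "\<dots> \<le> (\<Sum>k. ennreal ((1/2)^k))"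
  proof (intro suminf_le allI summableI)
    fix k
    have "(\<integral>\<^sup>+x. ennreal (2^k * (norm (d k x))\<^sup>2) \<partial>lborel) = ennreal (2^k) * (\<integral>\<^sup>+x. ennreal ((norm (d k x))\<^sup>2) \<partial>lborel)"
      by (simp add: ennreal_mult nn_integral_cmult)
    also have "\<dots> \<le> ennreal (2^k) * ennreal ((1/4)^k)" by (intro mult_left_mono dint) simp
    also have "\<dots> = ennreal ((1/2)^k)"
      by (simp add: ennreal_mult[symmetric] power_mult_distrib[symmetric])
    finally show "(\<integral>\<^sup>+x. ennreal (2^k * (norm (d k x))\<^sup>2) \<partial>lborel) \<le> ennreal ((1/2)^k)" .
  qed
  also have "\<dots> = ennreal (\<Sum>k. (1/2)^k)" by (rule suminf_ennreal2) (auto intro: summable_geometric)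
  also have "\<dots> < \<infinity>" by simp
  finally have "(\<integral>\<^sup>+x. (\<Sum>k. ennreal (2^k * (norm (d k x))\<^sup>2)) \<partial>lborel) \<noteq> \<infinity>" by simp
  then have ae: "AE x in lborel. (\<Sum>k. ennreal (2^k * (norm (d k x))\<^sup>2)) \<noteq> \<infinity>"
    by (intro nn_integral_noteq_infinite) auto
  have conv: "convergent (\<lambda>k. f (r k) x)" if fin: "(\<Sum>k. ennreal (2^k * (norm (d k x))\<^sup>2)) \<noteq> \<infinity>" for x
  proof -
    have s: "summable (\<lambda>k. 2^k * (norm (d k x))\<^sup>2)"
      by (rule summable_suminf_not_top) (use fin in auto)
    define B where "B = (\<Sum>k. 2^k * (norm (d k x))\<^sup>2)"
    have t: "2^k * (norm (d k x))\<^sup>2 \<le> B" for k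
      unfolding B_def using sum_le_suminf[OF s, of "{k}"] by simp
    have "norm (d k x) \<le> sqrt B * (1 / sqrt 2)^k" for k
    proof -
      have "(norm (d k x))\<^sup>2 \<le> B * (1/2)^k" using t[of k] by (simp add: field_simps power_divide)
      then have "norm (d k x) \<le> sqrt (B * (1/2)^k)" by (rule real_le_rsqrt)
      also have "\<dots> = sqrt B * (1 / sqrt 2)^k" by (simp add: real_sqrt_mult real_sqrt_power real_sqrt_divide)
      finally show ?thesis .
    qed
    moreover have "norm (1 / sqrt 2) < 1" by (simp add: norm_divide)
    then have "summable (\<lambda>k. sqrt B * (1 / sqrt 2)^k)" by (intro summable_mult summable_geometric)
    ultimately have "summable (\<lambda>k. d k x)" by (metis summable_comparison_test')
    then have "convergent (\<lambda>n. \<Sum>k<n. d k x)" by (simp add: summable_iff_convergent)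
    moreover have "(\<Sum>k<n. d k x) = f (r n) x - f (r 0) x" for n
      unfolding d_def by (rule sum_lessThan_telescope)
    ultimately have "convergent (\<lambda>n. (f (r n) x - f (r 0) x) + f (r 0) x)"
      by (intro convergent_add convergent_const) auto
    then show ?thesis by simp
  qed
  define g where "g x = lim (\<lambda>k. f (r k) x)" for x
  have [measurable]: "g \<in> borel_measurable borel" unfolding g_def by measurable
  have lim: "AE x in lborel. (\<lambda>k. f (r k) x) \<longlonglongrightarrow> g x"
    using ae by eventually_elim (simp add: g_def conv convergent_LIMSEQ_iff[symmetric])
  have fatou: "(\<integral>\<^sup>+x. ennreal ((norm (f m x - g x))\<^sup>2) \<partial>lborel) \<le> ennreal e"
    if e: "e \<ge> 0" and K: "\<And>k. k \<ge> K \<Longrightarrow> (\<integral>x. (norm (f m x - f k x))\<^sup>2 \<partial>lborel) \<le> e" for m e K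
  proof -
    have "AE x in lborel. ennreal ((norm (f m x - g x))\<^sup>2) = liminf (\<lambda>k. ennreal ((norm (f m x - f (r k) x))\<^sup>2))"
      using lim
    proof eventually_elim
      case (elim x)
      have "(\<lambda>k. ennreal ((norm (f m x - f (r k) x))\<^sup>2)) \<longlonglongrightarrow> ennreal ((norm (f m x - g x))\<^sup>2)"
        by (intro tendsto_intros elim)
      then show ?case by (rule lim_imp_Liminf[OF sequentially_bot, symmetric])
    qed
    then have "(\<integral>\<^sup>+x. ennreal ((norm (f m x - g x))\<^sup>2) \<partial>lborel)
        = (\<integral>\<^sup>+x. liminf (\<lambda>k. ennreal ((norm (f m x - f (r k) x))\<^sup>2)) \<partial>lborel)"
      by (rule nn_integral_cong_AE)
    also have "\<dots> \<le> liminf (\<lambda>k. \<integral>\<^sup>+x. ennreal ((norm (f m x - f (r k) x))\<^sup>2) \<partial>lborel)"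
      by (rule nn_integral_liminf) measurable
    also have "\<dots> \<le> limsup (\<lambda>k. \<integral>\<^sup>+x. ennreal ((norm (f m x - f (r k) x))\<^sup>2) \<partial>lborel)"
      by (rule Liminf_le_Limsup) simp
    also have "\<dots> \<le> ennreal e"
    proof (rule Limsup_bounded)
      show "\<forall>\<^sub>F k in sequentially. (\<integral>\<^sup>+x. ennreal ((norm (f m x - f (r k) x))\<^sup>2) \<partial>lborel) \<le> ennreal e"
        using eventually_ge_at_top[of K]
      proof eventually_elim
        case (elim k)
        then have "K \<le> r k" using seq_suble[OF rm, of k] by simp
        then show ?case unfolding L2_nn_integral[OF fd] by (intro ennreal_leI K)
      qed
    qed
    finally show ?thesis .
  qed
  have fg: "(\<lambda>x. f m x - g x) \<in> L2" if "m \<ge> N 0" for m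
  proof (rule L2I_nn)
    show "(\<integral>\<^sup>+x. ennreal ((norm (f m x - g x))\<^sup>2) \<partial>lborel) < \<infinity>"
      by (rule le_less_trans[OF fatou[of 1 "N 0"]]) (use N[OF that, of ] in \<open>auto intro: less_imp_le\<close>)
  qed measurable
  have g: "g \<in> L2" using L2_lin[OF f fg[OF order_refl], of 1 "N 0" "-1"] by simp
  have fg: "(\<lambda>x. f m x - g x) \<in> L2" for m using L2_lin[OF f g, of 1 m "-1"] by simp
  have "(\<lambda>n. \<integral>x. (norm (f n x - g x))\<^sup>2 \<partial>lborel) \<longlonglongrightarrow> 0"
  proof (rule LIMSEQ_I)
    fix e :: real assume e: "e > 0"
    obtain K where K: "\<And>m n. m \<ge> K \<Longrightarrow> n \<ge> K \<Longrightarrow> (\<integral>x. (norm (f m x - f n x))\<^sup>2 \<partial>lborel) < e/2"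
      using Cauchy[of "e/2"] e by auto
    show "\<exists>K. \<forall>n\<ge>K. norm ((\<integral>x. (norm (f n x - g x))\<^sup>2 \<partial>lborel) - 0) < e"
    proof (intro exI[of _ K] allI impI)
      fix n assume n: "K \<le> n"
      have "ennreal (\<integral>x. (norm (f n x - g x))\<^sup>2 \<partial>lborel) \<le> ennreal (e/2)"
        unfolding L2_nn_integral[OF fg, symmetric] by (rule fatou[of _ K]) (use e K[OF n] in \<open>auto intro: less_imp_le\<close>)
      then have "(\<integral>x. (norm (f n x - g x))\<^sup>2 \<partial>lborel) \<le> e/2" using e by (simp add: ennreal_le_iff)
      then show "norm ((\<integral>x. (norm (f n x - g x))\<^sup>2 \<partial>lborel) - 0) < e" using e by simp
    qed
  qed
  with g show ?thesis by blast
qed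

interpretation l2: semi_hilbert "L2 :: ('a::euclidean_space \<Rightarrow> 'b::euclidean_space) set" l2_ip
proof
  fix f :: "nat \<Rightarrow> 'a \<Rightarrow> 'b"
  assume "\<And>n. f n \<in> L2"
    "\<And>e. e > 0 \<Longrightarrow> \<exists>N. \<forall>m\<ge>N. \<forall>n\<ge>N. l2_ip (\<lambda>x. f m x - f n x) (\<lambda>x. f m x - f n x) < e"
  then show "\<exists>g\<in>L2. (\<lambda>n. l2_ip (\<lambda>x. f n x - g x) (\<lambda>x. f n x - g x)) \<longlonglongrightarrow> 0"
    unfolding l2_ip_self by (rule L2_complete)
qed (auto simp: L2_zero L2_lin l2_ip_def inner_add_left L2_ip_integrable intro!: Bochner_Integration.integral_cong inner_commute)

lemma l2_sq: "l2.sq f = (\<integral>x. (norm (f x))\<^sup>2 \<partial>lborel)"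
  by (simp add: l2.sq_def l2_ip_self)

lemma distr_shift: "distr lborel borel (\<lambda>x. x + h) = (lborel :: 'a::euclidean_space measure)"
proof -
  have "(\<lambda>x. x + h) = (+) h" by (auto simp: add.commute)
  then show ?thesis by (simp add: lborel_distr_plus)
qed

lemma integral_shift:
  fixes f :: "'a::euclidean_space \<Rightarrow> 'b::euclidean_space"
  assumes [measurable]: "f \<in> borel_measurable borel"
  shows "(\<integral>x. f (x + h) \<partial>lborel) = (\<integral>x. f x \<partial>lborel)"
  using integral_distr[of "\<lambda>x. x + h" lborel borel f] by (simp add: distr_shift)

lemma nn_integral_shift:
  fixes f :: "'a::euclidean_space \<Rightarrow> ennreal"
  assumes [measurable]: "f \<in> borel_measurable borel"
  shows "(\<integral>\<^sup>+x. f (x + h) \<partial>lborel) = (\<integral>\<^sup>+x. f x \<partial>lborel)"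
  using nn_integral_distr[of "\<lambda>x. x + h" lborel borel f] by (simp add: distr_shift)

lemma integrable_shift:
  fixes f :: "'a::euclidean_space \<Rightarrow> 'b::euclidean_space"
  assumes "integrable lborel f" shows "integrable lborel (\<lambda>x. f (x + h))"
  using integrable_distr_eq[of "\<lambda>x. x + h" lborel borel f] assms
  by (simp add: distr_shift borel_measurable_integrable)

lemma L2_shift:
  assumes "f \<in> L2" shows "(\<lambda>x. f (x + h)) \<in> L2"
proof (rule L2I)
  note [measurable] = L2_measurable[OF assms]
  show "(\<lambda>x. f (x + h)) \<in> borel_measurable borel" by measurable
  show "integrable lborel (\<lambda>x. (norm (f (x + h)))\<^sup>2)"
    using integrable_shift[OF L2_integrable[OF assms], of h] .
qed

section \<open>Test functions\<close>

lemma frechet_derivativeI: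
  assumes "(f has_derivative f') (at x)" shows "f differentiable (at x)" "frechet_derivative f (at x) = f'"
  using assms frechet_derivative_at by (auto simp: differentiable_def)

lemma frechet_derivativeD: "f differentiable (at x) \<Longrightarrow> (f has_derivative frechet_derivative f (at x)) (at x)"
  by (simp add: frechet_derivative_works)

lemma C_k_SucI:
  assumes "\<And>x. (f has_derivative f' x) (at x)" "\<And>b. b \<in> Basis \<Longrightarrow> C_k k (\<lambda>x. f' x b)"
  shows "C_k (Suc k) f"
  using frechet_derivativeI[OF assms(1)] assms(2) by simp

lemma C_k_SucD:
  assumes "C_k (Suc k) f"
  shows "(f has_derivative frechet_derivative f (at x)) (at x)"
    "b \<in> Basis \<Longrightarrow> C_k k (\<lambda>x. frechet_derivative f (at x) b)"
  using assms by (auto simp: frechet_derivativeD)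

lemma C_k_Suc_imp: "C_k (Suc k) f \<Longrightarrow> C_k k f"
proof (induction k arbitrary: f)
  case 0
  then have "\<forall>x. f differentiable (at x)" by simp
  then show ?case by (auto simp: continuous_on_eq_continuous_at intro: differentiable_imp_continuous_within)
next
  case (Suc k)
  then have d: "\<forall>x. f differentiable (at x)" and p: "\<And>b. b \<in> Basis \<Longrightarrow> C_k (Suc k) (\<lambda>x. frechet_derivative f (at x) b)"
    by (simp_all only: C_k.simps) auto
  show ?case using d Suc.IH[OF p] by simp
qed

lemma C_k_const: "C_k k (\<lambda>x. c)"
proof (induction k arbitrary: c)
  case (Suc k)
  show ?case by (rule C_k_SucI[where f'="\<lambda>_ _. 0"]) (use Suc in auto)
qed simp

lemma C_k_add: "C_k k f \<Longrightarrow> C_k k g \<Longrightarrow> C_k k (\<lambda>x. f x + g x)"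
proof (induction k arbitrary: f g)
  case (Suc k)
  show ?case
    by (rule C_k_SucI[OF has_derivative_add[OF C_k_SucD(1)[OF Suc.prems(1)] C_k_SucD(1)[OF Suc.prems(2)]]])
       (intro Suc.IH C_k_SucD(2)[OF Suc.prems(1)] C_k_SucD(2)[OF Suc.prems(2)])
qed (auto intro: continuous_intros)

lemma C_k_mult: "C_k k f \<Longrightarrow> C_k k g \<Longrightarrow> C_k k (\<lambda>x. f x * g x)"
proof (induction k arbitrary: f g)
  case (Suc k)
  show ?case
    by (rule C_k_SucI[OF has_derivative_mult[OF C_k_SucD(1)[OF Suc.prems(1)] C_k_SucD(1)[OF Suc.prems(2)]]])
       (intro C_k_add Suc.IH C_k_SucD(2)[OF Suc.prems(1)] C_k_SucD(2)[OF Suc.prems(2)]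
          C_k_Suc_imp[OF Suc.prems(1)] C_k_Suc_imp[OF Suc.prems(2)])
qed (auto intro: continuous_intros)

lemma C_k_prod: "finite A \<Longrightarrow> (\<And>i. i \<in> A \<Longrightarrow> C_k k (f i)) \<Longrightarrow> C_k k (\<lambda>x. \<Prod>i\<in>A. f i x)"
  by (induction A rule: finite_induct) (auto intro: C_k_const C_k_mult)

lemma has_derivative_shift:
  assumes "(f has_derivative f') (at (x + c))" shows "((\<lambda>x. f (x + c)) has_derivative f') (at x)"
proof -
  have "((\<lambda>x. x + c) has_derivative (\<lambda>x. x)) (at x)" by (auto intro!: derivative_eq_intros)
  from has_derivative_compose[OF this, of f f'] assms show ?thesis by simp
qed

lemma C_k_shift: "C_k k f \<Longrightarrow> C_k k (\<lambda>x. f (x + c))"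
proof (induction k arbitrary: f)
  case (Suc k)
  show ?case
    by (rule C_k_SucI[OF has_derivative_shift[OF C_k_SucD(1)[OF Suc.prems]]])
       (rule Suc.IH[OF C_k_SucD(2)[OF Suc.prems]])
next
  case 0
  then show ?case
    by (auto intro!: continuous_on_compose2[of UNIV f UNIV] continuous_intros)
qed

text \<open>Here \<open>h 0, h 1, ...\<close> are the successive derivatives of a smooth function of one real variable.\<close>
lemma C_k_inner:
  assumes h: "\<And>j t. (h j has_real_derivative h (Suc j) t) (at t)"
  shows "C_k k (\<lambda>x. h j (x \<bullet> c))"
proof (induction k arbitrary: j)
  case 0
  have "continuous_on UNIV (h j)" by (rule DERIV_continuous_on[of _ _ "h (Suc j)"]) (auto intro: h)
  then show ?case by (auto intro!: continuous_on_compose2[of UNIV "h j" UNIV] continuous_intros)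
next
  case (Suc k)
  have d: "((\<lambda>x. h j (x \<bullet> c)) has_derivative (\<lambda>v. h (Suc j) (x \<bullet> c) * (v \<bullet> c))) (at x)" for x
  proof -
    have "((\<lambda>x. x \<bullet> c) has_derivative (\<lambda>v. v \<bullet> c)) (at x)" by (auto intro!: derivative_eq_intros)
    from has_derivative_compose[OF this, of "h j" "\<lambda>t. h (Suc j) (x \<bullet> c) * t"] h[of j "x \<bullet> c"]
    show ?thesis by (simp add: has_field_derivative_def)
  qed
  show ?case by (rule C_k_SucI[OF d]) (intro C_k_mult C_k_const Suc.IH)
qed

text \<open>The functions \<open>p(1/t) exp(-1/t)\<close>, extended by 0 to \<open>t \<le> 0\<close>, for a polynomial p. This class is closed
under differentiation, so that all its members are smooth; \<open>flat 1\<close> is the classical example of a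
smooth function that vanishes exactly on the nonpositive half-line.\<close>
definition flat :: "real poly \<Rightarrow> real \<Rightarrow> real" where
  "flat p t = (if t > 0 then poly p (1/t) * exp (- (1/t)) else 0)"

lemma poly_exp_tendsto_0: "((\<lambda>x::real. poly p x * exp (- x)) \<longlongrightarrow> 0) at_top"
proof -
  have "((\<lambda>x. \<Sum>i\<le>degree p. coeff p i * (x ^ i / exp x)) \<longlongrightarrow> (\<Sum>i\<le>degree p. coeff p i * 0)) at_top"
    by (intro tendsto_intros tendsto_power_div_exp_0)
  then show ?thesis by (simp add: poly_altdef sum_distrib_right exp_minus divide_inverse mult.assoc)
qed

lemma flat_tendsto_0: "(flat p \<longlongrightarrow> 0) (at 0)"
proof -
  have l: "(flat p \<longlongrightarrow> 0) (at_left 0)"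
    by (rule tendsto_eventually) (auto simp: flat_def eventually_at_filter)
  have "((\<lambda>t::real. poly p (inverse t) * exp (- inverse t)) \<longlongrightarrow> 0) (at_right 0)"
    by (rule filterlim_compose[OF poly_exp_tendsto_0 filterlim_inverse_at_top_right])
  then have r: "(flat p \<longlongrightarrow> 0) (at_right 0)"
    by (rule tendsto_cong[THEN iffD1, rotated])
       (auto simp: flat_def eventually_at_filter inverse_eq_divide)
  show ?thesis using l r by (simp add: filterlim_at_split)
qed

text \<open>The polynomial \<open>X\<^sup>2 (p - p')\<close> of the derivative.\<close>
definition flat_d :: "real poly \<Rightarrow> real poly" where
  "flat_d p = [:0,0,1:] * (p - pderiv p)"

lemma flat_deriv: "(flat p has_real_derivative flat (flat_d p) t) (at t)"
proof -
  consider "t > 0" | "t < 0" | "t = 0" by linarith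
  then show ?thesis
  proof cases
    case 1
    have "((\<lambda>t. poly p (1/t) * exp (- (1/t))) has_real_derivative flat (flat_d p) t) (at t)"
      using 1 by (auto intro!: derivative_eq_intros poly_DERIV[THEN DERIV_chain2]
          simp: flat_def flat_d_def power2_eq_square field_simps)
    then show ?thesis
    proof (rule DERIV_cong_ev[THEN iffD1, OF refl _ refl, rotated])
      show "\<forall>\<^sub>F x in nhds t. poly p (1/x) * exp (- (1/x)) = flat p x"
        using eventually_nhds_in_open[of "{0<..}" t] 1 by (auto simp: flat_def elim!: eventually_mono)
    qed
  next
    case 2
    have "((\<lambda>t. 0) has_real_derivative flat (flat_d p) t) (at t)" using 2 by (auto simp: flat_def)
    then show ?thesis
    proof (rule DERIV_cong_ev[THEN iffD1, OF refl _ refl, rotated])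
      show "\<forall>\<^sub>F x in nhds t. 0 = flat p x"
        using eventually_nhds_in_open[of "{..<0}" t] 2 by (auto simp: flat_def elim!: eventually_mono)
    qed
  next
    case 3
    have "((\<lambda>h. flat p h / h) \<longlongrightarrow> 0) (at 0)"
      by (rule tendsto_cong[THEN iffD1, OF _ flat_tendsto_0[of "[:0,1:] * p"]])
         (auto simp: flat_def eventually_at_filter)
    then show ?thesis using 3 by (simp add: has_field_derivative_iff flat_def)
  qed
qed

lemma C_k_flat: "C_k k (\<lambda>x. flat 1 (c * (x \<bullet> i) + d))"
proof -
  define h where "h j t = c^j * flat ((flat_d ^^ j) 1) (c * t + d)" for j :: nat and t
  have "(h j has_real_derivative h (Suc j) t) (at t)" for j t
    unfolding h_def by (auto intro!: derivative_eq_intros flat_deriv[THEN DERIV_chain2])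
  from C_k_inner[of h, OF this, of k 0 i] show ?thesis by (simp add: h_def)
qed

lemma test_functionI:
  assumes "\<And>k. C_k k \<phi>" "compact K" "\<And>x. x \<notin> K \<Longrightarrow> \<phi> x = 0"
  shows "test_function \<phi>"
proof -
  have "closure {x. \<phi> x \<noteq> 0} \<subseteq> K"
    by (rule closure_minimal) (use assms in \<open>auto intro: compact_imp_closed\<close>)
  then have "compact (closure {x. \<phi> x \<noteq> 0})"
    using assms(2) by (metis closed_closure compact_Int_closed inf.absorb_iff2)
  then show ?thesis using assms(1) by (simp add: test_function_def)
qed

lemma test_functionE:
  assumes "test_function \<phi>"
  obtains K where "compact K" "\<And>x. x \<notin> K \<Longrightarrow> \<phi> x = 0" "\<And>x b. x \<notin> K \<Longrightarrow> frechet_derivative \<phi> (at x) b = 0"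
proof -
  define K where "K = closure {x. \<phi> x \<noteq> 0}"
  have 0: "\<phi> x = 0" if "x \<notin> K" for x using that closure_subset[of "{x. \<phi> x \<noteq> 0}"] by (auto simp: K_def)
  have "frechet_derivative \<phi> (at x) b = 0" if "x \<notin> K" for x b
  proof -
    have "open (- K)" by (auto simp: K_def)
    then have "(\<phi> has_derivative (\<lambda>_. 0)) (at x)"
      by (rule has_derivative_transform_within_open[of "\<lambda>_. 0" _ _ UNIV, OF has_derivative_const])
         (use that 0 in auto)
    then show ?thesis using frechet_derivativeI(2) by metis
  qed
  moreover have "compact K" using assms by (simp add: K_def test_function_def)
  ultimately show ?thesis using 0 by (intro that[of K])
qed

text \<open>A smooth function that is positive exactly on the open box between a and b (for m > 0). Since
\<open>exp(-1/(m t))\<close> is the m-th root of \<open>exp(-1/t)\<close>, these functions increase to the indicator of the box.\<close>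
definition bump :: "'a::euclidean_space \<Rightarrow> 'a \<Rightarrow> nat \<Rightarrow> 'a \<Rightarrow> real" where
  "bump a b m x = (\<Prod>i\<in>Basis. flat 1 (real m * (x \<bullet> i) + - (real m * (a \<bullet> i))) *
                               flat 1 (- real m * (x \<bullet> i) + real m * (b \<bullet> i)))"

lemma flat1_bounds: "0 \<le> flat 1 t" "flat 1 t \<le> 1"
  by (auto simp: flat_def)

lemma bump_bounds: "0 \<le> bump a b m x" "bump a b m x \<le> 1"
  unfolding bump_def by (intro prod_nonneg prod_le_1 ballI conjI mult_le_one flat1_bounds mult_nonneg_nonneg)+

lemma bump_outside: assumes "x \<notin> box a b" shows "bump a b m x = 0"
proof -
  obtain i where i: "i \<in> Basis" "x \<bullet> i \<le> a \<bullet> i \<or> b \<bullet> i \<le> x \<bullet> i"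
    using assms by (auto simp: mem_box not_less)
  then have "\<not> 0 < real m * (x \<bullet> i) + - (real m * (a \<bullet> i)) \<or> \<not> 0 < - real m * (x \<bullet> i) + real m * (b \<bullet> i)"
    by (auto simp: mult_left_mono not_less)
  then have "flat 1 (real m * (x \<bullet> i) + - (real m * (a \<bullet> i))) * flat 1 (- real m * (x \<bullet> i) + real m * (b \<bullet> i)) = 0"
    unfolding flat_def by auto
  with i(1) show ?thesis unfolding bump_def by (intro prod_zero) auto
qed

lemma test_function_bump: "test_function (bump a b m)"
proof (rule test_functionI)
  show "C_k k (bump a b m)" for k
    unfolding bump_def[abs_def] by (intro C_k_prod C_k_mult C_k_flat) auto
  show "compact (cbox a b)" by (rule compact_cbox)
  show "\<And>x. x \<notin> cbox a b \<Longrightarrow> bump a b m x = 0" using bump_outside box_subset_cbox by blast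
qed

lemma flat1_tendsto: assumes "c > 0" shows "(\<lambda>m. flat 1 (real m * c)) \<longlonglongrightarrow> 1"
proof -
  have "(\<lambda>m. exp (- (1 / c) * (1 / real m))) \<longlonglongrightarrow> exp (- (1 / c) * 0)"
    by (intro tendsto_intros lim_1_over_n)
  moreover have "\<forall>\<^sub>F m in sequentially. exp (- (1 / c) * (1 / real m)) = flat 1 (real m * c)"
    using eventually_gt_at_top[of 0] by eventually_elim (use assms in \<open>simp add: flat_def field_simps\<close>)
  ultimately show ?thesis by (simp add: tendsto_cong)
qed

lemma bump_tendsto: "(\<lambda>m. bump a b m x) \<longlonglongrightarrow> indicator (box a b) x"
proof (cases "x \<in> box a b")
  case False then show ?thesis by (simp add: bump_outside)
next
  case True
  have "(\<lambda>m. \<Prod>i\<in>Basis. flat 1 (real m * (x \<bullet> i - a \<bullet> i)) * flat 1 (real m * (b \<bullet> i - x \<bullet> i)))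
     \<longlonglongrightarrow> (\<Prod>i\<in>(Basis::'a set). 1 * 1)"
    by (intro tendsto_prod tendsto_mult flat1_tendsto) (use True in \<open>auto simp: mem_box\<close>)
  then show ?thesis using True by (simp add: bump_def algebra_simps)
qed

lemma test_function_C_k: "test_function \<phi> \<Longrightarrow> C_k k \<phi>" by (simp add: test_function_def)

lemma test_function_continuous: "test_function \<phi> \<Longrightarrow> continuous_on UNIV \<phi>"
  using test_function_C_k[of \<phi> 0] by simp

lemma test_function_measurable: "test_function \<phi> \<Longrightarrow> \<phi> \<in> borel_measurable borel"
  by (intro borel_measurable_continuous_onI test_function_continuous)

lemma test_function_has_derivative:
  "test_function \<phi> \<Longrightarrow> (\<phi> has_derivative frechet_derivative \<phi> (at x)) (at x)"
  by (rule C_k_SucD(1)[OF test_function_C_k])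

lemma test_function_lin:
  assumes "test_function \<phi>" "test_function \<psi>" shows "test_function (\<lambda>x. a * \<phi> x + b * \<psi> x)"
proof -
  obtain K where K: "compact K" "\<And>x. x \<notin> K \<Longrightarrow> \<phi> x = 0" using test_functionE[OF assms(1)] by metis
  obtain K' where K': "compact K'" "\<And>x. x \<notin> K' \<Longrightarrow> \<psi> x = 0" using test_functionE[OF assms(2)] by metis
  show ?thesis
    by (rule test_functionI[where K="K \<union> K'"])
       (intro C_k_add C_k_mult C_k_const test_function_C_k assms, use K K' in \<open>auto intro!: compact_Un\<close>)
qed

lemma test_function_zero: "test_function (\<lambda>x. 0)"
  by (rule test_functionI[where K="{}"]) (auto intro: C_k_const)

lemma test_function_sum:
  "finite A \<Longrightarrow> (\<And>i. i \<in> A \<Longrightarrow> test_function (f i)) \<Longrightarrow> test_function (\<lambda>x. \<Sum>i\<in>A. c i * f i x)"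
proof (induction A rule: finite_induct)
  case (insert i A)
  then show ?case using test_function_lin[of "f i" "\<lambda>x. \<Sum>i\<in>A. c i * f i x" "c i" 1] by auto
qed (auto intro: test_function_zero)

lemma test_function_shift:
  assumes "test_function \<phi>" shows "test_function (\<lambda>x. \<phi> (x + c))"
proof -
  obtain K where K: "compact K" "\<And>x. x \<notin> K \<Longrightarrow> \<phi> x = 0" using test_functionE[OF assms(1)] by metis
  have "\<phi> (x + c) = 0" if "x \<notin> (+) (- c) ` K" for x
    by (rule K(2)) (use that in \<open>force simp: image_iff\<close>)
  then show ?thesis
    by (intro test_functionI[where K="(+) (- c) ` K", OF C_k_shift[OF test_function_C_k[OF assms]]
          compact_translation[OF K(1)]])
qed

lemma frechet_derivative_shift:
  assumes "test_function \<phi>"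
  shows "frechet_derivative (\<lambda>x. \<phi> (x + c)) (at x) = frechet_derivative \<phi> (at (x + c))"
  by (rule frechet_derivativeI(2)[OF has_derivative_shift[OF test_function_has_derivative[OF assms]]])

lemma test_function_deriv_basis:
  assumes "test_function \<phi>" "b \<in> Basis" shows "test_function (\<lambda>x. frechet_derivative \<phi> (at x) b)"
proof -
  obtain K where K: "compact K" "\<And>x b. x \<notin> K \<Longrightarrow> frechet_derivative \<phi> (at x) b = 0"
    using test_functionE[OF assms(1)] by metis
  show ?thesis
    by (rule test_functionI[OF _ K]) (rule C_k_SucD(2)[OF test_function_C_k[OF assms(1)] assms(2)])
qed

lemma frechet_derivative_basis:
  assumes "test_function \<phi>"
  shows "frechet_derivative \<phi> (at x) h = (\<Sum>b\<in>Basis. (h \<bullet> b) * frechet_derivative \<phi> (at x) b)"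
proof -
  have l: "linear (frechet_derivative \<phi> (at x))"
    using test_function_has_derivative[OF assms] by (rule has_derivative_linear)
  have "frechet_derivative \<phi> (at x) (\<Sum>b\<in>Basis. (h \<bullet> b) *\<^sub>R b) = (\<Sum>b\<in>Basis. (h \<bullet> b) *\<^sub>R frechet_derivative \<phi> (at x) b)"
    by (simp add: linear_sum[OF l] linear_cmul[OF l])
  then show ?thesis by (simp add: euclidean_representation)
qed

lemma test_function_deriv:
  assumes "test_function \<phi>" shows "test_function (\<lambda>x. frechet_derivative \<phi> (at x) h)"
  unfolding frechet_derivative_basis[OF assms, of _ h]
  by (intro test_function_sum test_function_deriv_basis assms finite_Basis)

lemma test_function_bounded:
  assumes "test_function \<phi>" obtains B where "B \<ge> 0" "\<And>x. \<bar>\<phi> x\<bar> \<le> B"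
proof -
  obtain K where K: "compact K" "\<And>x. x \<notin> K \<Longrightarrow> \<phi> x = 0" using test_functionE[OF assms(1)] by metis
  have "compact (\<phi> ` K)"
    by (rule compact_continuous_image[OF continuous_on_subset[OF test_function_continuous[OF assms]] K(1)]) simp
  then obtain B where "\<And>x. x \<in> K \<Longrightarrow> \<bar>\<phi> x\<bar> \<le> B" using compact_imp_bounded[of "\<phi> ` K"] unfolding bounded_iff by (metis imageI real_norm_def)
  then show ?thesis using that[of "max B 0"] K(2) by (metis abs_zero max.cobounded1 max.cobounded2 order_trans)
qed

lemma test_function_L2:
  assumes "test_function \<phi>" shows "\<phi> \<in> L2"
proof -
  obtain K where K: "compact K" "\<And>x. x \<notin> K \<Longrightarrow> \<phi> x = 0" using test_functionE[OF assms(1)] by metis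
  obtain B where B: "B \<ge> 0" "\<And>x. \<bar>\<phi> x\<bar> \<le> B" using test_function_bounded[OF assms] by metis
  note [measurable] = test_function_measurable[OF assms]
  have "integrable lborel (\<lambda>x. B\<^sup>2 * indicator K x :: real)"
    by (intro integrable_mult_right integrable_real_indicator)
       (use K(1) emeasure_bounded_finite[of K] in \<open>auto simp: compact_imp_bounded intro: borel_compact\<close>)
  then have "integrable lborel (\<lambda>x. (norm (\<phi> x))\<^sup>2)"
    by (rule Bochner_Integration.integrable_bound)
       (use B(1) power_mono[OF B(2), of _ 2] K(2) in \<open>auto intro!: AE_I2 simp: indicator_def\<close>)
  then show ?thesis by (intro L2I) auto
qed

section \<open>The fundamental lemma and weak gradients\<close>

lemma L2_indicator:
  assumes [measurable]: "A \<in> sets borel" and "emeasure lborel A < \<infinity>"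
  shows "(indicator A :: 'a::euclidean_space \<Rightarrow> real) \<in> L2"
proof (rule L2I)
  have "(\<lambda>x. (norm (indicator A x :: real))\<^sup>2) = indicator A" by (auto simp: indicator_def)
  then show "integrable lborel (\<lambda>x. (norm (indicator A x :: real))\<^sup>2)"
    using assms by simp
qed measurable

lemma L2_mult_integrable:
  fixes u v :: "'a::euclidean_space \<Rightarrow> real"
  assumes "u \<in> L2" "v \<in> L2" shows "integrable lborel (\<lambda>x. u x * v x)"
  using L2_ip_integrable[OF assms] by simp

lemma L2_integrable_on_box:
  fixes u :: "'a::euclidean_space \<Rightarrow> real"
  assumes "u \<in> L2" shows "integrable lborel (\<lambda>x. u x * indicator (box a b) x)"
  by (rule L2_mult_integrable[OF assms L2_indicator]) (use emeasure_lborel_box_finite[of a b] in \<open>auto simp: less_top\<close>)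

text \<open>The positive and the negative part of h are densities of measures that agree on all open boxes, hence
on all Borel sets.\<close>
lemma AE_zero_from_boxes:
  fixes h :: "'a::euclidean_space \<Rightarrow> real"
  assumes [measurable]: "h \<in> borel_measurable borel"
    and int: "\<And>a b. integrable lborel (\<lambda>x. h x * indicator (box a b) x)"
    and zero: "\<And>a b. (\<integral>x. h x * indicator (box a b) x \<partial>lborel) = 0"
  shows "AE x in lborel. h x = 0"
proof -
  let ?P = "density lborel (\<lambda>x. ennreal (h x))"
  let ?N = "density lborel (\<lambda>x. ennreal (- h x))"
  let ?E = "range (\<lambda>(a, b). box a b::'a set)"
  have box: "emeasure ?P (box a b) = emeasure ?N (box a b)" "emeasure ?P (box a b) < \<infinity>" for a b
  proof -
    let ?f = "\<lambda>x. h x * indicator (box a b) x"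
    have pos: "emeasure ?P (box a b) = ennreal (\<integral>x. max 0 (?f x) \<partial>lborel)"
    proof -
      have "emeasure ?P (box a b) = (\<integral>\<^sup>+x. ennreal (max 0 (?f x)) \<partial>lborel)"
        by (subst emeasure_density) (auto intro!: nn_integral_cong simp: indicator_def max_def ennreal_neg)
      also have "\<dots> = ennreal (\<integral>x. max 0 (?f x) \<partial>lborel)"
        by (rule nn_integral_eq_integral) (auto intro!: integrable_max int)
      finally show ?thesis .
    qed
    have neg: "emeasure ?N (box a b) = ennreal (\<integral>x. max 0 (- ?f x) \<partial>lborel)"
    proof -
      have "emeasure ?N (box a b) = (\<integral>\<^sup>+x. ennreal (max 0 (- ?f x)) \<partial>lborel)"
        by (subst emeasure_density) (auto intro!: nn_integral_cong simp: indicator_def max_def ennreal_neg)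
      also have "\<dots> = ennreal (\<integral>x. max 0 (- ?f x) \<partial>lborel)"
        by (rule nn_integral_eq_integral) (auto intro!: integrable_max integrable_minus int)
      finally show ?thesis .
    qed
    have "(\<integral>x. max 0 (?f x) \<partial>lborel) - (\<integral>x. max 0 (- ?f x) \<partial>lborel) = (\<integral>x. max 0 (?f x) - max 0 (- ?f x) \<partial>lborel)"
      by (intro Bochner_Integration.integral_diff[symmetric] integrable_max integrable_minus int) auto
    also have "\<dots> = (\<integral>x. ?f x \<partial>lborel)"
      by (intro Bochner_Integration.integral_cong refl) (auto simp: max_def)
    finally show "emeasure ?P (box a b) = emeasure ?N (box a b)" "emeasure ?P (box a b) < \<infinity>"
      using zero pos neg by auto
  qed
  have "?P = ?N"
  proof (rule measure_eqI_generator_eq)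
    show "Int_stable ?E" by (auto simp: Int_stable_def box_Int_box)
    show "?E \<subseteq> Pow UNIV" "sets ?P = sigma_sets UNIV ?E" "sets ?N = sigma_sets UNIV ?E"
      by (simp_all add: borel_eq_box)
    let ?A = "\<lambda>n::nat. box (- (real n *\<^sub>R One)) (real n *\<^sub>R One) :: 'a set"
    show "range ?A \<subseteq> ?E" "(\<Union>i. ?A i) = UNIV" unfolding UN_box_eq_UNIV by auto
    show "emeasure ?P (?A i) \<noteq> \<infinity>" for i using box(2)[of "- (real i *\<^sub>R One)" "real i *\<^sub>R One"] by simp
    show "emeasure ?P X = emeasure ?N X" if "X \<in> ?E" for X using that box(1) by auto
  qed
  then have "AE x in lborel. ennreal (h x) = ennreal (- h x)"
    by (subst (asm) sigma_finite_measure.density_unique_iff[OF sigma_finite_lborel]) auto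
  then show ?thesis
  proof eventually_elim
    case (elim x)
    then show "h x = 0" by (cases "h x" "0 :: real" rule: linorder_cases) (auto simp: ennreal_neg)
  qed
qed

text \<open>The fundamental lemma of the calculus of variations: the bumps approximate indicators of boxes.\<close>
lemma fundamental_lemma:
  fixes h :: "'a::euclidean_space \<Rightarrow> real"
  assumes h: "h \<in> L2" and zero: "\<And>\<phi>. test_function \<phi> \<Longrightarrow> (\<integral>x. h x * \<phi> x \<partial>lborel) = 0"
  shows "AE x in lborel. h x = 0"
proof (rule AE_zero_from_boxes)
  note [measurable] = L2_measurable[OF h]
  show "h \<in> borel_measurable borel" by fact
  show int: "integrable lborel (\<lambda>x. h x * indicator (box a b) x)" for a b by (rule L2_integrable_on_box[OF h])
  show "(\<integral>x. h x * indicator (box a b) x \<partial>lborel) = 0" for a b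
  proof -
    note [measurable] = test_function_measurable[OF test_function_bump]
    have "(\<lambda>m. \<integral>x. h x * bump a b m x \<partial>lborel) \<longlonglongrightarrow> (\<integral>x. h x * indicator (box a b) x \<partial>lborel)"
    proof (rule integral_dominated_convergence)
      show "integrable lborel (\<lambda>x. norm (h x * indicator (box a b) x))" using int by (rule integrable_norm)
      show "AE x in lborel. (\<lambda>m. h x * bump a b m x) \<longlonglongrightarrow> h x * indicator (box a b) x"
        by (intro AE_I2 tendsto_intros bump_tendsto)
      show "AE x in lborel. norm (h x * bump a b m x) \<le> norm (h x * indicator (box a b) x)" for m
      proof (rule AE_I2)
        fix x
        show "norm (h x * bump a b m x) \<le> norm (h x * indicator (box a b) x)"
          using bump_bounds[of a b m x] bump_outside[of x a b m]
          by (cases "x \<in> box a b") (auto simp: abs_mult mult_left_le)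
      qed
    qed measurable
    then show ?thesis by (simp add: zero test_function_bump LIMSEQ_const_iff)
  qed
qed

lemma subsp_test_functions: "l2.subsp {\<phi>::'a::euclidean_space \<Rightarrow> real. test_function \<phi>}"
  by (auto simp: l2.subsp_def test_function_L2 test_function_zero test_function_lin)

lemma test_functions_dense:
  fixes f :: "'a::euclidean_space \<Rightarrow> real"
  assumes "f \<in> L2"
  obtains w where "\<And>n::nat. test_function (w n)" "(\<lambda>n. l2.sq (\<lambda>x. w n x - f x)) \<longlonglongrightarrow> 0"
proof -
  have "l2.sq v = 0" if v: "v \<in> L2" and o: "\<And>w. w \<in> {\<phi>. test_function \<phi>} \<Longrightarrow> l2_ip v w = 0" for v :: "'a \<Rightarrow> real"
  proof -
    have "AE x in lborel. v x = 0" by (rule fundamental_lemma[OF v]) (use o in \<open>auto simp: l2_ip_def\<close>)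
    then have "(\<integral>x. (norm (v x))\<^sup>2 \<partial>lborel) = (\<integral>x. 0 \<partial>(lborel :: 'a measure))"
      using L2_measurable[OF v] by (intro integral_cong_AE) auto
    then show ?thesis by (simp add: l2_sq)
  qed
  from l2.dense_subspace[OF subsp_test_functions assms this]
  obtain w where "\<And>n::nat. w n \<in> {\<phi>. test_function \<phi>}" "(\<lambda>n. l2.sq (\<lambda>x. w n x - f x)) \<longlonglongrightarrow> 0" by blast
  then show ?thesis by (intro that[of w]) auto
qed

lemma l2_ip_cong_AE:
  assumes "AE x in lborel. f x = f' x" "AE x in lborel. g x = g' x" "f \<in> L2" "f' \<in> L2" "g \<in> L2" "g' \<in> L2"
  shows "l2_ip f g = l2_ip f' g'"
proof -
  note [measurable] = L2_measurable[OF assms(3)] L2_measurable[OF assms(4)] L2_measurable[OF assms(5)] L2_measurable[OF assms(6)]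
  show ?thesis unfolding l2_ip_def by (rule integral_cong_AE) (use assms(1,2) in auto)
qed

lemma L2_component:
  assumes g: "(g :: 'a::euclidean_space \<Rightarrow> 'b::euclidean_space) \<in> L2" and b: "b \<in> Basis" shows "(\<lambda>x. g x \<bullet> b) \<in> L2"
proof (rule L2_bound[OF _ g])
  note [measurable] = L2_measurable[OF g]
  show "(\<lambda>x. g x \<bullet> b) \<in> borel_measurable borel" by measurable
  show "norm (g x \<bullet> b) \<le> norm (g x)" for x using Basis_le_norm[OF b] by simp
qed

lemma L2_times_vector:
  assumes g: "(\<phi> :: 'a::euclidean_space \<Rightarrow> real) \<in> L2" shows "(\<lambda>x. \<phi> x *\<^sub>R (b :: 'b::euclidean_space)) \<in> L2"
proof (rule L2I)
  note [measurable] = L2_measurable[OF g]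
  show "(\<lambda>x. \<phi> x *\<^sub>R b) \<in> borel_measurable borel" by measurable
  show "integrable lborel (\<lambda>x. (norm (\<phi> x *\<^sub>R b))\<^sup>2)"
    using integrable_mult_right[OF L2_integrable[OF g], of "(norm b)\<^sup>2"] by (simp add: power_mult_distrib mult.commute)
qed

lemma is_weak_gradient_altdef:
  "is_weak_gradient u g \<longleftrightarrow> (\<forall>\<phi>. test_function \<phi> \<longrightarrow> (\<forall>b\<in>Basis.
     l2_ip u (\<lambda>x. frechet_derivative \<phi> (at x) b) = - l2_ip g (\<lambda>x. \<phi> x *\<^sub>R b)))"
  by (simp add: is_weak_gradient_def l2_ip_def mult.commute)

lemma is_weak_gradient_unique:
  fixes u :: "'a::euclidean_space \<Rightarrow> real"
  assumes g: "g \<in> L2" "is_weak_gradient u g" and g': "g' \<in> L2" "is_weak_gradient u g'"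
  shows "AE x in lborel. g x = g' x"
proof -
  have "AE x in lborel. (g x - g' x) \<bullet> b = 0" if b: "b \<in> Basis" for b
  proof (rule fundamental_lemma)
    show "(\<lambda>x. (g x - g' x) \<bullet> b) \<in> L2" by (rule L2_component[OF l2.diff_mem[OF g(1) g'(1)] b])
    fix \<phi> :: "'a \<Rightarrow> real" assume \<phi>: "test_function \<phi>"
    have "l2_ip g (\<lambda>x. \<phi> x *\<^sub>R b) = l2_ip g' (\<lambda>x. \<phi> x *\<^sub>R b)"
      using g(2) g'(2) \<phi> b unfolding is_weak_gradient_altdef by (metis neg_equal_iff_equal)
    then have "l2_ip (\<lambda>x. g x - g' x) (\<lambda>x. \<phi> x *\<^sub>R b) = 0"
      by (simp add: l2.ip_diff g g' L2_times_vector test_function_L2 \<phi>)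
    then show "(\<integral>x. (g x - g' x) \<bullet> b * \<phi> x \<partial>lborel) = 0" by (simp add: l2_ip_def mult.commute)
  qed
  then have "AE x in lborel. \<forall>b\<in>Basis. (g x - g' x) \<bullet> b = 0" by (intro AE_finite_allI) auto
  then show ?thesis by eventually_elim (metis euclidean_all_zero_iff eq_iff_diff_eq_0)
qed

lemma is_weak_gradient_lin:
  fixes u v :: "'a::euclidean_space \<Rightarrow> real"
  assumes "u \<in> L2" "v \<in> L2" "g \<in> L2" "h \<in> L2" "is_weak_gradient u g" "is_weak_gradient v h"
  shows "is_weak_gradient (\<lambda>x. a *\<^sub>R u x + b *\<^sub>R v x) (\<lambda>x. a *\<^sub>R g x + b *\<^sub>R h x)"
  unfolding is_weak_gradient_altdef
proof (intro allI impI ballI)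
  fix \<phi> :: "'a \<Rightarrow> real" and c :: 'a assume \<phi>: "test_function \<phi>" and c: "c \<in> Basis"
  have "l2_ip u (\<lambda>x. frechet_derivative \<phi> (at x) c) = - l2_ip g (\<lambda>x. \<phi> x *\<^sub>R c)"
    "l2_ip v (\<lambda>x. frechet_derivative \<phi> (at x) c) = - l2_ip h (\<lambda>x. \<phi> x *\<^sub>R c)"
    using assms(5,6) \<phi> c by (auto simp: is_weak_gradient_altdef)
  then show "l2_ip (\<lambda>x. a *\<^sub>R u x + b *\<^sub>R v x) (\<lambda>x. frechet_derivative \<phi> (at x) c) =
      - l2_ip (\<lambda>x. a *\<^sub>R g x + b *\<^sub>R h x) (\<lambda>x. \<phi> x *\<^sub>R c)"
    using assms(1-4) \<phi> by (simp only: l2.ip_lin test_function_L2 test_function_deriv L2_times_vector)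
qed

lemma is_weak_gradient_shift:
  fixes u :: "'a::euclidean_space \<Rightarrow> real"
  assumes u: "u \<in> L2" and g: "g \<in> L2" and wg: "is_weak_gradient u g"
  shows "is_weak_gradient (\<lambda>x. u (x + y)) (\<lambda>x. g (x + y))"
  unfolding is_weak_gradient_def
proof (intro allI impI ballI)
  fix \<phi> :: "'a \<Rightarrow> real" and c :: 'a assume \<phi>: "test_function \<phi>" and c: "c \<in> Basis"
  define \<psi> where "\<psi> x = \<phi> (x + - y)" for x
  have \<psi>: "test_function \<psi>" unfolding \<psi>_def by (rule test_function_shift[OF \<phi>])
  have d: "frechet_derivative \<psi> (at x) = frechet_derivative \<phi> (at (x + - y))" for x
    unfolding \<psi>_def by (rule frechet_derivative_shift[OF \<phi>])
  note [measurable] = L2_measurable[OF u] L2_measurable[OF g] test_function_measurable[OF \<psi>]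
    test_function_measurable[OF test_function_deriv[OF \<psi>]]
  have "(\<integral>x. u (x + y) * frechet_derivative \<phi> (at x) c \<partial>lborel)
      = (\<integral>x. u (x + y) * frechet_derivative \<psi> (at (x + y)) c \<partial>lborel)" by (simp add: d)
  also have "\<dots> = (\<integral>x. u x * frechet_derivative \<psi> (at x) c \<partial>lborel)"
    by (rule integral_shift[of "\<lambda>x. u x * frechet_derivative \<psi> (at x) c"]) measurable
  also have "\<dots> = - (\<integral>x. (g x \<bullet> c) * \<psi> x \<partial>lborel)" using wg \<psi> c by (simp add: is_weak_gradient_def)
  also have "(\<integral>x. (g x \<bullet> c) * \<psi> x \<partial>lborel) = (\<integral>x. (g (x + y) \<bullet> c) * \<psi> (x + y) \<partial>lborel)"
    by (rule integral_shift[of "\<lambda>x. (g x \<bullet> c) * \<psi> x", symmetric]) measurable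
  finally show "(\<integral>x. u (x + y) * frechet_derivative \<phi> (at x) c \<partial>lborel) = - (\<integral>x. (g (x + y) \<bullet> c) * \<phi> x \<partial>lborel)"
    by (simp add: \<psi>_def)
qed

section \<open>The Hilbert space H1\<close>

lemma H1_L2: "u \<in> H1 \<Longrightarrow> u \<in> L2" by (simp add: H1_def)

lemma weak_gradient_props:
  assumes "u \<in> H1" shows "weak_gradient u \<in> L2" "is_weak_gradient u (weak_gradient u)"
proof -
  have "\<exists>g. g \<in> L2 \<and> is_weak_gradient u g" using assms by (auto simp: H1_def)
  from someI_ex[OF this] show "weak_gradient u \<in> L2" "is_weak_gradient u (weak_gradient u)"
    by (auto simp: weak_gradient_def)
qed

lemma weak_gradient_unique:
  assumes "u \<in> L2" "g \<in> L2" "is_weak_gradient u g"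
  shows "u \<in> H1" "AE x in lborel. weak_gradient u x = g x"
proof -
  show u: "u \<in> H1" using assms by (auto simp: H1_def)
  show "AE x in lborel. weak_gradient u x = g x"
    by (rule is_weak_gradient_unique[OF weak_gradient_props[OF u] assms(2,3)])
qed

lemma
  assumes u: "u \<in> H1" and v: "v \<in> H1"
  shows H1_lin: "(\<lambda>x. a *\<^sub>R u x + b *\<^sub>R v x) \<in> H1"
    and weak_gradient_lin: "AE x in lborel. weak_gradient (\<lambda>x. a *\<^sub>R u x + b *\<^sub>R v x) x = a *\<^sub>R weak_gradient u x + b *\<^sub>R weak_gradient v x"
  using weak_gradient_unique[OF L2_lin[OF H1_L2[OF u] H1_L2[OF v]]
     L2_lin[OF weak_gradient_props(1)[OF u] weak_gradient_props(1)[OF v]]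
     is_weak_gradient_lin[OF H1_L2[OF u] H1_L2[OF v] weak_gradient_props(1)[OF u] weak_gradient_props(1)[OF v]
        weak_gradient_props(2)[OF u] weak_gradient_props(2)[OF v]]] by auto

lemma
  assumes u: "u \<in> H1"
  shows H1_shift: "(\<lambda>x. u (x + y)) \<in> H1"
    and weak_gradient_shift: "AE x in lborel. weak_gradient (\<lambda>x. u (x + y)) x = weak_gradient u (x + y)"
  using weak_gradient_unique[OF L2_shift[OF H1_L2[OF u]] L2_shift[OF weak_gradient_props(1)[OF u]]
     is_weak_gradient_shift[OF H1_L2[OF u] weak_gradient_props[OF u]]] by auto

lemma H1_zero: "(\<lambda>x. 0) \<in> H1"
  by (rule weak_gradient_unique(1)[of _ "\<lambda>x. 0"]) (auto simp: L2_zero is_weak_gradient_def)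

text \<open>The bilinear form of the Dirichlet integral, and the inner product of H1. The weak gradient is chosen
only up to null sets, so these forms are bilinear although \<open>weak_gradient\<close> is linear only almost everywhere.\<close>
definition dir_ip :: "('a::euclidean_space \<Rightarrow> real) \<Rightarrow> ('a \<Rightarrow> real) \<Rightarrow> real" where
  "dir_ip u v = l2_ip (weak_gradient u) (weak_gradient v)"

definition h1_ip :: "('a::euclidean_space \<Rightarrow> real) \<Rightarrow> ('a \<Rightarrow> real) \<Rightarrow> real" where
  "h1_ip u v = l2_ip u v + dir_ip u v"

lemma dirichlet_eq: "dirichlet_integral u = dir_ip u u"
  by (simp add: dirichlet_integral_def dir_ip_def l2_ip_self)

lemma dir_ip_commute: "dir_ip u v = dir_ip v u"
  by (simp add: dir_ip_def l2_ip_def inner_commute)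

lemma l2_ip_commute: "l2_ip u v = l2_ip v u"
  by (simp add: l2_ip_def inner_commute)

lemma dir_ip_lin:
  assumes "u \<in> H1" "v \<in> H1" "w \<in> H1"
  shows "dir_ip (\<lambda>x. a *\<^sub>R u x + b *\<^sub>R v x) w = a * dir_ip u w + b * dir_ip v w"
proof -
  have "dir_ip (\<lambda>x. a *\<^sub>R u x + b *\<^sub>R v x) w = l2_ip (\<lambda>x. a *\<^sub>R weak_gradient u x + b *\<^sub>R weak_gradient v x) (weak_gradient w)"
    unfolding dir_ip_def
    by (intro l2_ip_cong_AE weak_gradient_lin assms weak_gradient_props L2_lin H1_lin) simp
  then show ?thesis using assms by (simp add: l2.ip_lin weak_gradient_props dir_ip_def)
qed

lemma dir_ip_shift:
  assumes "u \<in> H1" "v \<in> H1" shows "dir_ip (\<lambda>x. u (x + y)) (\<lambda>x. v (x + y)) = dir_ip u v"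
proof -
  note [measurable] = L2_measurable[OF weak_gradient_props(1)[OF assms(1)]] L2_measurable[OF weak_gradient_props(1)[OF assms(2)]]
  have "dir_ip (\<lambda>x. u (x + y)) (\<lambda>x. v (x + y)) = l2_ip (\<lambda>x. weak_gradient u (x + y)) (\<lambda>x. weak_gradient v (x + y))"
    unfolding dir_ip_def by (intro l2_ip_cong_AE weak_gradient_shift assms weak_gradient_props L2_shift H1_shift)
  also have "\<dots> = dir_ip u v" unfolding dir_ip_def l2_ip_def
    by (rule integral_shift[of "\<lambda>x. weak_gradient u x \<bullet> weak_gradient v x"]) measurable
  finally show ?thesis .
qed

lemma l2_ip_shift:
  assumes "u \<in> L2" "v \<in> L2" shows "l2_ip (\<lambda>x. u (x + y)) (\<lambda>x. v (x + y)) = l2_ip u v"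
proof -
  note [measurable] = L2_measurable[OF assms(1)] L2_measurable[OF assms(2)]
  show ?thesis unfolding l2_ip_def
    by (rule integral_shift[of "\<lambda>x. u x \<bullet> v x"]) measurable
qed

lemma weak_gradient_diff:
  assumes "u \<in> H1" "v \<in> H1"
  shows "AE x in lborel. weak_gradient (\<lambda>x. u x - v x) x = weak_gradient u x - weak_gradient v x"
  using weak_gradient_lin[OF assms, of 1 "-1"] by simp

lemma dir_ip_diff_self:
  assumes "u \<in> H1" "v \<in> H1"
  shows "dir_ip (\<lambda>x. u x - v x) (\<lambda>x. u x - v x) = l2.sq (\<lambda>x. weak_gradient u x - weak_gradient v x)"
proof -
  have d: "(\<lambda>x. u x - v x) \<in> H1" using H1_lin[OF assms, of 1 "-1"] by simp
  show ?thesis unfolding dir_ip_def l2.sq_def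
    by (intro l2_ip_cong_AE weak_gradient_diff assms weak_gradient_props d l2.diff_mem)
qed

lemma H1_complete:
  fixes f :: "nat \<Rightarrow> 'a::euclidean_space \<Rightarrow> real"
  assumes f: "\<And>n. f n \<in> H1"
    and Cauchy: "\<And>e. e > 0 \<Longrightarrow> \<exists>N. \<forall>m\<ge>N. \<forall>n\<ge>N. h1_ip (\<lambda>x. f m x - f n x) (\<lambda>x. f m x - f n x) < e"
  shows "\<exists>g\<in>H1. (\<lambda>n. h1_ip (\<lambda>x. f n x - g x) (\<lambda>x. f n x - g x)) \<longlonglongrightarrow> 0"
proof -
  let ?G = "\<lambda>n. weak_gradient (f n)"
  note fL = H1_L2[OF f] and GL = weak_gradient_props(1)[OF f]
  have eq: "h1_ip (\<lambda>x. f m x - f n x) (\<lambda>x. f m x - f n x) = l2.sq (\<lambda>x. f m x - f n x) + l2.sq (\<lambda>x. ?G m x - ?G n x)" for m n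
    by (simp add: h1_ip_def dir_ip_diff_self f l2.sq_def)
  have nn: "0 \<le> l2.sq (\<lambda>x. f m x - f n x)" "0 \<le> l2.sq (\<lambda>x. ?G m x - ?G n x)" for m n
    by (simp_all add: l2_sq)
  have "\<exists>u\<in>L2. (\<lambda>n. l2_ip (\<lambda>x. f n x - u x) (\<lambda>x. f n x - u x)) \<longlonglongrightarrow> 0"
  proof (rule l2.complete[OF fL])
    fix e :: real assume "e > 0"
    from Cauchy[OF this] show "\<exists>N. \<forall>m\<ge>N. \<forall>n\<ge>N. l2_ip (\<lambda>x. f m x - f n x) (\<lambda>x. f m x - f n x) < e"
      unfolding eq l2.sq_def[symmetric] using nn(2) by (meson le_less_trans le_add_same_cancel1)
  qed
  then obtain u where u: "u \<in> L2" "(\<lambda>n. l2.sq (\<lambda>x. f n x - u x)) \<longlonglongrightarrow> 0" by (auto simp: l2.sq_def)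
  have "\<exists>g\<in>L2. (\<lambda>n. l2_ip (\<lambda>x. ?G n x - g x) (\<lambda>x. ?G n x - g x)) \<longlonglongrightarrow> 0"
  proof (rule l2.complete[OF GL])
    fix e :: real assume "e > 0"
    from Cauchy[OF this] show "\<exists>N. \<forall>m\<ge>N. \<forall>n\<ge>N. l2_ip (\<lambda>x. ?G m x - ?G n x) (\<lambda>x. ?G m x - ?G n x) < e"
      unfolding eq l2.sq_def[symmetric] using nn(1) by (meson le_less_trans le_add_same_cancel2)
  qed
  then obtain g where g: "g \<in> L2" "(\<lambda>n. l2.sq (\<lambda>x. ?G n x - g x)) \<longlonglongrightarrow> 0" by (auto simp: l2.sq_def)
  have "is_weak_gradient u g" unfolding is_weak_gradient_altdef
  proof (intro allI impI ballI)
    fix \<phi> :: "'a \<Rightarrow> real" and c :: 'a assume \<phi>: "test_function \<phi>" and c: "c \<in> Basis"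
    have "(\<lambda>n. l2_ip (f n) (\<lambda>x. frechet_derivative \<phi> (at x) c)) \<longlonglongrightarrow> l2_ip u (\<lambda>x. frechet_derivative \<phi> (at x) c)"
      by (intro l2.ip_tendsto fL u test_function_L2 test_function_deriv \<phi>)
    moreover have "(\<lambda>n. - l2_ip (?G n) (\<lambda>x. \<phi> x *\<^sub>R c)) \<longlonglongrightarrow> - l2_ip g (\<lambda>x. \<phi> x *\<^sub>R c)"
      by (intro tendsto_minus l2.ip_tendsto GL g test_function_L2 L2_times_vector \<phi>)
    moreover have "l2_ip (f n) (\<lambda>x. frechet_derivative \<phi> (at x) c) = - l2_ip (?G n) (\<lambda>x. \<phi> x *\<^sub>R c)" for n
      using weak_gradient_props(2)[OF f[of n]] \<phi> c by (auto simp: is_weak_gradient_altdef)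
    ultimately show "l2_ip u (\<lambda>x. frechet_derivative \<phi> (at x) c) = - l2_ip g (\<lambda>x. \<phi> x *\<^sub>R c)"
      using LIMSEQ_unique by auto
  qed
  from weak_gradient_unique[OF u(1) g(1) this]
  have uH: "u \<in> H1" and ug: "AE x in lborel. weak_gradient u x = g x" by auto
  have "h1_ip (\<lambda>x. f n x - u x) (\<lambda>x. f n x - u x) = l2.sq (\<lambda>x. f n x - u x) + l2.sq (\<lambda>x. ?G n x - g x)" for n
  proof -
    have "l2.sq (\<lambda>x. ?G n x - weak_gradient u x) = l2.sq (\<lambda>x. ?G n x - g x)"
      unfolding l2.sq_def
      by (rule l2_ip_cong_AE; (rule l2.diff_mem)?) (use ug in \<open>auto simp: GL g weak_gradient_props uH l2.diff_mem\<close>)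
    then show ?thesis by (simp add: h1_ip_def dir_ip_diff_self f uH l2.sq_def)
  qed
  then have "(\<lambda>n. h1_ip (\<lambda>x. f n x - u x) (\<lambda>x. f n x - u x)) \<longlonglongrightarrow> 0"
    using tendsto_add[OF u(2) g(2)] by simp
  with uH show ?thesis by blast
qed

interpretation h1: semi_hilbert "H1 :: ('a::euclidean_space \<Rightarrow> real) set" h1_ip
proof
  fix f :: "nat \<Rightarrow> 'a \<Rightarrow> real"
  assume "\<And>n. f n \<in> H1"
    "\<And>e. e > 0 \<Longrightarrow> \<exists>N. \<forall>m\<ge>N. \<forall>n\<ge>N. h1_ip (\<lambda>x. f m x - f n x) (\<lambda>x. f m x - f n x) < e"
  then show "\<exists>g\<in>H1. (\<lambda>n. h1_ip (\<lambda>x. f n x - g x) (\<lambda>x. f n x - g x)) \<longlonglongrightarrow> 0" by (rule H1_complete)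
next
  fix a b and u v w :: "'a \<Rightarrow> real" assume H: "u \<in> H1" "v \<in> H1" "w \<in> H1"
  show "h1_ip (\<lambda>x. a *\<^sub>R u x + b *\<^sub>R v x) w = a * h1_ip u w + b * h1_ip v w"
    unfolding h1_ip_def dir_ip_lin[OF H] using l2.ip_lin[OF H1_L2[OF H(1)] H1_L2[OF H(2)] H1_L2[OF H(3)]]
    by (simp add: algebra_simps)
next
  fix u v :: "'a \<Rightarrow> real"
  show "h1_ip u v = h1_ip v u" by (simp add: h1_ip_def l2_ip_commute[of u] dir_ip_commute[of u])
  show "0 \<le> h1_ip u u" by (simp add: h1_ip_def dir_ip_def l2_ip_self)
qed (use H1_zero H1_lin in auto)

lemma H1_norm_eq: "H1_norm u = sqrt (h1.sq u)"
  by (simp add: H1_norm_def h1.sq_def h1_ip_def dirichlet_eq l2_ip_self)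

lemma h1_sq: "h1.sq u = l2.sq u + dirichlet_integral u"
  by (simp add: h1.sq_def h1_ip_def dirichlet_eq l2.sq_def)

lemma dirichlet_nonneg: "0 \<le> dirichlet_integral u" by (simp add: dirichlet_integral_def)
lemma l2_sq_nonneg: "0 \<le> l2.sq u" by (simp add: l2_sq)
lemma h1_sq_nonneg: "0 \<le> h1.sq u" by (simp add: h1_sq dirichlet_nonneg l2_sq_nonneg)

lemma h1_sq_shift: "u \<in> H1 \<Longrightarrow> h1.sq (\<lambda>t. u (t + x)) = h1.sq u"
  unfolding h1.sq_def h1_ip_def by (simp add: l2_ip_shift dir_ip_shift H1_L2)

section \<open>Weak convergence\<close>

lemma H1_weakly_convergesI:
  assumes f: "\<And>n. f n \<in> H1" and g: "g \<in> H1"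
    and lim: "\<And>\<phi>. \<phi> \<in> H1 \<Longrightarrow> (\<lambda>n. h1_ip (f n) \<phi>) \<longlonglongrightarrow> h1_ip g \<phi>"
  shows "H1_weakly_converges f g"
  unfolding H1_weakly_converges_def
proof (intro conjI allI ballI f g)
  fix L :: "('a \<Rightarrow> real) \<Rightarrow> real" assume L: "L \<in> H1_dual"
  then obtain C where add: "\<And>u v. u \<in> H1 \<Longrightarrow> v \<in> H1 \<Longrightarrow> L (\<lambda>x. u x + v x) = L u + L v"
    and scale: "\<And>c u. u \<in> H1 \<Longrightarrow> L (\<lambda>x. c * u x) = c * L u"
    and bd: "\<And>u. u \<in> H1 \<Longrightarrow> \<bar>L u\<bar> \<le> C * sqrt (h1.sq u)"
    unfolding H1_dual_def H1_norm_eq by blast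
  have lin: "L (\<lambda>x. a *\<^sub>R u x + b *\<^sub>R v x) = a * L u + b * L v" if "u \<in> H1" "v \<in> H1" for a b u v
    using add[OF h1.scale_mem[OF that(1), of a] h1.scale_mem[OF that(2), of b]] scale that by simp
  obtain p where p: "p \<in> H1" "\<And>v. v \<in> H1 \<Longrightarrow> L v = h1_ip p v" using h1.Riesz[of L C] lin bd by blast
  have "(\<lambda>n. h1_ip (f n) p) \<longlonglongrightarrow> h1_ip g p" by (rule lim[OF p(1)])
  then show "(\<lambda>n. L (f n)) \<longlonglongrightarrow> L g" by (simp add: p f g h1.ip_commute)
qed

lemma
  assumes "H1_weakly_converges f g"
  shows weak_H1_mem: "f n \<in> H1" and weak_H1_limit_mem: "g \<in> H1"
  using assms by (auto simp: H1_weakly_converges_def)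

lemma weakD_functional:
  assumes w: "H1_weakly_converges f g"
    and lin: "\<And>a b u v. u \<in> H1 \<Longrightarrow> v \<in> H1 \<Longrightarrow> L (\<lambda>x. a *\<^sub>R u x + b *\<^sub>R v x) = a * L u + b * L v"
    and bd: "\<And>u. u \<in> H1 \<Longrightarrow> \<bar>L u\<bar> \<le> C * H1_norm u"
  shows "(\<lambda>n. L (f n)) \<longlonglongrightarrow> L g"
proof -
  have "L \<in> H1_dual" unfolding H1_dual_def
    using lin[of _ _ 1 1] lin[of _ _ _ 0, OF _ H1_zero] bd by (auto intro!: exI[of _ C])
  with w show ?thesis by (simp add: H1_weakly_converges_def)
qed

lemma weakD_h1:
  assumes w: "H1_weakly_converges f g" and \<phi>: "\<phi> \<in> H1"
  shows "(\<lambda>n. h1_ip (f n) \<phi>) \<longlonglongrightarrow> h1_ip g \<phi>"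
  by (rule weakD_functional[OF w, where C="sqrt (h1.sq \<phi>)"])
     (use h1.Cauchy_Schwarz[OF _ \<phi>] in \<open>auto simp: H1_norm_eq mult.commute h1.ip_lin[simplified] \<phi>\<close>)

lemma weakD_l2:
  fixes g :: "'a::euclidean_space \<Rightarrow> real"
  assumes w: "H1_weakly_converges f g" and \<phi>: "\<phi> \<in> L2"
  shows "(\<lambda>n. l2_ip (f n) \<phi>) \<longlonglongrightarrow> l2_ip g \<phi>"
proof (rule weakD_functional[OF w, where C="sqrt (l2.sq \<phi>)"])
  fix a b and u v :: "'a \<Rightarrow> real" assume "u \<in> H1" "v \<in> H1"
  then show "l2_ip (\<lambda>x. a *\<^sub>R u x + b *\<^sub>R v x) \<phi> = a * l2_ip u \<phi> + b * l2_ip v \<phi>"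
    by (intro l2.ip_lin H1_L2 \<phi>)
next
  fix u :: "'a \<Rightarrow> real" assume "u \<in> H1"
  then have "\<bar>l2_ip u \<phi>\<bar> \<le> sqrt (l2.sq u) * sqrt (l2.sq \<phi>)" by (intro l2.Cauchy_Schwarz H1_L2 \<phi>)
  also have "\<dots> \<le> sqrt (h1.sq u) * sqrt (l2.sq \<phi>)"
    by (intro mult_right_mono) (auto simp: h1_sq dirichlet_nonneg l2_sq_nonneg)
  finally show "\<bar>l2_ip u \<phi>\<bar> \<le> sqrt (l2.sq \<phi>) * H1_norm u" by (simp add: H1_norm_eq mult.commute)
qed

lemma weakD_dir:
  assumes w: "H1_weakly_converges f g" and \<phi>: "\<phi> \<in> H1"
  shows "(\<lambda>n. dir_ip (f n) \<phi>) \<longlonglongrightarrow> dir_ip g \<phi>"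
proof -
  have "(\<lambda>n. h1_ip (f n) \<phi> - l2_ip (f n) \<phi>) \<longlonglongrightarrow> h1_ip g \<phi> - l2_ip g \<phi>"
    by (intro tendsto_diff weakD_h1[OF w \<phi>] weakD_l2[OF w H1_L2[OF \<phi>]])
  then show ?thesis by (simp add: h1_ip_def)
qed

lemma weak_subseq:
  assumes "H1_weakly_converges f g" "strict_mono r"
  shows "H1_weakly_converges (\<lambda>n. f (r n)) g"
  using assms by (auto simp: H1_weakly_converges_def intro: LIMSEQ_subseq_LIMSEQ[unfolded o_def, of "\<lambda>n. L (f n)" for L])

lemma weak_diff:
  assumes "H1_weakly_converges f g" "H1_weakly_converges f' g'"
  shows "H1_weakly_converges (\<lambda>n x. f n x - f' n x) (\<lambda>x. g x - g' x)"
proof (rule H1_weakly_convergesI)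
  note m = weak_H1_mem[OF assms(1)] weak_H1_mem[OF assms(2)] weak_H1_limit_mem[OF assms(1)] weak_H1_limit_mem[OF assms(2)]
  show "(\<lambda>x. f n x - f' n x) \<in> H1" "(\<lambda>x. g x - g' x) \<in> H1" for n by (intro h1.diff_mem m)+
  fix \<phi> :: "'a \<Rightarrow> real" assume "\<phi> \<in> H1"
  then show "(\<lambda>n. h1_ip (\<lambda>x. f n x - f' n x) \<phi>) \<longlonglongrightarrow> h1_ip (\<lambda>x. g x - g' x) \<phi>"
    by (simp add: h1.ip_diff m) (intro tendsto_intros weakD_h1 assms)
qed

text \<open>The function f cut off to the complement of a ball of radius R.\<close>
definition tail :: "real \<Rightarrow> ('a::euclidean_space \<Rightarrow> 'b::euclidean_space) \<Rightarrow> 'a \<Rightarrow> 'b" where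
  "tail R f x = (if norm x \<ge> R then f x else 0)"

lemma tail_L2: assumes "f \<in> L2" shows "tail R f \<in> L2"
proof (rule L2_bound[OF _ assms])
  note [measurable] = L2_measurable[OF assms]
  show "tail R f \<in> borel_measurable borel" unfolding tail_def[abs_def] by measurable
qed (simp add: tail_def)

lemma tail_tendsto:
  fixes f :: "'a::euclidean_space \<Rightarrow> 'b::euclidean_space"
  assumes f: "f \<in> L2" and R: "filterlim R at_top sequentially"
  shows "(\<lambda>n. l2.sq (tail (R n) f)) \<longlonglongrightarrow> 0"
proof -
  note [measurable] = L2_measurable[OF f] L2_measurable[OF tail_L2[OF f]]
  have "(\<lambda>n. \<integral>x. (norm (tail (R n) f x))\<^sup>2 \<partial>lborel) \<longlonglongrightarrow> (\<integral>x. 0 \<partial>(lborel :: 'a measure))"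
  proof (rule integral_dominated_convergence[where w="\<lambda>x. (norm (f x))\<^sup>2"])
    show "AE x in lborel. (\<lambda>n. (norm (tail (R n) f x))\<^sup>2) \<longlonglongrightarrow> 0"
    proof (rule AE_I2, rule tendsto_eventually)
      fix x
      show "\<forall>\<^sub>F n in sequentially. (norm (tail (R n) f x))\<^sup>2 = 0"
        using R[unfolded filterlim_at_top_dense, rule_format, of "norm x"] by eventually_elim (simp add: tail_def)
    qed
  qed (auto simp: L2_integrable f tail_def)
  then show ?thesis by (simp add: l2_sq)
qed

text \<open>With R half the length of z, one of x and x + z lies outside the ball of radius R. Hence in the pairing
of \<open>f(\<cdot> + z)\<close> with g at each point one of the two factors may be replaced by its tail.\<close>
lemma l2_ip_shift_tendsto_0:
  fixes f g :: "'a::euclidean_space \<Rightarrow> 'b::euclidean_space"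
  assumes f: "f \<in> L2" and g: "g \<in> L2" and z: "filterlim (\<lambda>n. norm (z n)) at_top sequentially"
  shows "(\<lambda>n. l2_ip (\<lambda>x. f (x + z n)) g) \<longlonglongrightarrow> 0"
proof -
  let ?R = "\<lambda>n. norm (z n) / 2"
  let ?sf = "\<lambda>n x. f (x + z n)" and ?st = "\<lambda>n x. tail (?R n) f (x + z n)"
  have R: "filterlim ?R at_top sequentially"
    using filterlim_tendsto_pos_mult_at_top[OF tendsto_const[of "1/2"] _ z] by simp
  have eq: "l2_ip (?sf n) g = l2_ip (?st n) (\<lambda>x. g x - tail (?R n) g x) + l2_ip (?sf n) (tail (?R n) g)" for n
  proof -
    have "l2_ip (?sf n) g - l2_ip (?sf n) (tail (?R n) g) = l2_ip (?sf n) (\<lambda>x. g x - tail (?R n) g x)"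
      by (simp add: l2.ip_diff_right L2_shift f g tail_L2)
    also have "\<dots> = l2_ip (?st n) (\<lambda>x. g x - tail (?R n) g x)"
      unfolding l2_ip_def
    proof (intro Bochner_Integration.integral_cong refl)
      fix x
      show "f (x + z n) \<bullet> (g x - tail (?R n) g x) = tail (?R n) f (x + z n) \<bullet> (g x - tail (?R n) g x)"
        using norm_triangle_ineq4[of "x + z n" x] by (auto simp: tail_def)
    qed
    finally show ?thesis by simp
  qed
  have sqs: "l2.sq (\<lambda>x. h (x + y)) = l2.sq h" if "h \<in> L2" for h :: "'a \<Rightarrow> 'b" and y
    unfolding l2.sq_def by (rule l2_ip_shift[OF that that])
  have "\<bar>l2_ip (?sf n) g\<bar> \<le> sqrt (l2.sq (tail (?R n) f)) * sqrt (2 * l2.sq g + 2 * l2.sq g) + sqrt (l2.sq f) * sqrt (l2.sq (tail (?R n) g))" for n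
  proof -
    have m: "l2.sq (tail (?R n) g) \<le> l2.sq g"
      unfolding l2_sq by (rule integral_mono) (simp_all add: L2_integrable g tail_L2, simp add: tail_def)
    have "\<bar>l2_ip (?sf n) g\<bar> \<le> \<bar>l2_ip (?st n) (\<lambda>x. g x - tail (?R n) g x)\<bar> + \<bar>l2_ip (?sf n) (tail (?R n) g)\<bar>"
      unfolding eq by (rule abs_triangle_ineq)
    also have "\<bar>l2_ip (?st n) (\<lambda>x. g x - tail (?R n) g x)\<bar> \<le> sqrt (l2.sq (?st n)) * sqrt (l2.sq (\<lambda>x. g x - tail (?R n) g x))"
      by (intro l2.Cauchy_Schwarz L2_shift tail_L2 l2.diff_mem f g)
    also have "\<dots> \<le> sqrt (l2.sq (tail (?R n) f)) * sqrt (2 * l2.sq g + 2 * l2.sq g)"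
      using l2.sq_diff_le[OF g tail_L2[OF g], of "?R n"] m
      by (intro mult_mono) (auto simp: sqs tail_L2 f l2_sq_nonneg)
    also have "\<bar>l2_ip (?sf n) (tail (?R n) g)\<bar> \<le> sqrt (l2.sq (?sf n)) * sqrt (l2.sq (tail (?R n) g))"
      by (intro l2.Cauchy_Schwarz L2_shift tail_L2 f g)
    finally show ?thesis by (simp add: sqs f)
  qed
  moreover have "(\<lambda>n. sqrt (l2.sq (tail (?R n) f)) * sqrt (2 * l2.sq g + 2 * l2.sq g) + sqrt (l2.sq f) * sqrt (l2.sq (tail (?R n) g)))
     \<longlonglongrightarrow> sqrt 0 * sqrt (2 * l2.sq g + 2 * l2.sq g) + sqrt (l2.sq f) * sqrt 0"
    by (intro tendsto_intros tail_tendsto f g R)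
  ultimately show ?thesis by (intro Lim_null_comparison[where f="\<lambda>n. l2_ip (?sf n) g"]) (auto intro!: always_eventually)
qed

lemma weak_shift_to_0:
  assumes f: "f \<in> H1" and z: "filterlim (\<lambda>n. norm (z n)) at_top sequentially"
  shows "H1_weakly_converges (\<lambda>n x. f (x + z n)) (\<lambda>x. 0)"
proof (rule H1_weakly_convergesI)
  show "(\<lambda>x. f (x + z n)) \<in> H1" for n by (rule H1_shift[OF f])
  show "(\<lambda>x. 0) \<in> H1" by (rule H1_zero)
  fix \<phi> :: "'a \<Rightarrow> real" assume \<phi>: "\<phi> \<in> H1"
  have "h1_ip (\<lambda>x. f (x + z n)) \<phi> = l2_ip (\<lambda>x. f (x + z n)) \<phi> + l2_ip (\<lambda>x. weak_gradient f (x + z n)) (weak_gradient \<phi>)" for n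
    unfolding h1_ip_def dir_ip_def
    by (intro arg_cong2[where f="(+)"] refl l2_ip_cong_AE weak_gradient_shift f \<phi> weak_gradient_props L2_shift H1_shift) simp
  moreover have "(\<lambda>n. l2_ip (\<lambda>x. f (x + z n)) \<phi> + l2_ip (\<lambda>x. weak_gradient f (x + z n)) (weak_gradient \<phi>)) \<longlonglongrightarrow> 0 + 0"
    by (intro tendsto_add l2_ip_shift_tendsto_0 z H1_L2 f \<phi> weak_gradient_props)
  moreover have "h1_ip (\<lambda>x. 0) \<phi> = 0" using h1.ip_scale[OF H1_zero \<phi>, of 0] by simp
  ultimately show "(\<lambda>n. h1_ip (\<lambda>x. f (x + z n)) \<phi>) \<longlonglongrightarrow> h1_ip (\<lambda>x. 0) \<phi>" by simp
qed

section \<open>Translations of functions in H1\<close>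

lemma deriv_pairing_at_0:
  fixes u \<phi> :: "'a::euclidean_space \<Rightarrow> real"
  assumes u: "u \<in> L2" and \<phi>: "test_function \<phi>"
  shows "((\<lambda>t. \<integral>x. u x * \<phi> (x + t *\<^sub>R k) \<partial>lborel) has_real_derivative
     (\<integral>x. u x * frechet_derivative \<phi> (at x) k \<partial>lborel)) (at 0)"
proof -
  let ?D = "\<lambda>x. frechet_derivative \<phi> (at x) k"
  have shift: "test_function (\<lambda>x. \<phi> (x + c))" for c by (rule test_function_shift[OF \<phi>])
  note [measurable] = L2_measurable[OF u] test_function_measurable[OF shift] test_function_measurable[OF \<phi>]
    test_function_measurable[OF test_function_deriv[OF \<phi>]]
  obtain K where K: "compact K" "\<And>x. x \<notin> K \<Longrightarrow> \<phi> x = 0" using test_functionE[OF \<phi>] by metis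
  obtain R where R: "\<And>x. x \<in> K \<Longrightarrow> norm x \<le> R" using compact_imp_bounded[OF K(1)] by (auto simp: bounded_iff)
  obtain B where B: "B \<ge> 0" "\<And>x. \<bar>?D x\<bar> \<le> B" using test_function_bounded[OF test_function_deriv[OF \<phi>]] by metis
  have deriv: "((\<lambda>t. \<phi> (x + t *\<^sub>R k)) has_real_derivative ?D (x + t *\<^sub>R k)) (at t)" for x t
  proof -
    have 1: "((\<lambda>t. x + t *\<^sub>R k) has_derivative (\<lambda>t. t *\<^sub>R k)) (at t)" by (auto intro!: derivative_eq_intros)
    have l: "linear (frechet_derivative \<phi> (at (x + t *\<^sub>R k)))"
      by (rule has_derivative_linear[OF test_function_has_derivative[OF \<phi>]])
    show ?thesis
      using has_derivative_compose[OF 1 test_function_has_derivative[OF \<phi>]]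
      by (simp add: has_field_derivative_def linear_cmul[OF l] mult_commute_abs)
  qed
  have lip: "\<bar>\<phi> (x + t *\<^sub>R k) - \<phi> x\<bar> \<le> B * \<bar>t\<bar>" for x t
    using field_differentiable_bound[of UNIV "\<lambda>t. \<phi> (x + t *\<^sub>R k)" "\<lambda>t. ?D (x + t *\<^sub>R k)" B t 0] deriv B by simp
  show ?thesis
    unfolding DERIV_def tendsto_at_iff_sequentially
  proof (intro allI impI)
    fix X :: "nat \<Rightarrow> real" assume X0: "\<forall>i. X i \<in> UNIV - {0}" and X: "X \<longlonglongrightarrow> 0"
    obtain M where M: "\<And>i. \<bar>X i\<bar> \<le> M"
      using convergent_imp_bounded[OF X] by (auto simp: bounded_iff)
    define q where "q i x = (\<phi> (x + X i *\<^sub>R k) - \<phi> x) / X i" for i x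
    have [measurable]: "q i \<in> borel_measurable borel" for i unfolding q_def by measurable
    let ?S = "cball 0 (R + M * norm k) :: 'a set"
    \<comment> \<open>The difference quotients are supported in one ball, because the step sizes are bounded.\<close>
    have q0: "q i x = 0" if "x \<notin> ?S" for i x
    proof -
      have "x \<notin> K" using that R[of x] M[of 0] by (auto simp: add_increasing2)
      moreover have "x + X i *\<^sub>R k \<notin> K"
      proof
        assume "x + X i *\<^sub>R k \<in> K"
        then have "norm (x + X i *\<^sub>R k) \<le> R" by (rule R)
        moreover have "norm x \<le> norm (x + X i *\<^sub>R k) + norm (X i *\<^sub>R k)"
          using norm_triangle_ineq4[of "x + X i *\<^sub>R k" "X i *\<^sub>R k"] by simp
        moreover have "norm (X i *\<^sub>R k) \<le> M * norm k" using M[of i] by (simp add: mult_right_mono)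
        ultimately show False using that by simp
      qed
      ultimately show ?thesis by (simp add: q_def K)
    qed
    have qb: "\<bar>q i x\<bar> \<le> B" for i x
      using lip[of x "X i"] X0 by (auto simp: q_def abs_divide pos_divide_le_eq)
    have "(\<lambda>i. \<integral>x. u x * q i x \<partial>lborel) \<longlonglongrightarrow> (\<integral>x. u x * ?D x \<partial>lborel)"
    proof (rule integral_dominated_convergence[where w="\<lambda>x. \<bar>u x * (B * indicator ?S x)\<bar>"])
      have "(\<lambda>x. B * indicator ?S x) \<in> L2"
        using l2.scale_mem[OF L2_indicator[of ?S], of B] emeasure_lborel_cball_finite[of "0::'a"] by (simp add: less_top)
      then show "integrable lborel (\<lambda>x. \<bar>u x * (B * indicator ?S x)\<bar>)"
        by (intro integrable_abs L2_mult_integrable u)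
      show "AE x in lborel. (\<lambda>i. u x * q i x) \<longlonglongrightarrow> u x * ?D x"
      proof (intro AE_I2 tendsto_mult tendsto_const)
        fix x
        have "(\<lambda>t. (\<phi> (x + t *\<^sub>R k) - \<phi> x) / t) \<midarrow>0\<rightarrow> ?D x"
          using deriv[of x 0] by (simp add: DERIV_def)
        then show "(\<lambda>i. q i x) \<longlonglongrightarrow> ?D x"
          unfolding tendsto_at_iff_sequentially q_def using X0 X by (auto simp: o_def)
      qed
      show "AE x in lborel. norm (u x * q i x) \<le> \<bar>u x * (B * indicator ?S x)\<bar>" for i
        using qb[of i] q0[of _ i] B(1) by (intro AE_I2) (auto simp: abs_mult indicator_def intro!: mult_left_mono)
    qed measurable
    moreover have "(\<integral>x. u x * q i x \<partial>lborel) =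
       ((\<integral>x. u x * \<phi> (x + (0 + X i) *\<^sub>R k) \<partial>lborel) - (\<integral>x. u x * \<phi> (x + 0 *\<^sub>R k) \<partial>lborel)) / X i" for i
    proof -
      have "(\<integral>x. u x * \<phi> (x + X i *\<^sub>R k) \<partial>lborel) - (\<integral>x. u x * \<phi> x \<partial>lborel)
        = (\<integral>x. u x * \<phi> (x + X i *\<^sub>R k) - u x * \<phi> x \<partial>lborel)"
        by (intro Bochner_Integration.integral_diff[symmetric] L2_mult_integrable u test_function_L2 shift \<phi>)
      also have "\<dots> / X i = (\<integral>x. (u x * \<phi> (x + X i *\<^sub>R k) - u x * \<phi> x) / X i \<partial>lborel)"
        by simp
      also have "\<dots> = (\<integral>x. u x * q i x \<partial>lborel)"
        by (intro Bochner_Integration.integral_cong refl) (simp add: q_def right_diff_distrib)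
      finally show ?thesis by simp
    qed
    ultimately show "((\<lambda>h. ((\<integral>x. u x * \<phi> (x + (0 + h) *\<^sub>R k) \<partial>lborel) - (\<integral>x. u x * \<phi> (x + 0 *\<^sub>R k) \<partial>lborel)) / h) \<circ> X)
        \<longlonglongrightarrow> (\<integral>x. u x * ?D x \<partial>lborel)" by (simp add: o_def)
  qed
qed

lemma is_weak_gradient_direction:
  assumes "u \<in> L2" "g \<in> L2" and wg: "is_weak_gradient u g" and \<phi>: "test_function \<phi>"
  shows "l2_ip u (\<lambda>x. frechet_derivative \<phi> (at x) k) = - l2_ip g (\<lambda>x. \<phi> x *\<^sub>R k)"
proof -
  have "l2_ip u (\<lambda>x. frechet_derivative \<phi> (at x) k)
     = (\<integral>x. (\<Sum>b\<in>Basis. (k \<bullet> b) * (u x * frechet_derivative \<phi> (at x) b)) \<partial>lborel)"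
    unfolding l2_ip_def frechet_derivative_basis[OF \<phi>, of _ k] by (simp add: sum_distrib_left mult_ac)
  also have "\<dots> = (\<Sum>b\<in>Basis. (k \<bullet> b) * (\<integral>x. u x * frechet_derivative \<phi> (at x) b \<partial>lborel))"
    by (subst Bochner_Integration.integral_sum)
       (auto intro!: integrable_mult_right L2_mult_integrable test_function_L2 test_function_deriv assms)
  also have "\<dots> = (\<Sum>b\<in>Basis. (k \<bullet> b) * - (\<integral>x. (g x \<bullet> b) * \<phi> x \<partial>lborel))"
    using wg \<phi> by (intro sum.cong) (auto simp: is_weak_gradient_def)
  also have "\<dots> = - (\<Sum>b\<in>Basis. (\<integral>x. (k \<bullet> b) * ((g x \<bullet> b) * \<phi> x) \<partial>lborel))"
    by (simp add: sum_negf)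
  also have "(\<Sum>b\<in>Basis. (\<integral>x. (k \<bullet> b) * ((g x \<bullet> b) * \<phi> x) \<partial>lborel)) = (\<integral>x. (\<Sum>b\<in>Basis. (k \<bullet> b) * ((g x \<bullet> b) * \<phi> x)) \<partial>lborel)"
    by (rule Bochner_Integration.integral_sum[symmetric])
       (intro integrable_mult_right L2_mult_integrable test_function_L2[OF \<phi>] L2_component[OF assms(2)])
  also have "\<dots> = l2_ip g (\<lambda>x. \<phi> x *\<^sub>R k)"
    unfolding l2_ip_def
  proof (intro Bochner_Integration.integral_cong refl)
    fix x show "(\<Sum>b\<in>Basis. (k \<bullet> b) * ((g x \<bullet> b) * \<phi> x)) = g x \<bullet> \<phi> x *\<^sub>R k"
      by (subst euclidean_inner[of "g x"]) (simp add: sum_distrib_left mult_ac)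
  qed
  finally show ?thesis .
qed

text \<open>By density it suffices to pair \<open>u(\<cdot> + h) - u\<close> with a test function \<open>\<phi>\<close>. Moving the translation to \<open>\<phi>\<close>,
the pairing of u with \<open>\<phi>(\<cdot> - t h)\<close> is differentiable in t, and the definition of the weak gradient bounds
its derivative by \<open>|h|\<close> times the norms of the gradient and of \<open>\<phi>\<close>.\<close>
theorem translation_estimate:
  fixes u :: "'a::euclidean_space \<Rightarrow> real"
  assumes u: "u \<in> H1"
  shows "l2.sq (\<lambda>x. u (x + h) - u x) \<le> dirichlet_integral u * (norm h)\<^sup>2"
proof -
  let ?g = "weak_gradient u"
  note uL = H1_L2[OF u] and g = weak_gradient_props[OF u]
  define d where "d x = u (x + h) - u x" for x
  have dL: "d \<in> L2" unfolding d_def by (intro l2.diff_mem L2_shift uL)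
  define A where "A = sqrt (l2.sq ?g) * norm h"
  have A0: "A \<ge> 0" by (simp add: A_def l2_sq_nonneg)
  have key: "\<bar>l2_ip d \<phi>\<bar> \<le> A * sqrt (l2.sq \<phi>)" if \<phi>: "test_function \<phi>" for \<phi>
  proof -
    define G where "G t = (\<integral>x. u x * \<phi> (x + t *\<^sub>R (- h)) \<partial>lborel)" for t
    have \<psi>: "test_function (\<lambda>x. \<phi> (x + c))" for c by (rule test_function_shift[OF \<phi>])
    have deriv: "(G has_real_derivative - l2_ip ?g (\<lambda>x. \<phi> (x + s *\<^sub>R (-h)) *\<^sub>R (-h))) (at s)" for s
    proof -
      have "((\<lambda>t. G (t + s)) has_real_derivative - l2_ip ?g (\<lambda>x. \<phi> (x + s *\<^sub>R (-h)) *\<^sub>R (-h))) (at 0)"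
        using deriv_pairing_at_0[OF uL \<psi>[of "s *\<^sub>R (-h)"], of "-h"]
        unfolding G_def scaleR_left_distrib add.assoc[symmetric]
          is_weak_gradient_direction[OF uL g \<psi>[of "s *\<^sub>R (-h)"], of "-h", symmetric]
        by (simp only: l2_ip_def inner_real_def)
      then show ?thesis using DERIV_shift[of G _ 0 s] by simp
    qed
    have bd: "\<bar>- l2_ip ?g (\<lambda>x. \<phi> (x + s *\<^sub>R (-h)) *\<^sub>R (-h))\<bar> \<le> A * sqrt (l2.sq \<phi>)" for s
    proof -
      have "\<bar>l2_ip ?g (\<lambda>x. \<phi> (x + s *\<^sub>R (-h)) *\<^sub>R (-h))\<bar>
        \<le> sqrt (l2.sq ?g) * sqrt (l2.sq (\<lambda>x. \<phi> (x + s *\<^sub>R (-h)) *\<^sub>R (-h)))"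
        by (intro l2.Cauchy_Schwarz g L2_times_vector test_function_L2 \<psi>)
      also have "l2.sq (\<lambda>x. \<phi> (x + s *\<^sub>R (-h)) *\<^sub>R (-h)) = (norm h)\<^sup>2 * l2.sq (\<lambda>x. \<phi> (x + s *\<^sub>R (-h)))"
        by (simp add: l2_sq power_mult_distrib mult.commute)
      also have "l2.sq (\<lambda>x. \<phi> (x + s *\<^sub>R (-h))) = l2.sq \<phi>"
        unfolding l2.sq_def by (rule l2_ip_shift) (rule test_function_L2[OF \<phi>])+
      finally show ?thesis by (simp add: A_def real_sqrt_mult)
    qed
    have "\<bar>G 1 - G 0\<bar> \<le> A * sqrt (l2.sq \<phi>) * \<bar>1 - 0\<bar>"
      using field_differentiable_bound[of UNIV G "\<lambda>s. - l2_ip ?g (\<lambda>x. \<phi> (x + s *\<^sub>R (-h)) *\<^sub>R (-h))" "A * sqrt (l2.sq \<phi>)" 1 0]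
        deriv bd by simp
    moreover have "G 1 = l2_ip (\<lambda>x. u (x + h)) \<phi>"
    proof -
      note [measurable] = L2_measurable[OF uL] test_function_measurable[OF \<phi>]
      have "l2_ip (\<lambda>x. u (x + h)) \<phi> = (\<integral>x. u (x + h) * \<phi> ((x + h) - h) \<partial>lborel)" by (simp add: l2_ip_def)
      also have "\<dots> = (\<integral>x. u x * \<phi> (x - h) \<partial>lborel)" by (rule integral_shift[of "\<lambda>x. u x * \<phi> (x - h)"]) measurable
      finally show ?thesis by (simp add: G_def)
    qed
    moreover have "G 0 = l2_ip u \<phi>" by (simp add: G_def l2_ip_def)
    ultimately show ?thesis unfolding d_def
      by (simp add: l2.ip_diff L2_shift uL test_function_L2 \<phi>)
  qed
  obtain w where w: "\<And>n::nat. test_function (w n)" "(\<lambda>n. l2.sq (\<lambda>x. w n x - d x)) \<longlonglongrightarrow> 0"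
    using test_functions_dense[OF dL] by blast
  have wL: "w n \<in> L2" for n by (rule test_function_L2[OF w(1)])
  have "(\<lambda>n. \<bar>l2_ip (w n) d\<bar>) \<longlonglongrightarrow> \<bar>l2_ip d d\<bar>" by (intro tendsto_intros l2.ip_tendsto wL dL w)
  moreover have "(\<lambda>n. A * sqrt (l2.sq (w n))) \<longlonglongrightarrow> A * sqrt (l2.sq d)" by (intro tendsto_intros l2.sq_tendsto wL dL w)
  ultimately have "\<bar>l2_ip d d\<bar> \<le> A * sqrt (l2.sq d)"
    by (rule LIMSEQ_le) (use key[OF w(1)] in \<open>simp add: l2_ip_commute[of _ d]\<close>)
  then have "sqrt (l2.sq d) \<le> A"
    using A0 l2_sq_nonneg[of d] by (intro le_mult_sqrt_imp_sqrt_le) (auto simp: l2.sq_def)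
  then have "(sqrt (l2.sq d))\<^sup>2 \<le> A\<^sup>2" by (rule power_mono) (simp add: l2_sq_nonneg)
  then show ?thesis
    by (simp add: l2_sq_nonneg A_def power_mult_distrib d_def dirichlet_integral_def l2_sq)
qed

lemma H1_translation_estimate:
  assumes "u \<in> H1" "h1.sq u \<le> M"
  shows "l2.sq (\<lambda>x. u (x + h) - u x) \<le> M * (norm h)\<^sup>2"
proof -
  have "dirichlet_integral u \<le> M" using assms(2) l2_sq_nonneg[of u] by (simp add: h1_sq)
  then show ?thesis using translation_estimate[OF assms(1), of h] mult_right_mono[of _ M "(norm h)\<^sup>2"]
    by (meson order_trans zero_le_power2)
qed

section \<open>The critical Sobolev bound\<close>

text \<open>The layer of \<open>|a|\<close> between the heights \<open>2\<^sup>k\<close> and \<open>2\<^sup>k\<^sup>+\<^sup>1\<close>.\<close>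
definition trunc :: "nat \<Rightarrow> real \<Rightarrow> real" where
  "trunc k a = min \<bar>a\<bar> (2 ^ Suc k) - min \<bar>a\<bar> (2 ^ k)"

lemma trunc_measurable [measurable]: "trunc k \<in> borel_measurable borel"
  unfolding trunc_def[abs_def] by measurable

lemma trunc_high: "2 ^ Suc k \<le> \<bar>a\<bar> \<Longrightarrow> trunc k a = 2 ^ k"
  by (auto simp: trunc_def min_def)

lemma trunc_low: "\<bar>a\<bar> < 2 ^ k \<Longrightarrow> trunc k a = 0"
  by (auto simp: trunc_def min_def)

lemma trunc_bound: "\<bar>trunc k a\<bar> \<le> \<bar>a\<bar>"
  by (auto simp: trunc_def min_def)

lemma trunc_mono: "\<bar>b\<bar> \<le> \<bar>a\<bar> \<Longrightarrow> trunc k b \<le> trunc k a"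
  by (auto simp: trunc_def min_def)

lemma sum_trunc: "(\<Sum>k<K. trunc k a) = min \<bar>a\<bar> (2 ^ K) - min \<bar>a\<bar> 1"
  by (induction K) (auto simp: trunc_def)

text \<open>The layers are monotone in \<open>|a|\<close>, so the differences of all layers have the same sign. Hence the sum of
their squares is at most the square of their sum, and the energies of the layers of a function add up
to at most the energy of the function.\<close>
lemma sum_trunc_diff_sq: "(\<Sum>k<K. (trunc k a - trunc k b)\<^sup>2) \<le> (a - b)\<^sup>2"
proof -
  have *: "(\<Sum>k<K. (trunc k a - trunc k b)\<^sup>2) \<le> (a - b)\<^sup>2" if ab: "\<bar>b\<bar> \<le> \<bar>a\<bar>" for a b
  proof -
    have nn: "0 \<le> trunc k a - trunc k b" for k using trunc_mono[OF ab] by simp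
    have "(\<Sum>k<K. (trunc k a - trunc k b)\<^sup>2) \<le> (\<Sum>k<K. trunc k a - trunc k b)\<^sup>2"
    proof (induction K)
      case (Suc K)
      have "0 \<le> (\<Sum>k<K. trunc k a - trunc k b) * (trunc K a - trunc K b)" by (intro mult_nonneg_nonneg sum_nonneg nn)
      then show ?case using Suc by (simp add: power2_sum)
    qed simp
    also have "\<dots> \<le> (\<bar>a\<bar> - \<bar>b\<bar>)\<^sup>2"
    proof (rule power_mono)
      show "(\<Sum>k<K. trunc k a - trunc k b) \<le> \<bar>a\<bar> - \<bar>b\<bar>"
        using ab unfolding sum_subtractf sum_trunc by (auto simp: min_def)
    qed (intro sum_nonneg nn)
    also have "\<dots> \<le> (a - b)\<^sup>2" by (rule abs_le_square_iff[THEN iffD1]) auto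
    finally show ?thesis .
  qed
  show ?thesis using *[of b a] *[of a b] by (cases "\<bar>b\<bar> \<le> \<bar>a\<bar>") (auto simp: power2_commute)
qed

lemma translation_modulus_nonneg:
  fixes u :: "'a::euclidean_space \<Rightarrow> real"
  assumes "\<And>h. l2.sq (\<lambda>x. u (x + h) - u x) \<le> G * (norm h)\<^sup>2"
  shows "G \<ge> 0"
proof -
  obtain b :: 'a where b: "b \<in> Basis" using nonempty_Basis by blast
  have "0 \<le> l2.sq (\<lambda>x. u (x + b) - u x)" by (rule l2_sq_nonneg)
  also have "\<dots> \<le> G" using assms[of b] b by simp
  finally show ?thesis .
qed

lemma emeasure_scaled_preimage:
  fixes D :: "'a::euclidean_space set"
  assumes [measurable]: "D \<in> sets borel" and t: "t > 0"
  shows "ennreal (t ^ DIM('a)) * emeasure lborel {z. x + t *\<^sub>R z \<in> D} = emeasure lborel D"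
proof -
  have "emeasure lborel D = emeasure (density (distr lborel borel (\<lambda>z. x + t *\<^sub>R z)) (\<lambda>_. ennreal (\<bar>t\<bar> ^ DIM('a)))) D"
    using lborel_affine[of t x] t by simp
  also have "\<dots> = ennreal (t ^ DIM('a)) * emeasure (distr lborel borel (\<lambda>z. x + t *\<^sub>R z)) D"
    using t by (subst emeasure_density) (auto simp: nn_integral_cmult_indicator)
  also have "emeasure (distr lborel borel (\<lambda>z. x + t *\<^sub>R z)) D = emeasure lborel {z. x + t *\<^sub>R z \<in> D}"
    by (subst emeasure_distr) (auto simp: vimage_def)
  finally show ?thesis by simp
qed

text \<open>At a point of E the function jumps from L to 0 under all translations that leave D. These form most of
the ball of radius t if the measure d of D is small compared with \<open>t\<^sup>N\<close>.\<close>
lemma translation_energy_lower: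
  fixes w :: "'a::euclidean_space \<Rightarrow> real"
  assumes [measurable]: "w \<in> borel_measurable borel" "E \<in> sets borel" "D \<in> sets borel"
    and wE: "\<And>x. x \<in> E \<Longrightarrow> w x = L" and wD: "\<And>x. x \<notin> D \<Longrightarrow> w x = 0"
    and D: "emeasure lborel D \<le> ennreal d" "d \<ge> 0" and t: "t > 0"
  shows "ennreal (L\<^sup>2 * (measure lborel (ball 0 1 :: 'a set) - d / t ^ DIM('a))) * emeasure lborel E
     \<le> (\<integral>\<^sup>+z. (\<integral>\<^sup>+x. ennreal ((w (x + t *\<^sub>R z) - w x)\<^sup>2) \<partial>lborel) * indicator (ball 0 1) z \<partial>lborel)"
proof -
  let ?B = "ball 0 1 :: 'a set"
  let ?c = "measure lborel ?B - d / t ^ DIM('a)"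
  have [measurable]: "?B \<in> sets borel" by simp
  have tp: "t ^ DIM('a) > 0" using t by simp
  have inner: "ennreal (L\<^sup>2 * ?c) * indicator E x \<le> (\<integral>\<^sup>+z. ennreal ((w (x + t *\<^sub>R z) - w x)\<^sup>2) * indicator ?B z \<partial>lborel)" for x
  proof (cases "x \<in> E")
    case True
    define S where "S = {z. x + t *\<^sub>R z \<in> D}"
    have [measurable]: "S \<in> sets borel" unfolding S_def by measurable
    have "ennreal (t ^ DIM('a)) * emeasure lborel S \<le> ennreal d"
      unfolding S_def using emeasure_scaled_preimage[of D t x] t D by simp
    then have "ennreal (1 / t ^ DIM('a)) * (ennreal (t ^ DIM('a)) * emeasure lborel S) \<le> ennreal (1 / t ^ DIM('a)) * ennreal d"
      by (rule mult_left_mono) simp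
    then have S: "emeasure lborel S \<le> ennreal (d / t ^ DIM('a))"
      using tp D(2) t by (simp add: mult.assoc[symmetric] ennreal_mult[symmetric])
    have "ennreal ?c = ennreal (measure lborel ?B) - ennreal (d / t ^ DIM('a))"
      using tp D(2) by (intro ennreal_minus[symmetric]) simp
    also have "\<dots> = emeasure lborel ?B - ennreal (d / t ^ DIM('a))"
      using emeasure_lborel_ball_finite[of "0::'a" 1] by (subst emeasure_eq_ennreal_measure) auto
    also have "\<dots> \<le> emeasure lborel ?B - emeasure lborel S" by (rule ennreal_minus_mono[OF order_refl S])
    also have "\<dots> \<le> emeasure lborel (?B - S)"
    proof -
      have fin: "emeasure lborel (?B \<inter> S) \<noteq> \<infinity>"
        using emeasure_mono[of "?B \<inter> S" ?B lborel] emeasure_lborel_ball_finite[of "0::'a" 1] by (auto simp: top_unique)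
      have "emeasure lborel ?B - emeasure lborel S \<le> emeasure lborel ?B - emeasure lborel (?B \<inter> S)"
        by (intro ennreal_minus_mono order_refl emeasure_mono) auto
      also have "\<dots> = emeasure lborel (?B - ?B \<inter> S)" by (rule emeasure_Diff[symmetric]) (use fin in auto)
      also have "?B - ?B \<inter> S = ?B - S" by auto
      finally show ?thesis .
    qed
    finally have "ennreal (L\<^sup>2) * ennreal ?c \<le> ennreal (L\<^sup>2) * emeasure lborel (?B - S)" by (rule mult_left_mono) simp
    also have "\<dots> = (\<integral>\<^sup>+z. ennreal (L\<^sup>2) * indicator (?B - S) z \<partial>lborel)"
      by (rule nn_integral_cmult_indicator[symmetric]) measurable
    also have "\<dots> \<le> (\<integral>\<^sup>+z. ennreal ((w (x + t *\<^sub>R z) - w x)\<^sup>2) * indicator ?B z \<partial>lborel)"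
      by (rule nn_integral_mono) (auto simp: indicator_def S_def wE[OF True] wD)
    finally show ?thesis using True by (simp add: ennreal_mult')
  qed simp
  have "ennreal (L\<^sup>2 * ?c) * emeasure lborel E = (\<integral>\<^sup>+x. ennreal (L\<^sup>2 * ?c) * indicator E x \<partial>lborel)"
    by (rule nn_integral_cmult_indicator[symmetric]) measurable
  also have "\<dots> \<le> (\<integral>\<^sup>+x. \<integral>\<^sup>+z. ennreal ((w (x + t *\<^sub>R z) - w x)\<^sup>2) * indicator ?B z \<partial>lborel \<partial>lborel)"
    by (rule nn_integral_mono) (rule inner)
  also have "\<dots> = (\<integral>\<^sup>+z. \<integral>\<^sup>+x. ennreal ((w (x + t *\<^sub>R z) - w x)\<^sup>2) * indicator ?B z \<partial>lborel \<partial>lborel)"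
    by (rule lborel_pair.Fubini'[symmetric]) measurable
  also have "\<dots> = (\<integral>\<^sup>+z. (\<integral>\<^sup>+x. ennreal ((w (x + t *\<^sub>R z) - w x)\<^sup>2) \<partial>lborel) * indicator ?B z \<partial>lborel)"
    by (intro nn_integral_cong nn_integral_multc) measurable
  finally show ?thesis .
qed

text \<open>A translation by n h is a chain of n translations by h.\<close>
lemma translation_energy_multiple:
  fixes w :: "'a::euclidean_space \<Rightarrow> real"
  assumes w: "w \<in> L2"
  shows "l2.sq (\<lambda>x. w (x + real n *\<^sub>R h) - w x) \<le> (real n)\<^sup>2 * l2.sq (\<lambda>x. w (x + h) - w x)"
proof -
  have "sqrt (l2.sq (\<lambda>x. w (x + real n *\<^sub>R h) - w x)) \<le> real n * sqrt (l2.sq (\<lambda>x. w (x + h) - w x))"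
  proof (induction n)
    case (Suc n)
    let ?a = "\<lambda>x. w (x + real n *\<^sub>R h) - w x" and ?b = "\<lambda>x. w ((x + real n *\<^sub>R h) + h) - w (x + real n *\<^sub>R h)"
    have "(\<lambda>x. w (x + real (Suc n) *\<^sub>R h) - w x) = (\<lambda>x. ?a x + ?b x)"
      by (simp add: algebra_simps)
    then have "sqrt (l2.sq (\<lambda>x. w (x + real (Suc n) *\<^sub>R h) - w x)) \<le> sqrt (l2.sq ?a) + sqrt (l2.sq ?b)"
      using l2.seminorm_triangle[of ?a ?b] L2_shift[OF l2.diff_mem[OF L2_shift[OF w, of h] w], of "real n *\<^sub>R h"]
        l2.diff_mem[OF L2_shift[OF w, of "real n *\<^sub>R h"] w] by simp
    also have "l2.sq ?b = l2.sq (\<lambda>x. w (x + h) - w x)"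
      unfolding l2.sq_def by (rule l2_ip_shift) (intro l2.diff_mem L2_shift w)+
    finally show ?case using Suc by (simp add: algebra_simps)
  qed (simp add: l2_sq)
  then have "(sqrt (l2.sq (\<lambda>x. w (x + real n *\<^sub>R h) - w x)))\<^sup>2 \<le> (real n * sqrt (l2.sq (\<lambda>x. w (x + h) - w x)))\<^sup>2"
    by (rule power_mono) (simp add: l2_sq_nonneg)
  then show ?thesis by (simp add: l2_sq_nonneg power_mult_distrib)
qed

lemma Chebyshev_L2:
  fixes u :: "'a::euclidean_space \<Rightarrow> real"
  assumes u: "u \<in> L2" and c: "c > 0"
  shows "emeasure lborel {x. c \<le> \<bar>u x\<bar>} \<le> ennreal (l2.sq u / c\<^sup>2)"
proof -
  note [measurable] = L2_measurable[OF u]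
  have "ennreal (c\<^sup>2) * emeasure lborel {x. c \<le> \<bar>u x\<bar>} = (\<integral>\<^sup>+x. ennreal (c\<^sup>2) * indicator {x. c \<le> \<bar>u x\<bar>} x \<partial>lborel)"
    by (rule nn_integral_cmult_indicator[symmetric]) measurable
  also have "\<dots> \<le> (\<integral>\<^sup>+x. ennreal ((norm (u x))\<^sup>2) \<partial>lborel)"
    by (rule nn_integral_mono) (use c in \<open>auto simp: indicator_def intro!: ennreal_leI power_mono[of c "\<bar>u _\<bar>" 2, simplified]\<close>)
  also have "\<dots> = ennreal (l2.sq u)" using L2_nn_integral[OF u] by (simp add: l2_sq)
  finally have "ennreal (1 / c\<^sup>2) * (ennreal (c\<^sup>2) * emeasure lborel {x. c \<le> \<bar>u x\<bar>}) \<le> ennreal (1 / c\<^sup>2) * ennreal (l2.sq u)"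
    by (rule mult_left_mono) simp
  then show ?thesis using c l2_sq_nonneg[of u] by (simp add: mult.assoc[symmetric] ennreal_mult[symmetric])
qed

lemma trunc_L2:
  fixes u :: "'a::euclidean_space \<Rightarrow> real"
  assumes u: "u \<in> L2" shows "(\<lambda>x. trunc k (u x)) \<in> L2"
proof (rule L2_bound[OF _ u])
  note [measurable] = L2_measurable[OF u]
  show "(\<lambda>x. trunc k (u x)) \<in> borel_measurable borel" by measurable
qed (simp add: trunc_bound)

text \<open>The measure of the set where \<open>|u|\<close> is at least \<open>2\<^sup>k\<close>.\<close>
definition lev :: "('a::euclidean_space \<Rightarrow> real) \<Rightarrow> nat \<Rightarrow> real" where
  "lev u k = measure lborel {x. 2 ^ k \<le> \<bar>u x\<bar>}"

lemma emeasure_lev: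
  fixes u :: "'a::euclidean_space \<Rightarrow> real"
  assumes u: "u \<in> L2"
  shows "emeasure lborel {x. 2 ^ k \<le> \<bar>u x\<bar>} = ennreal (lev u k)" and "lev u k \<le> l2.sq u / 4 ^ k"
proof -
  have le: "emeasure lborel {x. 2 ^ k \<le> \<bar>u x\<bar>} \<le> ennreal (l2.sq u / 4 ^ k)"
    using Chebyshev_L2[OF u, of "2 ^ k"] by (simp add: power2_eq_square power_mult_distrib[symmetric])
  then have "emeasure lborel {x. 2 ^ k \<le> \<bar>u x\<bar>} \<noteq> top" by (auto simp: top_unique)
  then show eq: "emeasure lborel {x. 2 ^ k \<le> \<bar>u x\<bar>} = ennreal (lev u k)"
    unfolding lev_def by (rule emeasure_eq_ennreal_measure)
  show "lev u k \<le> l2.sq u / 4 ^ k" using le l2_sq_nonneg[of u] unfolding eq by (simp add: ennreal_le_iff)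
qed

lemma lev_nonneg: "0 \<le> lev u k" by (simp add: lev_def)

text \<open>The lower bound for the energy of the k-th layer is used with translations of a size \<open>t k\<close> adapted to the
measure of its support. To add up the layers, all these energies are compared with energies at one
small scale s: \<open>t k\<close> is taken to be a multiple of s between \<open>\<tau> k\<close> and \<open>2 \<tau> k\<close>.\<close>
lemma sum_levels:
  fixes u :: "'a::euclidean_space \<Rightarrow> real"
  assumes u: "u \<in> L2"
    and G: "\<And>h. l2.sq (\<lambda>x. u (x + h) - u x) \<le> G * (norm h)\<^sup>2"
    and \<tau>: "\<And>k. \<tau> k > 0"
    and \<tau>m: "\<And>k. k < K \<Longrightarrow> 2 * lev u k \<le> measure lborel (ball 0 1 :: 'a set) * \<tau> k ^ DIM('a)"
  shows "(\<Sum>k<K. 4 ^ k * lev u (Suc k) / (\<tau> k)\<^sup>2) \<le> 8 * G"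
proof -
  let ?B = "ball 0 1 :: 'a set"
  let ?\<omega> = "measure lborel ?B"
  note [measurable] = L2_measurable[OF u]
  have [measurable]: "?B \<in> sets borel" by simp
  have \<omega>: "?\<omega> > 0" by simp
  have G0: "G \<ge> 0" by (rule translation_modulus_nonneg[OF G])
  define s where "s = Min (insert 1 (\<tau> ` {..<K}))"
  have s: "s > 0" unfolding s_def using \<tau> by (subst Min_gr_iff) auto
  have s\<tau>: "s \<le> \<tau> k" if "k < K" for k unfolding s_def using that by (intro Min_le) auto
  define n where "n k = nat \<lceil>\<tau> k / s\<rceil>" for k
  define t where "t k = real (n k) * s" for k
  have rn: "real (n k) = of_int \<lceil>\<tau> k / s\<rceil>" for k
    using divide_pos_pos[OF \<tau>[of k] s] unfolding n_def by (simp add: le_ceiling_iff)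
  have t: "\<tau> k \<le> t k" "t k \<le> 2 * \<tau> k" if k: "k < K" for k
  proof -
    have "\<tau> k / s \<le> real (n k)" unfolding rn by (rule le_of_int_ceiling)
    then show "\<tau> k \<le> t k" using s by (simp add: t_def pos_divide_le_eq)
    have "real (n k) \<le> \<tau> k / s + 1" unfolding rn by linarith
    then have "t k \<le> (\<tau> k / s + 1) * s" unfolding t_def using s by (intro mult_right_mono) auto
    also have "\<dots> = \<tau> k + s" using s by (simp add: field_simps)
    finally show "t k \<le> 2 * \<tau> k" using s\<tau>[OF k] by simp
  qed
  have t0: "t k > 0" if "k < K" for k using t(1)[OF that] \<tau>[of k] by linarith
  have n0: "n k > 0" if "k < K" for k using t0[OF that] s by (auto simp: t_def zero_less_mult_iff intro: gr0I)
  define F where "F k z = l2.sq (\<lambda>x. trunc k (u (x + z)) - trunc k (u x))" for k z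
  have dL: "(\<lambda>x. trunc k (u (x + z)) - trunc k (u x)) \<in> L2" for k z
    by (intro l2.diff_mem trunc_L2 u L2_shift)
  have Fn: "(\<integral>\<^sup>+x. ennreal ((trunc k (u (x + z)) - trunc k (u x))\<^sup>2) \<partial>lborel) = ennreal (F k z)" for k z
    using L2_nn_integral[OF dL[of k z]] by (simp add: F_def l2_sq)
  have "F k = (\<lambda>z. enn2real (\<integral>\<^sup>+x. ennreal ((trunc k (u (x + z)) - trunc k (u x))\<^sup>2) \<partial>lborel))" for k
    unfolding Fn by (auto simp: F_def l2_sq_nonneg)
  then have [measurable]: "F k \<in> borel_measurable borel" for k by simp
  have Fsum: "(\<Sum>k<K. F k z) \<le> G * (norm z)\<^sup>2" for z
  proof -
    have "(\<Sum>k<K. F k z) = (\<integral>x. (\<Sum>k<K. (trunc k (u (x + z)) - trunc k (u x))\<^sup>2) \<partial>lborel)"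
      unfolding F_def l2_sq by (subst Bochner_Integration.integral_sum) (use L2_integrable[OF dL] in auto)
    also have "\<dots> \<le> l2.sq (\<lambda>x. u (x + z) - u x)" unfolding l2_sq
      by (rule integral_mono) (use L2_integrable[OF dL] L2_integrable[OF l2.diff_mem[OF L2_shift[OF u] u]] sum_trunc_diff_sq in auto)
    also have "\<dots> \<le> G * (norm z)\<^sup>2" by (rule G)
    finally show ?thesis .
  qed
  have Fmult: "F k (t k *\<^sub>R z) \<le> (real (n k))\<^sup>2 * F k (s *\<^sub>R z)" for k z
    using translation_energy_multiple[OF trunc_L2[OF u, of k], of "n k" "s *\<^sub>R z"]
    by (simp add: F_def t_def)
  have step: "ennreal (?\<omega> * 4 ^ k * lev u (Suc k) / (8 * (\<tau> k)\<^sup>2)) \<le> ennreal (1 / s\<^sup>2) * (\<integral>\<^sup>+z. ennreal (F k (s *\<^sub>R z)) * indicator ?B z \<partial>lborel)"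
    if k: "k < K" for k
  proof -
    have "?\<omega> * \<tau> k ^ DIM('a) \<le> ?\<omega> * t k ^ DIM('a)"
      by (intro mult_left_mono power_mono t(1)[OF k]) (use \<tau>[of k] in auto)
    then have "2 * lev u k \<le> ?\<omega> * t k ^ DIM('a)" using \<tau>m[OF k] by linarith
    then have "lev u k / t k ^ DIM('a) \<le> ?\<omega> / 2" using t0[OF k] by (simp add: pos_divide_le_eq)
    then have half: "4 ^ k * (?\<omega> / 2) \<le> (2 ^ k)\<^sup>2 * (?\<omega> - lev u k / t k ^ DIM('a))"
      by (simp add: power2_eq_square power_mult_distrib[symmetric])
    have "ennreal (4 ^ k * (?\<omega> / 2) * lev u (Suc k)) = ennreal (4 ^ k * (?\<omega> / 2)) * emeasure lborel {x. 2 ^ Suc k \<le> \<bar>u x\<bar>}"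
      unfolding emeasure_lev(1)[OF u] using \<omega> by (intro ennreal_mult) (auto simp: lev_nonneg)
    also have "\<dots> \<le> ennreal ((2 ^ k)\<^sup>2 * (?\<omega> - lev u k / t k ^ DIM('a))) * emeasure lborel {x. 2 ^ Suc k \<le> \<bar>u x\<bar>}"
      by (intro mult_right_mono ennreal_leI half) simp
    also have "\<dots> \<le> (\<integral>\<^sup>+z. (\<integral>\<^sup>+x. ennreal ((trunc k (u (x + t k *\<^sub>R z)) - trunc k (u x))\<^sup>2) \<partial>lborel) * indicator ?B z \<partial>lborel)"
    proof (rule translation_energy_lower[where w="\<lambda>x. trunc k (u x)" and D="{x. 2 ^ k \<le> \<bar>u x\<bar>}"])
      show "emeasure lborel {x. 2 ^ k \<le> \<bar>u x\<bar>} \<le> ennreal (lev u k)" by (simp add: emeasure_lev(1)[OF u])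
    qed (use t0[OF k] in \<open>auto simp: trunc_high trunc_low lev_nonneg simp del: power_Suc\<close>)
    also have "\<dots> \<le> (\<integral>\<^sup>+z. ennreal ((real (n k))\<^sup>2) * (ennreal (F k (s *\<^sub>R z)) * indicator ?B z) \<partial>lborel)"
      unfolding Fn using Fmult[of k]
      by (intro nn_integral_mono) (auto simp: indicator_def ennreal_mult'[symmetric] intro!: ennreal_leI)
    also have "\<dots> = ennreal ((real (n k))\<^sup>2) * (\<integral>\<^sup>+z. ennreal (F k (s *\<^sub>R z)) * indicator ?B z \<partial>lborel)"
      by (rule nn_integral_cmult) measurable
    finally have "ennreal (1 / (t k)\<^sup>2) * ennreal (4 ^ k * (?\<omega> / 2) * lev u (Suc k)) \<le> ennreal (1 / (t k)\<^sup>2) * \<dots>"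
      by (rule mult_left_mono) simp
    also have "\<dots> = ennreal (1 / s\<^sup>2) * (\<integral>\<^sup>+z. ennreal (F k (s *\<^sub>R z)) * indicator ?B z \<partial>lborel)"
      using n0[OF k] s by (simp add: mult.assoc[symmetric] ennreal_mult'[symmetric] t_def power_mult_distrib)
    also have "ennreal (1 / (t k)\<^sup>2) * ennreal (4 ^ k * (?\<omega> / 2) * lev u (Suc k))
        = ennreal (1 / (t k)\<^sup>2 * (4 ^ k * (?\<omega> / 2) * lev u (Suc k)))"
      by (rule ennreal_mult'[symmetric]) simp
    finally have a: "ennreal (1 / (t k)\<^sup>2 * (4 ^ k * (?\<omega> / 2) * lev u (Suc k)))
        \<le> ennreal (1 / s\<^sup>2) * (\<integral>\<^sup>+z. ennreal (F k (s *\<^sub>R z)) * indicator ?B z \<partial>lborel)" .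
    have "?\<omega> * 4 ^ k * lev u (Suc k) / (8 * (\<tau> k)\<^sup>2) = 1 / (2 * \<tau> k)\<^sup>2 * (4 ^ k * (?\<omega> / 2) * lev u (Suc k))"
      by (simp add: power2_eq_square)
    also have "\<dots> \<le> 1 / (t k)\<^sup>2 * (4 ^ k * (?\<omega> / 2) * lev u (Suc k))"
      using t[OF k] t0[OF k] \<omega> by (intro mult_right_mono divide_left_mono power_mono) (auto simp: lev_nonneg)
    finally show ?thesis using a by (meson ennreal_leI order_trans)
  qed
  have nn: "0 \<le> ?\<omega> * 4 ^ k * lev u (Suc k) / (8 * (\<tau> k)\<^sup>2)" for k using \<omega> by (simp add: lev_nonneg)
  have "ennreal (\<Sum>k<K. ?\<omega> * 4 ^ k * lev u (Suc k) / (8 * (\<tau> k)\<^sup>2)) = (\<Sum>k<K. ennreal (?\<omega> * 4 ^ k * lev u (Suc k) / (8 * (\<tau> k)\<^sup>2)))"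
    by (rule sum_ennreal[symmetric]) (rule nn)
  also have "\<dots> \<le> (\<Sum>k<K. ennreal (1 / s\<^sup>2) * (\<integral>\<^sup>+z. ennreal (F k (s *\<^sub>R z)) * indicator ?B z \<partial>lborel))"
    by (rule sum_mono) (use step in auto)
  also have "\<dots> = ennreal (1 / s\<^sup>2) * (\<integral>\<^sup>+z. (\<Sum>k<K. ennreal (F k (s *\<^sub>R z)) * indicator ?B z) \<partial>lborel)"
    by (subst nn_integral_sum) (auto simp: sum_distrib_left)
  also have "\<dots> \<le> ennreal (1 / s\<^sup>2) * (\<integral>\<^sup>+z. ennreal (G * s\<^sup>2) * indicator ?B z \<partial>lborel)"
  proof (intro mult_left_mono nn_integral_mono)
    fix z
    show "(\<Sum>k<K. ennreal (F k (s *\<^sub>R z)) * indicator ?B z) \<le> ennreal (G * s\<^sup>2) * indicator ?B z"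
    proof (cases "z \<in> ?B")
      case True
      have "(\<Sum>k<K. F k (s *\<^sub>R z)) \<le> G * (norm (s *\<^sub>R z))\<^sup>2" by (rule Fsum)
      also have "\<dots> \<le> G * s\<^sup>2"
        using True G0 s by (intro mult_left_mono power_mono) (auto simp: mult_left_le)
      finally show ?thesis using True by (simp add: sum_ennreal F_def l2_sq_nonneg ennreal_leI)
    qed simp
  qed simp
  also have "\<dots> = ennreal (1 / s\<^sup>2) * (ennreal (G * s\<^sup>2) * ennreal ?\<omega>)"
    using emeasure_lborel_ball_finite[of "0::'a" 1]
    by (subst nn_integral_cmult_indicator) (auto simp: emeasure_eq_ennreal_measure)
  also have "\<dots> = ennreal (G * ?\<omega>)"
    using s G0 \<omega> by (simp add: mult.assoc[symmetric] ennreal_mult'[symmetric])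
  finally have "(\<Sum>k<K. ?\<omega> * 4 ^ k * lev u (Suc k) / (8 * (\<tau> k)\<^sup>2)) \<le> G * ?\<omega>"
    using G0 \<omega> by (subst (asm) ennreal_le_iff) auto
  moreover have "(\<Sum>k<K. ?\<omega> * 4 ^ k * lev u (Suc k) / (8 * (\<tau> k)\<^sup>2)) = ?\<omega> * (\<Sum>k<K. 4 ^ k * lev u (Suc k) / (\<tau> k)\<^sup>2) / 8"
    by (simp add: sum_distrib_left sum_divide_distrib mult_ac)
  moreover have "?\<omega> * (8 * G) = 8 * (G * ?\<omega>)" by (simp only: mult_ac)
  ultimately have "?\<omega> * (\<Sum>k<K. 4 ^ k * lev u (Suc k) / (\<tau> k)\<^sup>2) \<le> ?\<omega> * (8 * G)" by linarith
  then show ?thesis using \<omega> by (rule mult_left_le_imp_le)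
qed

text \<open>Write N for the dimension, q for the critical exponent and \<open>b\<^sub>k\<close> for \<open>2\<^sup>q\<^sup>k\<close> times the measure of the set
where \<open>|u| \<ge> 2\<^sup>k\<close>. If \<open>b\<^sub>k \<le> B\<close> for all \<open>k < K\<close>, then \<open>sum_levels\<close> applies with \<open>(\<tau> k)\<^sup>N\<close> proportional to
\<open>B / 2\<^sup>q\<^sup>k\<close>, and the relation between q and N turns its conclusion into a bound of
\<open>b\<^sub>1 + ... + b\<^sub>K\<close> by a constant times the power of B with exponent \<open>2/N\<close>. As \<open>2/N < 1\<close>, this is at most
B again once B is large enough, so the bound propagates to all k and also controls the sum of all
\<open>b\<^sub>k\<close>, which dominates, up to a factor, the integral of \<open>|u|\<^sup>q\<close> over the set where \<open>|u| \<ge> 1\<close>.\<close>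
theorem critical_bound:
  fixes M G :: real
  assumes N: "DIM('a::euclidean_space) \<ge> 3" and M0: "M \<ge> 0"
  obtains C where "C \<ge> 0" "\<And>u :: 'a \<Rightarrow> real. u \<in> L2 \<Longrightarrow> l2.sq u \<le> M \<Longrightarrow>
      (\<And>h. l2.sq (\<lambda>x. u (x + h) - u x) \<le> G * (norm h)\<^sup>2) \<Longrightarrow>
      (\<integral>\<^sup>+x. ennreal (\<bar>u x\<bar> powr sobolev_exponent DIM('a)) \<partial>lborel) \<le> ennreal C"
proof -
  let ?N = "real DIM('a)" and ?q = "sobolev_exponent DIM('a)"
  let ?\<omega> = "measure lborel (ball 0 1 :: 'a set)"
  have \<omega>: "?\<omega> > 0" by simp
  define \<beta> where "\<beta> = 2 / ?N"
  have \<beta>: "0 < \<beta>" "\<beta> < 1" using N by (auto simp: \<beta>_def)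
  define P where "P = 2 powr (?q / ?N)"
  define Q where "Q = 2 powr ?q"
  have P0: "P > 0" and Q0: "Q > 0" by (auto simp: P_def Q_def)
  have PN: "P ^ DIM('a) = Q" using N by (simp add: P_def Q_def powr_realpow[symmetric] powr_powr)
  \<comment> \<open>This is where the value of the critical exponent enters.\<close>
  have PQ: "4 * P\<^sup>2 = Q"
  proof -
    have "4 * P\<^sup>2 = 2 powr (2 + 2 * (?q / ?N))"
      by (simp add: P_def powr_realpow[symmetric] powr_powr powr_add mult.commute)
    also have "2 + 2 * (?q / ?N) = ?q"
      using N by (simp add: sobolev_exponent_def divide_simps)
    finally show ?thesis by (simp add: Q_def)
  qed
  have q2: "?q \<ge> 2" using N by (simp add: sobolev_exponent_def divide_simps)
  define A where "A = Q * 8 * \<bar>G\<bar> * (2 / ?\<omega>) powr \<beta>"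
  define B where "B = max (max M 1) (A powr (1 / (1 - \<beta>)))"
  have A0: "A \<ge> 0" using Q0 by (simp add: A_def)
  have B1: "B \<ge> 1" "M \<le> B" by (auto simp: B_def)
  have AB: "A * B powr \<beta> \<le> B"
  proof -
    have "A = (A powr (1 / (1 - \<beta>))) powr (1 - \<beta>)" using A0 \<beta> by (simp add: powr_powr)
    also have "\<dots> \<le> B powr (1 - \<beta>)" by (rule powr_mono2) (use \<beta> in \<open>auto simp: B_def\<close>)
    finally have "A * B powr \<beta> \<le> B powr (1 - \<beta>) * B powr \<beta>" by (rule mult_right_mono) simp
    also have "\<dots> = B" using B1 by (simp add: powr_add[symmetric])
    finally show ?thesis .
  qed
  define c where "c = root DIM('a) (2 * B / ?\<omega>)"
  have c0: "c > 0" using B1 \<omega> N by (auto simp: c_def)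
  have cN: "c ^ DIM('a) = 2 * B / ?\<omega>" using B1 \<omega> N by (simp add: c_def real_root_pow_pos2)
  have c2: "c\<^sup>2 = (2 / ?\<omega>) powr \<beta> * B powr \<beta>"
  proof -
    have "c = (2 * B / ?\<omega>) powr (1 / ?N)" using B1 \<omega> N by (simp add: c_def root_powr_inverse)
    then have "c\<^sup>2 = (2 * B / ?\<omega>) powr \<beta>"
      by (simp add: \<beta>_def powr_powr powr_realpow[symmetric] del: powr_realpow)
        (simp add: power2_eq_square powr_add[symmetric])
    also have "\<dots> = ((2 / ?\<omega>) * B) powr \<beta>" by simp
    also have "\<dots> = (2 / ?\<omega>) powr \<beta> * B powr \<beta>" by (rule powr_mult)
    finally show ?thesis .
  qed
  define C where "C = M + Q * (M + B)"
  have C0: "C \<ge> 0" using M0 B1 Q0 by (simp add: C_def)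
  have "(\<integral>\<^sup>+x. ennreal (\<bar>u x\<bar> powr ?q) \<partial>lborel) \<le> ennreal C"
    if u: "u \<in> L2" and uM: "l2.sq u \<le> M" and uG: "\<And>h. l2.sq (\<lambda>x. u (x + h) - u x) \<le> G * (norm h)\<^sup>2"
    for u :: "'a \<Rightarrow> real"
  proof -
    note [measurable] = L2_measurable[OF u]
    define b where "b k = Q ^ k * lev u k" for k
    have b0: "b k \<ge> 0" for k using Q0 by (simp add: b_def lev_nonneg)
    have bM: "b 0 \<le> M" using emeasure_lev(2)[OF u, of 0] uM by (simp add: b_def)
    have sum_b: "(\<Sum>k<K. b (Suc k)) \<le> B" if bB: "\<And>k. k < K \<Longrightarrow> b k \<le> B" for K
    proof -
      have "(\<Sum>k<K. 4 ^ k * lev u (Suc k) / (c / P ^ k)\<^sup>2) \<le> 8 * G"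
      proof (rule sum_levels[OF u uG])
        show "0 < c / P ^ k" for k using c0 P0 by simp
        fix k assume "k < K"
        then have "Q ^ k * lev u k \<le> B" using bB by (simp add: b_def)
        then have "lev u k \<le> B / Q ^ k" using Q0 by (simp add: pos_le_divide_eq mult.commute)
        moreover have "?\<omega> * (c / P ^ k) ^ DIM('a) = 2 * (B / Q ^ k)"
        proof -
          have "(P ^ k) ^ DIM('a) = Q ^ k" by (simp add: PN[symmetric] power_mult[symmetric] mult.commute)
          then show ?thesis using \<omega> by (simp add: power_divide cN)
        qed
        ultimately show "2 * lev u k \<le> ?\<omega> * (c / P ^ k) ^ DIM('a)" by simp
      qed
      moreover have "4 ^ k * lev u (Suc k) / (c / P ^ k)\<^sup>2 = b (Suc k) / (Q * c\<^sup>2)" for k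
      proof -
        have "Q ^ k = 4 ^ k * (P ^ k)\<^sup>2" by (simp add: PQ[symmetric] power_mult_distrib power_mult[symmetric] mult.commute)
        then show ?thesis using Q0 c0 P0 by (simp add: b_def power_divide field_simps)
      qed
      ultimately have "(\<Sum>k<K. b (Suc k)) / (Q * c\<^sup>2) \<le> 8 * G" by (simp add: sum_divide_distrib)
      then have "(\<Sum>k<K. b (Suc k)) \<le> 8 * G * (Q * c\<^sup>2)" using Q0 c0 by (simp add: pos_divide_le_eq)
      also have "\<dots> \<le> 8 * \<bar>G\<bar> * (Q * c\<^sup>2)" using Q0 by (intro mult_right_mono) auto
      also have "\<dots> = A * B powr \<beta>" by (simp add: A_def c2)
      finally show ?thesis using AB by simp
    qed
    have bB: "b k \<le> B" for k
    proof (induction k rule: less_induct)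
      case (less k)
      show ?case
      proof (cases k)
        case 0 then show ?thesis using bM B1 by simp
      next
        case (Suc j)
        have "b (Suc j) \<le> (\<Sum>k<Suc j. b (Suc k))" by (rule member_le_sum) (auto intro: b0)
        also have "\<dots> \<le> B" by (rule sum_b) (use less Suc in auto)
        finally show ?thesis by (simp add: Suc)
      qed
    qed
    have tot: "(\<Sum>k<K. b k) \<le> M + B" for K
    proof (cases K)
      case (Suc j)
      then have "(\<Sum>k<K. b k) = b 0 + (\<Sum>k<j. b (Suc k))" by (simp only: sum.lessThan_Suc_shift)
      then show ?thesis using bM sum_b[of j, OF bB] by simp
    qed (use M0 B1 in simp)
    have term_le: "g k \<le> (\<Sum>k. g k)" for g :: "nat \<Rightarrow> ennreal" and k
      using sum_le_suminf[of g "{k}"] by simp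
    let ?E = "\<lambda>k. {x. 2 ^ k \<le> \<bar>u x\<bar>}"
    have pw: "ennreal (\<bar>u x\<bar> powr ?q) \<le> ennreal ((norm (u x))\<^sup>2) + (\<Sum>k. ennreal (Q ^ Suc k) * indicator (?E k) x)" for x
    proof (cases "\<bar>u x\<bar> < 1")
      case True
      have "\<bar>u x\<bar> powr ?q \<le> \<bar>u x\<bar> powr 2" using True q2 by (intro powr_mono') auto
      then have "ennreal (\<bar>u x\<bar> powr ?q) \<le> ennreal ((norm (u x))\<^sup>2)" by (intro ennreal_leI) (simp add: powr_numeral)
      then show ?thesis by (rule order_trans) simp
    next
      case False
      define k where "k = nat \<lfloor>log 2 \<bar>u x\<bar>\<rfloor>"
      have l0: "0 \<le> log 2 \<bar>u x\<bar>" using False by simp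
      have k: "real k \<le> log 2 \<bar>u x\<bar>" "log 2 \<bar>u x\<bar> < real (Suc k)" using l0 by (auto simp: k_def) linarith+
      have "2 powr real k \<le> \<bar>u x\<bar>" using k(1) False by (subst (asm) le_log_iff) auto
      then have xE: "x \<in> ?E k" by (simp add: powr_realpow)
      have "\<bar>u x\<bar> < 2 powr real (Suc k)" using k(2) False by (subst (asm) log_less_iff) auto
      then have "\<bar>u x\<bar> powr ?q \<le> (2 powr real (Suc k)) powr ?q" using q2 by (intro powr_mono2) auto
      also have "\<dots> = Q ^ Suc k" by (simp only: Q_def powr_realpow[symmetric] powr_gt_zero powr_powr) (simp add: powr_powr powr_realpow[symmetric] mult.commute)
      finally have "ennreal (\<bar>u x\<bar> powr ?q) \<le> ennreal (Q ^ Suc k) * indicator (?E k) x" using xE by (simp add: ennreal_leI)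
      also have "\<dots> \<le> (\<Sum>k. ennreal (Q ^ Suc k) * indicator (?E k) x)"
        by (rule term_le)
      finally show ?thesis by (rule order_trans) simp
    qed
    have "(\<integral>\<^sup>+x. ennreal (\<bar>u x\<bar> powr ?q) \<partial>lborel)
        \<le> (\<integral>\<^sup>+x. ennreal ((norm (u x))\<^sup>2) + (\<Sum>k. ennreal (Q ^ Suc k) * indicator (?E k) x) \<partial>lborel)"
      by (rule nn_integral_mono) (rule pw)
    also have "\<dots> = ennreal (l2.sq u) + (\<Sum>k. ennreal (Q ^ Suc k) * emeasure lborel (?E k))"
      by (subst nn_integral_add, measurable)
        (simp add: L2_nn_integral[OF u, simplified] l2_sq nn_integral_suminf nn_integral_cmult_indicator del: power_Suc)
    also have "(\<Sum>k. ennreal (Q ^ Suc k) * emeasure lborel (?E k)) \<le> ennreal (Q * (M + B))"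
    proof (rule suminf_le_const)
      fix K
      have "(\<Sum>k<K. ennreal (Q ^ Suc k) * emeasure lborel (?E k)) = (\<Sum>k<K. ennreal (Q * b k))"
        using Q0 by (intro sum.cong refl) (simp add: emeasure_lev(1)[OF u] b_def ennreal_mult[symmetric] lev_nonneg mult.assoc)
      also have "\<dots> = ennreal (Q * (\<Sum>k<K. b k))" using Q0 b0 by (subst sum_ennreal) (auto simp: sum_distrib_left)
      also have "\<dots> \<le> ennreal (Q * (M + B))" using Q0 tot by (intro ennreal_leI mult_left_mono) auto
      finally show "(\<Sum>k<K. ennreal (Q ^ Suc k) * emeasure lborel (?E k)) \<le> ennreal (Q * (M + B))" .
    qed simp
    also have "ennreal (l2.sq u) \<le> ennreal M" by (rule ennreal_leI[OF uM])
    also have "ennreal M + ennreal (Q * (M + B)) = ennreal C"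
      using M0 B1 Q0 by (simp add: C_def ennreal_plus[symmetric] del: ennreal_plus)
    finally show ?thesis by (simp add: add_mono)
  qed
  with C0 show ?thesis using that by blast
qed

section \<open>Averages over small balls\<close>

text \<open>The average of f over the ball of radius e around x, written as a pairing so that weak convergence
applies to it.\<close>
definition avg :: "real \<Rightarrow> ('a::euclidean_space \<Rightarrow> real) \<Rightarrow> 'a \<Rightarrow> real" where
  "avg e f x = l2_ip (\<lambda>h. f (h + x)) (indicator (ball 0 e)) / measure lborel (ball 0 e :: 'a set)"

lemma L2_indicator_ball: "(indicator (ball 0 e) :: 'a::euclidean_space \<Rightarrow> real) \<in> L2"
  using emeasure_lborel_ball_finite[of "0::'a" e] by (intro L2_indicator) (auto simp: less_top)

lemma l2_sq_indicator_ball: "l2.sq (indicator (ball 0 e) :: 'a::euclidean_space \<Rightarrow> real) = measure lborel (ball 0 e :: 'a set)"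
proof -
  have "(\<lambda>x. (norm (indicator (ball 0 e) x :: real))\<^sup>2) = (indicator (ball 0 e) :: 'a \<Rightarrow> real)" by (auto simp: indicator_def)
  then show ?thesis by (simp add: l2_sq)
qed

lemma avg_measurable:
  fixes f :: "'a::euclidean_space \<Rightarrow> real"
  assumes "f \<in> L2" shows "avg e f \<in> borel_measurable borel"
proof -
  note [measurable] = L2_measurable[OF assms]
  have [measurable]: "ball 0 e \<in> sets (borel :: 'a measure)" by simp
  show ?thesis unfolding avg_def[abs_def] l2_ip_def by measurable
qed

lemma avg_bound:
  fixes f :: "'a::euclidean_space \<Rightarrow> real"
  assumes "f \<in> L2" shows "\<bar>avg e f x\<bar> \<le> sqrt (l2.sq f) * (sqrt (measure lborel (ball 0 e :: 'a set)) / measure lborel (ball 0 e :: 'a set))"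
proof -
  have "\<bar>l2_ip (\<lambda>h. f (h + x)) (indicator (ball 0 e))\<bar> \<le> sqrt (l2.sq (\<lambda>h. f (h + x))) * sqrt (l2.sq (indicator (ball 0 e) :: 'a \<Rightarrow> real))"
    by (intro l2.Cauchy_Schwarz L2_shift assms L2_indicator_ball)
  also have "l2.sq (\<lambda>h. f (h + x)) = l2.sq f" unfolding l2.sq_def by (rule l2_ip_shift[OF assms assms])
  finally show ?thesis by (simp add: avg_def l2_sq_indicator_ball divide_right_mono abs_divide)
qed

lemma L2_times_indicator:
  fixes f :: "'a::euclidean_space \<Rightarrow> real"
  assumes f: "f \<in> L2" and [measurable]: "A \<in> sets borel" shows "(\<lambda>x. f x * indicator A x) \<in> L2"
proof (rule L2_bound[OF _ f])
  note [measurable] = L2_measurable[OF f]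
  show "(\<lambda>x. f x * indicator A x) \<in> borel_measurable borel" by measurable
qed (auto simp: indicator_def)

text \<open>By Jensen's inequality the distance of f to its averages is at most the mean of the distances of f to its
translations by vectors shorter than e.\<close>
lemma avg_close:
  fixes f :: "'a::euclidean_space \<Rightarrow> real"
  assumes f: "f \<in> L2" and e: "e > 0"
    and G: "\<And>h. l2.sq (\<lambda>x. f (x + h) - f x) \<le> G * (norm h)\<^sup>2"
  shows "(\<lambda>x. f x - avg e f x) \<in> L2" "l2.sq (\<lambda>x. f x - avg e f x) \<le> G * e\<^sup>2"
proof -
  let ?B = "ball 0 e :: 'a set"
  define \<omega> where "\<omega> = measure lborel ?B"
  have \<omega>: "\<omega> > 0" using e by (simp add: \<omega>_def content_ball_pos)
  note [measurable] = L2_measurable[OF f] avg_measurable[OF f]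
  have [measurable]: "?B \<in> sets borel" by simp
  have G0: "G \<ge> 0" by (rule translation_modulus_nonneg[OF G])
  have pt: "ennreal ((f x - avg e f x)\<^sup>2) \<le> ennreal (1 / \<omega>) * (\<integral>\<^sup>+h. ennreal ((f (x + h) - f x)\<^sup>2) * indicator ?B h \<partial>lborel)" for x
  proof -
    let ?d = "\<lambda>h. (f (h + x) - f x) * indicator ?B h"
    have dL: "?d \<in> L2"
    proof -
      have "(\<lambda>h. f (h + x) * indicator ?B h - f x * indicator ?B h) \<in> L2"
        using l2.diff_mem[OF L2_times_indicator[OF L2_shift[OF f, of x], of ?B] l2.scale_mem[OF L2_indicator_ball[of e], of "f x"]]
        by simp
      then show ?thesis by (simp add: left_diff_distrib)
    qed
    have "l2_ip (\<lambda>h. f (h + x)) (indicator ?B) - f x * \<omega> = l2_ip ?d (indicator ?B)"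
    proof -
      have "f x * \<omega> = l2_ip (\<lambda>h. f x * indicator ?B h) (indicator ?B)"
        using l2.ip_scale[OF L2_indicator_ball[where 'a='a, of e] L2_indicator_ball[of e], of "f x"] l2_sq_indicator_ball[where 'a='a, of e]
        by (simp add: l2.sq_def \<omega>_def)
      moreover have "l2_ip (\<lambda>h. f (h + x)) (indicator ?B) = l2_ip (\<lambda>h. f (h + x) * indicator ?B h) (indicator ?B)"
        unfolding l2_ip_def by (intro Bochner_Integration.integral_cong) (auto simp: indicator_def)
      ultimately have "l2_ip (\<lambda>h. f (h + x)) (indicator ?B) - f x * \<omega> =
         l2_ip (\<lambda>h. f (h + x) * indicator ?B h - f x * indicator ?B h) (indicator ?B)"
        using l2.scale_mem[OF L2_indicator_ball[of e], of "f x"]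
        by (subst l2.ip_diff) (auto intro!: L2_times_indicator L2_shift f L2_indicator_ball)
      then show ?thesis by (simp add: left_diff_distrib)
    qed
    then have "avg e f x - f x = l2_ip ?d (indicator ?B) / \<omega>"
      using \<omega> by (simp add: avg_def \<omega>_def[symmetric] field_simps)
    then have "(f x - avg e f x)\<^sup>2 = (l2_ip ?d (indicator ?B))\<^sup>2 / \<omega>\<^sup>2"
      by (metis power2_commute power_divide)
    also have "\<dots> \<le> (l2.sq ?d * \<omega>) / \<omega>\<^sup>2"
      using l2.Cauchy_Schwarz_sq[OF dL L2_indicator_ball[of e]] l2_sq_indicator_ball[where 'a='a, of e]
      by (intro divide_right_mono) (auto simp: \<omega>_def)
    also have "\<dots> = 1 / \<omega> * l2.sq ?d" using \<omega> by (simp add: power2_eq_square)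
    finally have "ennreal ((f x - avg e f x)\<^sup>2) \<le> ennreal (1 / \<omega> * l2.sq ?d)" by (rule ennreal_leI)
    also have "\<dots> = ennreal (1 / \<omega>) * ennreal (l2.sq ?d)" using \<omega> by (intro ennreal_mult') simp
    also have "ennreal (l2.sq ?d) = (\<integral>\<^sup>+h. ennreal ((f (x + h) - f x)\<^sup>2) * indicator ?B h \<partial>lborel)"
      unfolding l2_sq L2_nn_integral[OF dL, symmetric]
      by (intro nn_integral_cong) (auto simp: indicator_def add.commute)
    finally show ?thesis .
  qed
  have dL: "(\<lambda>x. f (x + h) - f x) \<in> L2" for h by (intro l2.diff_mem L2_shift f)
  have "(\<integral>\<^sup>+x. ennreal ((norm (f x - avg e f x))\<^sup>2) \<partial>lborel)
     \<le> (\<integral>\<^sup>+x. ennreal (1 / \<omega>) * (\<integral>\<^sup>+h. ennreal ((f (x + h) - f x)\<^sup>2) * indicator ?B h \<partial>lborel) \<partial>lborel)"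
    using pt by (intro nn_integral_mono) simp
  also have "\<dots> = ennreal (1 / \<omega>) * (\<integral>\<^sup>+x. \<integral>\<^sup>+h. ennreal ((f (x + h) - f x)\<^sup>2) * indicator ?B h \<partial>lborel \<partial>lborel)"
    by (rule nn_integral_cmult) measurable
  also have "(\<integral>\<^sup>+x. \<integral>\<^sup>+h. ennreal ((f (x + h) - f x)\<^sup>2) * indicator ?B h \<partial>lborel \<partial>lborel)
     = (\<integral>\<^sup>+h. \<integral>\<^sup>+x. ennreal ((f (x + h) - f x)\<^sup>2) * indicator ?B h \<partial>lborel \<partial>lborel)"
    by (rule lborel_pair.Fubini'[symmetric]) measurable
  also have "\<dots> \<le> (\<integral>\<^sup>+h. ennreal (G * e\<^sup>2) * indicator ?B h \<partial>(lborel :: 'a measure))"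
  proof (rule nn_integral_mono)
    fix h :: 'a
    show "(\<integral>\<^sup>+x. ennreal ((f (x + h) - f x)\<^sup>2) * indicator ?B h \<partial>lborel) \<le> ennreal (G * e\<^sup>2) * indicator ?B h"
    proof (cases "h \<in> ?B")
      case True
      have "(\<integral>\<^sup>+x. ennreal ((f (x + h) - f x)\<^sup>2) \<partial>lborel) = ennreal (l2.sq (\<lambda>x. f (x + h) - f x))"
        using L2_nn_integral[OF dL[of h]] by (simp add: l2_sq)
      also have "\<dots> \<le> ennreal (G * (norm h)\<^sup>2)" by (rule ennreal_leI[OF G])
      also have "\<dots> \<le> ennreal (G * e\<^sup>2)"
        using True G0 e by (intro ennreal_leI mult_left_mono power_mono) auto
      finally show ?thesis using True by simp
    qed simp
  qed
  also have "\<dots> = ennreal (G * e\<^sup>2) * ennreal \<omega>"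
    using emeasure_lborel_ball_finite[of "0::'a" e]
    by (subst nn_integral_cmult_indicator) (auto simp: emeasure_eq_ennreal_measure \<omega>_def)
  also have "ennreal (1 / \<omega>) * \<dots> = ennreal (G * e\<^sup>2)"
    using \<omega> G0 by (simp add: ennreal_mult'[symmetric])
  finally have *: "(\<integral>\<^sup>+x. ennreal ((norm (f x - avg e f x))\<^sup>2) \<partial>lborel) \<le> ennreal (G * e\<^sup>2)"
    by (simp add: mult_left_mono)
  show L: "(\<lambda>x. f x - avg e f x) \<in> L2"
    by (rule L2I_nn) (use * in \<open>auto intro: le_less_trans\<close>)
  show "l2.sq (\<lambda>x. f x - avg e f x) \<le> G * e\<^sup>2"
    using * G0 unfolding L2_nn_integral[OF L] l2_sq by (simp add: ennreal_le_iff)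
qed

lemma small_averages_small_levels:
  fixes v :: "'a::euclidean_space \<Rightarrow> real"
  assumes v: "v \<in> L2" and e: "e > 0" and d: "d > 0"
    and G: "\<And>h. l2.sq (\<lambda>x. v (x + h) - v x) \<le> G * (norm h)\<^sup>2"
    and small: "\<And>x. \<bar>avg e v x\<bar> \<le> d / 2"
  shows "emeasure lborel {x. d \<le> \<bar>v x\<bar>} \<le> ennreal (4 * G * e\<^sup>2 / d\<^sup>2)"
proof -
  note [measurable] = L2_measurable[OF v] avg_measurable[OF v]
  have "{x. d \<le> \<bar>v x\<bar>} \<subseteq> {x. d / 2 \<le> \<bar>v x - avg e v x\<bar>}"
  proof (intro subsetI CollectI)
    fix x assume "x \<in> {x. d \<le> \<bar>v x\<bar>}"
    then show "d / 2 \<le> \<bar>v x - avg e v x\<bar>" using small[of x] by (simp add: abs_if split: if_splits)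
  qed
  then have "emeasure lborel {x. d \<le> \<bar>v x\<bar>} \<le> emeasure lborel {x. d / 2 \<le> \<bar>v x - avg e v x\<bar>}"
    by (rule emeasure_mono) measurable
  also have "\<dots> \<le> ennreal (l2.sq (\<lambda>x. v x - avg e v x) / (d / 2)\<^sup>2)"
    by (rule Chebyshev_L2[OF avg_close(1)[OF v e G]]) (use d in simp)
  also have "\<dots> \<le> ennreal (G * e\<^sup>2 / (d / 2)\<^sup>2)"
    by (intro ennreal_leI divide_right_mono avg_close(2)[OF v e G]) simp
  also have "G * e\<^sup>2 / (d / 2)\<^sup>2 = 4 * G * e\<^sup>2 / d\<^sup>2" by (simp add: power_divide)
  finally show ?thesis .
qed

text \<open>Averages of a weakly null sequence tend to 0 at every point and are bounded, while the sequence is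
uniformly close in L2 to its averages over small balls. Hence it tends to 0 in L2 with respect to any integrable weight W, and
a subsequence tends to 0 almost everywhere.\<close>
lemma weakly_null_AE_subseq:
  fixes f :: "nat \<Rightarrow> 'a::euclidean_space \<Rightarrow> real"
  assumes w: "H1_weakly_converges f (\<lambda>x. 0)" and M: "\<And>n. h1.sq (f n) \<le> M"
  obtains r where "strict_mono (r :: nat \<Rightarrow> nat)" "AE x in lborel. (\<lambda>n. f (r n) x) \<longlonglongrightarrow> 0"
proof -
  have f: "f n \<in> H1" for n by (rule weak_H1_mem[OF w])
  note fL = H1_L2[OF f]
  note [measurable] = L2_measurable[OF fL] avg_measurable[OF fL]
  note G = H1_translation_estimate[OF f M]
  have M2: "l2.sq (f n) \<le> M" for n using M[of n] dirichlet_nonneg[of "f n"] by (simp add: h1_sq)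
  have M0: "M \<ge> 0" using M2[of 0] l2_sq_nonneg[of "f 0"] by linarith
  obtain h :: "'a \<Rightarrow> ennreal" where h: "h \<in> borel_measurable lborel" "integral\<^sup>N lborel h \<noteq> \<infinity>"
     "\<And>x. 0 < h x" "\<And>x. h x < \<infinity>"
    using sigma_finite_measure.Ex_finite_integrable_function[OF sigma_finite_lborel[where 'a='a]] by auto
  note [measurable] = h(1)
  define W where "W x = min 1 (enn2real (h x))" for x
  have [measurable]: "W \<in> borel_measurable borel" unfolding W_def by measurable
  have W: "0 < W x" "W x \<le> 1" for x
    using h(3,4)[of x] by (auto simp: W_def enn2real_positive_iff)
  have Wh: "ennreal (W x) \<le> h x" for x
  proof -
    have "ennreal (W x) \<le> ennreal (enn2real (h x))" by (intro ennreal_leI) (simp add: W_def)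
    also have "\<dots> = h x" by (rule ennreal_enn2real) (use h(4)[of x] in simp)
    finally show ?thesis .
  qed
  have Wint: "integrable lborel W"
  proof (rule integrableI_bounded)
    have "(\<integral>\<^sup>+x. ennreal (norm (W x)) \<partial>lborel) \<le> integral\<^sup>N lborel h"
      using W(1) Wh by (intro nn_integral_mono) (simp add: less_imp_le)
    then show "(\<integral>\<^sup>+x. ennreal (norm (W x)) \<partial>lborel) < \<infinity>" using h(2) by (simp add: less_top[symmetric] top_unique) (metis infinity_ennreal_def neq_top_trans)
  qed measurable
  have fWint: "integrable lborel (\<lambda>x. (f n x)\<^sup>2 * W x)" for n
    by (rule Bochner_Integration.integrable_bound[OF L2_integrable[OF fL[of n]]])
       (use W in \<open>auto simp: abs_mult less_imp_le intro!: mult_left_le\<close>)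
  have aW: "(\<lambda>n. \<integral>x. (avg e (f n) x)\<^sup>2 * W x \<partial>lborel) \<longlonglongrightarrow> 0" and aWint: "\<And>n. integrable lborel (\<lambda>x. (avg e (f n) x)\<^sup>2 * W x)"
    if e: "e > 0" for e
  proof -
    let ?\<omega> = "measure lborel (ball 0 e :: 'a set)"
    define A where "A = (sqrt M * (sqrt ?\<omega> / ?\<omega>))\<^sup>2"
    have bd: "(avg e (f n) x)\<^sup>2 \<le> A" for n x
    proof -
      have "\<bar>avg e (f n) x\<bar> \<le> sqrt M * (sqrt ?\<omega> / ?\<omega>)"
        by (rule order_trans[OF avg_bound[OF fL]]) (intro mult_right_mono, auto simp: M2)
      then have "\<bar>avg e (f n) x\<bar>\<^sup>2 \<le> A" unfolding A_def by (intro power_mono) auto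
      then show ?thesis by simp
    qed
    have AW: "integrable lborel (\<lambda>x. A * W x)" using Wint by simp
    have le: "norm ((avg e (f n) x)\<^sup>2 * W x) \<le> A * W x" for n x
      using bd[of n x] W[of x] by (simp add: abs_mult mult_right_mono)
    have "(\<lambda>n. \<integral>x. (avg e (f n) x)\<^sup>2 * W x \<partial>lborel) \<longlonglongrightarrow> (\<integral>x. 0 \<partial>(lborel :: 'a measure))"
    proof (rule integral_dominated_convergence[OF _ _ AW])
      show "AE x in lborel. (\<lambda>n. (avg e (f n) x)\<^sup>2 * W x) \<longlonglongrightarrow> 0"
      proof (rule AE_I2)
        fix x :: 'a
        have "(\<lambda>n. l2_ip (f n) (\<lambda>h. indicator (ball 0 e) (h + - x))) \<longlonglongrightarrow> l2_ip (\<lambda>x. 0 :: real) (\<lambda>h. indicator (ball 0 e) (h + - x))"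
          by (rule weakD_l2[OF w L2_shift[OF L2_indicator_ball]])
        moreover have "l2_ip (f n) (\<lambda>h. indicator (ball 0 e) (h + - x)) = l2_ip (\<lambda>h. f n (h + x)) (indicator (ball 0 e))" for n
          using l2_ip_shift[OF L2_shift[OF fL[of n], of x] L2_indicator_ball[of e], of "- x"] by simp
        ultimately have "(\<lambda>n. l2_ip (\<lambda>h. f n (h + x)) (indicator (ball 0 e))) \<longlonglongrightarrow> 0"
          by (simp add: l2_ip_def)
        then have "(\<lambda>n. avg e (f n) x) \<longlonglongrightarrow> 0" unfolding avg_def by (rule tendsto_divide_zero)
        then have "(\<lambda>n. (avg e (f n) x)\<^sup>2 * W x) \<longlonglongrightarrow> 0\<^sup>2 * W x" by (intro tendsto_intros)
        then show "(\<lambda>n. (avg e (f n) x)\<^sup>2 * W x) \<longlonglongrightarrow> 0" by simp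
      qed
    qed (use le in auto)
    then show "(\<lambda>n. \<integral>x. (avg e (f n) x)\<^sup>2 * W x \<partial>lborel) \<longlonglongrightarrow> 0" by simp
    show "integrable lborel (\<lambda>x. (avg e (f n) x)\<^sup>2 * W x)" for n
      by (rule Bochner_Integration.integrable_bound[OF AW], measurable) (intro AE_I2 order_trans[OF le], simp)
  qed
  have "(\<lambda>n. \<integral>x. (f n x)\<^sup>2 * W x \<partial>lborel) \<longlonglongrightarrow> 0"
  proof (rule LIMSEQ_I)
    fix \<epsilon> :: real assume \<epsilon>: "\<epsilon> > 0"
    define e where "e = sqrt (\<epsilon> / (8 * (M + 1)))"
    have e: "e > 0" "e\<^sup>2 = \<epsilon> / (8 * (M + 1))" using \<epsilon> M0 by (auto simp: e_def)
    have "M * e\<^sup>2 \<le> (M + 1) * e\<^sup>2" by (intro mult_right_mono) auto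
    also have "\<dots> = \<epsilon> / 8" using M0 by (subst e(2)) (simp add: divide_simps)
    finally have Me: "2 * (M * e\<^sup>2) \<le> \<epsilon> / 4" by simp
    from aW[OF e(1)] have "\<forall>\<^sub>F n in sequentially. (\<integral>x. (avg e (f n) x)\<^sup>2 * W x \<partial>lborel) < \<epsilon> / 4"
      using \<epsilon> by (intro order_tendstoD) auto
    then obtain n0 where n0: "\<And>n. n \<ge> n0 \<Longrightarrow> (\<integral>x. (avg e (f n) x)\<^sup>2 * W x \<partial>lborel) < \<epsilon> / 4"
      by (auto simp: eventually_sequentially)
    show "\<exists>n0. \<forall>n\<ge>n0. norm ((\<integral>x. (f n x)\<^sup>2 * W x \<partial>lborel) - 0) < \<epsilon>"
    proof (intro exI[of _ n0] allI impI)
      fix n assume n: "n0 \<le> n"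
      note ac = avg_close[OF fL[of n] e(1) G]
      have "(\<integral>x. (f n x)\<^sup>2 * W x \<partial>lborel) \<le> (\<integral>x. 2 * (norm (f n x - avg e (f n) x))\<^sup>2 + 2 * ((avg e (f n) x)\<^sup>2 * W x) \<partial>lborel)"
      proof (rule integral_mono[OF fWint])
        show "integrable lborel (\<lambda>x. 2 * (norm (f n x - avg e (f n) x))\<^sup>2 + 2 * ((avg e (f n) x)\<^sup>2 * W x))"
          by (intro Bochner_Integration.integrable_add integrable_mult_right L2_integrable ac aWint[OF e(1)])
        fix x
        have "(a::real)\<^sup>2 \<le> 2 * (a - b)\<^sup>2 + 2 * b\<^sup>2" for a b
          using zero_le_power2[of "a - 2 * b"] by (simp add: power2_eq_square algebra_simps)
        from mult_right_mono[OF this[of "f n x" "avg e (f n) x"], of "W x"]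
        have "(f n x)\<^sup>2 * W x \<le> 2 * (f n x - avg e (f n) x)\<^sup>2 * W x + 2 * (avg e (f n) x)\<^sup>2 * W x"
          using W[of x] by (simp add: distrib_right)
        also have "2 * (f n x - avg e (f n) x)\<^sup>2 * W x \<le> 2 * (f n x - avg e (f n) x)\<^sup>2"
          using W[of x] by (intro mult_left_le) auto
        finally show "(f n x)\<^sup>2 * W x \<le> 2 * (norm (f n x - avg e (f n) x))\<^sup>2 + 2 * ((avg e (f n) x)\<^sup>2 * W x)"
          by simp
      qed
      also have "\<dots> = 2 * l2.sq (\<lambda>x. f n x - avg e (f n) x) + 2 * (\<integral>x. (avg e (f n) x)\<^sup>2 * W x \<partial>lborel)"
        unfolding l2_sq by (subst Bochner_Integration.integral_add) (use L2_integrable[OF ac(1)] aWint[OF e(1)] in auto)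
      also have "\<dots> \<le> 2 * (M * e\<^sup>2) + 2 * (\<integral>x. (avg e (f n) x)\<^sup>2 * W x \<partial>lborel)" using ac(2) by simp
      also have "\<dots> < \<epsilon>" using Me n0[OF n] \<epsilon> by linarith
      finally show "norm ((\<integral>x. (f n x)\<^sup>2 * W x \<partial>lborel) - 0) < \<epsilon>"
        using W by (simp add: less_imp_le)
    qed
  qed
  then have "(\<lambda>n. \<integral>x. norm ((f n x)\<^sup>2 * W x) \<partial>lborel) \<longlonglongrightarrow> 0"
    using W by (simp add: abs_mult less_imp_le)
  from tendsto_L1_AE_subseq[OF fWint this]
  obtain r where r: "strict_mono r" "AE x in lborel. (\<lambda>n. (f (r n) x)\<^sup>2 * W x) \<longlonglongrightarrow> 0" by blast
  from r(2) have "AE x in lborel. (\<lambda>n. f (r n) x) \<longlonglongrightarrow> 0"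
  proof eventually_elim
    case (elim x)
    then have "(\<lambda>n. (f (r n) x)\<^sup>2 * W x / W x) \<longlonglongrightarrow> 0 / W x" using W[of x] by (intro tendsto_divide tendsto_const) auto
    then have "(\<lambda>n. (f (r n) x)\<^sup>2) \<longlonglongrightarrow> 0" using W[of x] by simp
    then have "(\<lambda>n. sqrt ((f (r n) x)\<^sup>2)) \<longlonglongrightarrow> sqrt 0" by (rule tendsto_real_sqrt)
    then show ?case by (simp add: tendsto_rabs_zero_iff)
  qed
  with r(1) show ?thesis using that by blast
qed

section \<open>Nonlinear functionals of critical growth\<close>

text \<open>The critical growth \<open>s\<^sup>2 + |s|\<^sup>q\<close>.\<close>
definition grw :: "real \<Rightarrow> real \<Rightarrow> real" where
  "grw q s = s\<^sup>2 + \<bar>s\<bar> powr q"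

lemma grw_measurable [measurable]: "grw q \<in> borel_measurable borel"
  unfolding grw_def[abs_def] by measurable

lemma grw_nonneg: "0 \<le> grw q s" by (simp add: grw_def)

text \<open>Nonnegative functions of class C1 whose derivative grows at most like that of the critical growth.\<close>
definition growth_C1 :: "real \<Rightarrow> (real \<Rightarrow> real) \<Rightarrow> real \<Rightarrow> bool" where
  "growth_C1 q \<Psi> C \<longleftrightarrow> (\<forall>s. 0 \<le> \<Psi> s) \<and> \<Psi> C1_differentiable_on UNIV \<and> C > 0 \<and>
     (\<forall>s. \<bar>deriv \<Psi> s\<bar> \<le> C * (\<bar>s\<bar> + \<bar>s\<bar> powr (q - 1)))"

lemma growth_C1_deriv:
  assumes "growth_C1 q \<Psi> C" shows "(\<Psi> has_real_derivative deriv \<Psi> s) (at s)"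
proof -
  obtain D where "(\<Psi> has_real_derivative D) (at s)"
    using assms by (auto simp: growth_C1_def C1_differentiable_on_def has_real_derivative_iff_has_vector_derivative)
  then show ?thesis using DERIV_imp_deriv by metis
qed

lemma growth_C1_continuous: "growth_C1 q \<Psi> C \<Longrightarrow> continuous_on UNIV \<Psi>"
  by (rule DERIV_continuous_on[of _ _ "deriv \<Psi>"]) (auto intro: growth_C1_deriv has_field_derivative_at_within)

lemma growth_C1_measurable: "growth_C1 q \<Psi> C \<Longrightarrow> \<Psi> \<in> borel_measurable borel"
  by (intro borel_measurable_continuous_onI growth_C1_continuous)

lemma growth_C1_diff:
  assumes g: "growth_C1 q \<Psi> C" and q: "q \<ge> 2"
  shows "\<bar>\<Psi> (a + b) - \<Psi> a\<bar> \<le> C * (\<bar>b\<bar> * (\<bar>a\<bar> + \<bar>b\<bar>) + \<bar>b\<bar> * (\<bar>a\<bar> + \<bar>b\<bar>) powr (q - 1))"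
proof -
  let ?R = "\<bar>a\<bar> + \<bar>b\<bar>"
  have "norm (\<Psi> (a + b) - \<Psi> a) \<le> C * (?R + ?R powr (q - 1)) * norm (a + b - a)"
  proof (rule field_differentiable_bound[of "{-?R..?R}" \<Psi> "deriv \<Psi>"])
    fix z assume z: "z \<in> {-?R..?R}"
    show "(\<Psi> has_real_derivative deriv \<Psi> z) (at z within {-?R..?R})"
      by (rule has_field_derivative_at_within[OF growth_C1_deriv[OF g]])
    have "\<bar>deriv \<Psi> z\<bar> \<le> C * (\<bar>z\<bar> + \<bar>z\<bar> powr (q - 1))" using g by (simp add: growth_C1_def)
    also have "\<dots> \<le> C * (?R + ?R powr (q - 1))"
      using g z q by (intro mult_left_mono add_mono powr_mono2) (auto simp: growth_C1_def)
    finally show "norm (deriv \<Psi> z) \<le> C * (?R + ?R powr (q - 1))" by simp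
  qed auto
  then show ?thesis by (simp add: algebra_simps)
qed

text \<open>If \<open>|b|\<close> is small compared with \<open>|a|\<close>, the increment is small compared with the growth of a; otherwise
it is controlled by the growth of b.\<close>
lemma growth_C1_eps:
  assumes g: "growth_C1 q \<Psi> C" and q: "q \<ge> 2" and \<epsilon>: "\<epsilon> > 0"
  obtains K where "K \<ge> 0" "\<And>a b. \<bar>\<Psi> (a + b) - \<Psi> a\<bar> \<le> \<epsilon> * grw q a + K * grw q b"
proof -
  have C: "C > 0" using g by (simp add: growth_C1_def)
  define \<eta> where "\<eta> = min 1 (\<epsilon> / (C * (2 + 2 powr q)))"
  have t: "0 < C * (2 + 2 powr q)" using C by (intro mult_pos_pos add_pos_pos) auto
  have \<eta>: "\<eta> > 0" "\<eta> \<le> 1" using \<epsilon> t by (auto simp: \<eta>_def)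
  have "\<eta> \<le> \<epsilon> / (C * (2 + 2 powr q))" by (simp add: \<eta>_def)
  then have \<eta>\<epsilon>: "\<eta> * (C * (2 + 2 powr q)) \<le> \<epsilon>" using t by (simp add: pos_le_divide_eq)
  define L where "L = 1 + 1 / \<eta>"
  have L: "L > 0" using \<eta> by (simp add: L_def add_pos_pos)
  define K where "K = C * (L + L powr (q - 1))"
  have base: "\<bar>x\<bar> * \<bar>x\<bar> powr (q - 1) = \<bar>x\<bar> powr q" for x :: real
    by (simp add: powr_mult_base)
  show ?thesis
  proof
    show K0: "K \<ge> 0" using C L by (simp add: K_def)
    fix a b
    show "\<bar>\<Psi> (a + b) - \<Psi> a\<bar> \<le> \<epsilon> * grw q a + K * grw q b"
    proof (cases "\<bar>b\<bar> \<le> \<eta> * \<bar>a\<bar>")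
      case True
      have "\<eta> * \<bar>a\<bar> \<le> 1 * \<bar>a\<bar>" using \<eta> by (intro mult_right_mono) auto
      then have R: "\<bar>a\<bar> + \<bar>b\<bar> \<le> 2 * \<bar>a\<bar>" using True by simp
      have "\<bar>b\<bar> * (\<bar>a\<bar> + \<bar>b\<bar>) \<le> \<eta> * \<bar>a\<bar> * (2 * \<bar>a\<bar>)"
        using \<eta> by (intro mult_mono True R) auto
      also have "\<dots> = \<eta> * 2 * (\<bar>a\<bar> * \<bar>a\<bar>)" by (simp only: mult_ac)
      also have "\<bar>a\<bar> * \<bar>a\<bar> = a\<^sup>2" by (simp add: power2_eq_square)
      finally have 1: "\<bar>b\<bar> * (\<bar>a\<bar> + \<bar>b\<bar>) \<le> \<eta> * 2 * a\<^sup>2" .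
      have "\<bar>b\<bar> * (\<bar>a\<bar> + \<bar>b\<bar>) powr (q - 1) \<le> \<eta> * \<bar>a\<bar> * (2 * \<bar>a\<bar>) powr (q - 1)"
        using \<eta> q by (intro mult_mono True powr_mono2 R) auto
      also have "\<dots> = \<eta> * (2 powr (q - 1)) * \<bar>a\<bar> powr q"
        by (simp add: powr_mult base[symmetric])
      also have "\<dots> \<le> \<eta> * (2 powr q) * \<bar>a\<bar> powr q"
        using \<eta> by (intro mult_right_mono mult_left_mono powr_mono) auto
      finally have "\<bar>b\<bar> * (\<bar>a\<bar> + \<bar>b\<bar>) + \<bar>b\<bar> * (\<bar>a\<bar> + \<bar>b\<bar>) powr (q - 1) \<le> \<eta> * 2 * a\<^sup>2 + \<eta> * (2 powr q) * \<bar>a\<bar> powr q"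
        using 1 by linarith
      also have "\<dots> \<le> \<eta> * (2 + 2 powr q) * grw q a"
        using \<eta> by (simp add: grw_def algebra_simps)
      finally have "C * (\<bar>b\<bar> * (\<bar>a\<bar> + \<bar>b\<bar>) + \<bar>b\<bar> * (\<bar>a\<bar> + \<bar>b\<bar>) powr (q - 1)) \<le> C * (\<eta> * (2 + 2 powr q) * grw q a)"
        using C by (intro mult_left_mono) auto
      also have "\<dots> = (\<eta> * (C * (2 + 2 powr q))) * grw q a" by simp
      also have "\<dots> \<le> \<epsilon> * grw q a" by (rule mult_right_mono[OF \<eta>\<epsilon> grw_nonneg])
      finally show ?thesis using growth_C1_diff[OF g q, of a b] mult_nonneg_nonneg[OF K0 grw_nonneg, of q b] by linarith
    next
      case False
      then have "\<bar>a\<bar> \<le> \<bar>b\<bar> / \<eta>" using \<eta> by (simp add: pos_le_divide_eq mult.commute)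
      then have R: "\<bar>a\<bar> + \<bar>b\<bar> \<le> L * \<bar>b\<bar>" by (simp add: L_def algebra_simps)
      have 1: "\<bar>b\<bar> * (\<bar>a\<bar> + \<bar>b\<bar>) \<le> \<bar>b\<bar> * (L * \<bar>b\<bar>)" by (intro mult_left_mono R) auto
      have "\<bar>b\<bar> * (\<bar>a\<bar> + \<bar>b\<bar>) powr (q - 1) \<le> \<bar>b\<bar> * (L * \<bar>b\<bar>) powr (q - 1)"
        using q by (intro mult_left_mono powr_mono2 R) auto
      also have "\<dots> = L powr (q - 1) * \<bar>b\<bar> powr q"
        using L by (simp add: powr_mult base[symmetric])
      finally have "\<bar>b\<bar> * (\<bar>a\<bar> + \<bar>b\<bar>) + \<bar>b\<bar> * (\<bar>a\<bar> + \<bar>b\<bar>) powr (q - 1) \<le> L * b\<^sup>2 + L powr (q - 1) * \<bar>b\<bar> powr q"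
        using 1 by (simp add: power2_eq_square mult.left_commute)
      also have "\<dots> \<le> (L + L powr (q - 1)) * grw q b"
        using L by (simp add: grw_def algebra_simps)
      finally have "C * (\<bar>b\<bar> * (\<bar>a\<bar> + \<bar>b\<bar>) + \<bar>b\<bar> * (\<bar>a\<bar> + \<bar>b\<bar>) powr (q - 1)) \<le> C * ((L + L powr (q - 1)) * grw q b)"
        using C by (intro mult_left_mono) auto
      also have "\<dots> = K * grw q b" by (simp add: K_def)
      finally show ?thesis using growth_C1_diff[OF g q, of a b] mult_nonneg_nonneg[OF less_imp_le[OF \<epsilon>] grw_nonneg, of q a] by linarith
    qed
  qed
qed

lemma growth_C1_le:
  assumes g: "growth_C1 q \<Psi> C" and q: "q \<ge> 2" and 0: "\<Psi> 0 = 0"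
  shows "\<bar>\<Psi> b\<bar> \<le> C * grw q b"
  using growth_C1_diff[OF g q, of 0 b] by (simp add: 0 grw_def power2_eq_square powr_mult_base)

text \<open>The defect \<open>\<Psi>(f\<^sub>n) - \<Psi>(f\<^sub>n - f\<^sub>0) - \<Psi>(f\<^sub>0)\<close>, reduced by \<open>\<epsilon>\<close> times the growth of \<open>f\<^sub>n - f\<^sub>0\<close>, is dominated
by a multiple of the growth of \<open>f\<^sub>0\<close>; dominated convergence applies to its positive part W.\<close>
lemma Brezis_Lieb:
  fixes f :: "nat \<Rightarrow> 'a::euclidean_space \<Rightarrow> real"
  assumes g: "growth_C1 q \<Psi> C" and q: "q \<ge> 2" and 0: "\<Psi> 0 = 0"
    and [measurable]: "\<And>n. f n \<in> borel_measurable borel" "f0 \<in> borel_measurable borel"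
    and int: "\<And>n. integrable lborel (\<lambda>x. grw q (f n x))" "integrable lborel (\<lambda>x. grw q (f0 x))"
      "\<And>n. integrable lborel (\<lambda>x. grw q (f n x - f0 x))"
    and K: "\<And>n. (\<integral>x. grw q (f n x - f0 x) \<partial>lborel) \<le> K"
    and ae: "AE x in lborel. (\<lambda>n. f n x) \<longlonglongrightarrow> f0 x"
  shows "(\<lambda>n. (\<integral>x. \<Psi> (f n x) \<partial>lborel) - (\<integral>x. \<Psi> (f n x - f0 x) \<partial>lborel)) \<longlonglongrightarrow> (\<integral>x. \<Psi> (f0 x) \<partial>lborel)"
proof -
  note [measurable] = growth_C1_measurable[OF g]
  have \<Psi>int: "integrable lborel (\<lambda>x. \<Psi> (w x))" if "w \<in> borel_measurable borel" "integrable lborel (\<lambda>x. grw q (w x))" for w :: "'a \<Rightarrow> real"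
  proof (rule Bochner_Integration.integrable_bound[OF integrable_mult_right[OF that(2), of C]])
    note [measurable] = that(1)
    show "(\<lambda>x. \<Psi> (w x)) \<in> borel_measurable lborel" by measurable
    show "AE x in lborel. norm (\<Psi> (w x)) \<le> norm (C * grw q (w x))"
      using growth_C1_le[OF g q 0] by (intro AE_I2) (metis abs_ge_self order_trans real_norm_def)
  qed
  have "0 \<le> (\<integral>x. grw q (f 0 x - f0 x) \<partial>lborel)" by (intro integral_nonneg_AE AE_I2 grw_nonneg)
  then have K0: "K \<ge> 0" using K[of 0] by linarith
  define D where "D n x = \<Psi> (f n x) - \<Psi> (f n x - f0 x) - \<Psi> (f0 x)" for n x
  have [measurable]: "D n \<in> borel_measurable borel" for n unfolding D_def by measurable
  have Dint: "integrable lborel (D n)" for n unfolding D_def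
    by (intro Bochner_Integration.integrable_diff \<Psi>int int) measurable
  have Dlim: "AE x in lborel. (\<lambda>n. D n x) \<longlonglongrightarrow> 0"
    using ae
  proof eventually_elim
    case (elim x)
    have c: "isCont \<Psi> s" for s using growth_C1_continuous[OF g] by (simp add: continuous_on_eq_continuous_at)
    have "(\<lambda>n. f n x - f0 x) \<longlonglongrightarrow> f0 x - f0 x" by (intro tendsto_intros elim)
    then have "(\<lambda>n. \<Psi> (f n x - f0 x)) \<longlonglongrightarrow> \<Psi> 0" using isCont_tendsto_compose[OF c[of 0]] by simp
    then have "(\<lambda>n. D n x) \<longlonglongrightarrow> \<Psi> (f0 x) - \<Psi> 0 - \<Psi> (f0 x)"
      unfolding D_def by (intro tendsto_intros isCont_tendsto_compose[OF c elim])
    then show ?case by (simp add: 0)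
  qed
  have main: "(\<lambda>n. \<integral>x. \<bar>D n x\<bar> \<partial>lborel) \<longlonglongrightarrow> 0"
  proof (rule LIMSEQ_I)
    fix e :: real assume e: "e > 0"
    define \<epsilon> where "\<epsilon> = e / (2 * (K + 1))"
    have \<epsilon>: "\<epsilon> > 0" using e K0 by (simp add: \<epsilon>_def)
    have "\<epsilon> * K \<le> \<epsilon> * (K + 1)" using \<epsilon> by (intro mult_left_mono) auto
    also have "\<dots> = e / 2" using K0 by (simp add: \<epsilon>_def divide_simps)
    finally have \<epsilon>K: "\<epsilon> * K \<le> e / 2" .
    obtain B where B: "B \<ge> 0" "\<And>a b. \<bar>\<Psi> (a + b) - \<Psi> a\<bar> \<le> \<epsilon> * grw q a + B * grw q b"
      using growth_C1_eps[OF g q \<epsilon>] by blast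
    define W where "W n x = max 0 (\<bar>D n x\<bar> - \<epsilon> * grw q (f n x - f0 x))" for n x
    have [measurable]: "W n \<in> borel_measurable borel" for n unfolding W_def by measurable
    have Wb: "norm (W n x) \<le> (B + C) * grw q (f0 x)" for n x
    proof -
      have "\<bar>D n x\<bar> \<le> \<bar>\<Psi> (f n x) - \<Psi> (f n x - f0 x)\<bar> + \<bar>\<Psi> (f0 x)\<bar>" by (simp add: D_def)
      also have "\<bar>\<Psi> (f n x) - \<Psi> (f n x - f0 x)\<bar> \<le> \<epsilon> * grw q (f n x - f0 x) + B * grw q (f0 x)"
        using B(2)[of "f n x - f0 x" "f0 x"] by simp
      also have "\<bar>\<Psi> (f0 x)\<bar> \<le> C * grw q (f0 x)" by (rule growth_C1_le[OF g q 0])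
      finally have "\<bar>D n x\<bar> - \<epsilon> * grw q (f n x - f0 x) \<le> (B + C) * grw q (f0 x)" by (simp add: algebra_simps)
      moreover have "0 \<le> (B + C) * grw q (f0 x)"
        using B(1) g by (intro mult_nonneg_nonneg grw_nonneg) (auto simp: growth_C1_def)
      ultimately show ?thesis by (simp add: W_def)
    qed
    have BI: "integrable lborel (\<lambda>x. (B + C) * grw q (f0 x))" by (intro integrable_mult_right int)
    have "(\<lambda>n. \<integral>x. W n x \<partial>lborel) \<longlonglongrightarrow> (\<integral>x. 0 \<partial>(lborel :: 'a measure))"
    proof (rule integral_dominated_convergence[OF _ _ BI])
      show "AE x in lborel. (\<lambda>n. W n x) \<longlonglongrightarrow> 0"
        using Dlim
      proof eventually_elim
        case (elim x)
        then have "(\<lambda>n. \<bar>D n x\<bar>) \<longlonglongrightarrow> 0" by (simp add: tendsto_rabs_zero_iff)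
        then show ?case
          by (rule Lim_null_comparison[rotated])
             (use \<epsilon> grw_nonneg in \<open>auto intro!: always_eventually simp: W_def\<close>)
      qed
    qed (use Wb in auto)
    then have "\<forall>\<^sub>F n in sequentially. (\<integral>x. W n x \<partial>lborel) < e / 2" using e by (intro order_tendstoD) auto
    then obtain n0 where n0: "\<And>n. n \<ge> n0 \<Longrightarrow> (\<integral>x. W n x \<partial>lborel) < e / 2" by (auto simp: eventually_sequentially)
    show "\<exists>n0. \<forall>n\<ge>n0. norm ((\<integral>x. \<bar>D n x\<bar> \<partial>lborel) - 0) < e"
    proof (intro exI[of _ n0] allI impI)
      fix n assume n: "n0 \<le> n"
      have Wint: "integrable lborel (W n)"
        by (rule Bochner_Integration.integrable_bound[OF BI], measurable) (intro AE_I2 order_trans[OF Wb], simp)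
      have "(\<integral>x. \<bar>D n x\<bar> \<partial>lborel) \<le> (\<integral>x. W n x + \<epsilon> * grw q (f n x - f0 x) \<partial>lborel)"
      proof (rule integral_mono)
        show "integrable lborel (\<lambda>x. \<bar>D n x\<bar>)" by (intro integrable_abs Dint)
        show "integrable lborel (\<lambda>x. W n x + \<epsilon> * grw q (f n x - f0 x))"
          by (intro Bochner_Integration.integrable_add integrable_mult_right Wint int)
        show "\<bar>D n x\<bar> \<le> W n x + \<epsilon> * grw q (f n x - f0 x)" for x by (simp add: W_def)
      qed
      also have "\<dots> = (\<integral>x. W n x \<partial>lborel) + \<epsilon> * (\<integral>x. grw q (f n x - f0 x) \<partial>lborel)"
        by (subst Bochner_Integration.integral_add) (auto intro!: Wint int)
      also have "\<epsilon> * (\<integral>x. grw q (f n x - f0 x) \<partial>lborel) \<le> \<epsilon> * K" using \<epsilon> K by (intro mult_left_mono) auto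
      finally have "(\<integral>x. \<bar>D n x\<bar> \<partial>lborel) < e" using \<epsilon>K n0[OF n] by linarith
      then show "norm ((\<integral>x. \<bar>D n x\<bar> \<partial>lborel) - 0) < e" by simp
    qed
  qed
  have "(\<lambda>n. \<integral>x. D n x \<partial>lborel) \<longlonglongrightarrow> 0"
    by (rule Lim_null_comparison[OF _ main]) (auto intro!: always_eventually integral_abs_bound)
  then have "(\<lambda>n. (\<integral>x. D n x \<partial>lborel) + (\<integral>x. \<Psi> (f0 x) \<partial>lborel)) \<longlonglongrightarrow> 0 + (\<integral>x. \<Psi> (f0 x) \<partial>lborel)"
    by (intro tendsto_intros)
  moreover have "(\<integral>x. D n x \<partial>lborel) = (\<integral>x. \<Psi> (f n x) \<partial>lborel) - (\<integral>x. \<Psi> (f n x - f0 x) \<partial>lborel) - (\<integral>x. \<Psi> (f0 x) \<partial>lborel)" for n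
    unfolding D_def
    by (subst Bochner_Integration.integral_diff, (intro Bochner_Integration.integrable_diff \<Psi>int int; measurable)+)
       (subst Bochner_Integration.integral_diff, (intro \<Psi>int int; measurable)+, simp)
  ultimately show ?thesis by simp
qed

lemma H1_grw_bound:
  fixes M :: real
  assumes N: "DIM('a::euclidean_space) \<ge> 3"
  obtains K where "K \<ge> 0"
    "\<And>u :: 'a \<Rightarrow> real. u \<in> H1 \<Longrightarrow> h1.sq u \<le> M \<Longrightarrow> integrable lborel (\<lambda>x. grw (sobolev_exponent DIM('a)) (u x))"
    "\<And>u :: 'a \<Rightarrow> real. u \<in> H1 \<Longrightarrow> h1.sq u \<le> M \<Longrightarrow> (\<integral>x. grw (sobolev_exponent DIM('a)) (u x) \<partial>lborel) \<le> K"
proof -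
  let ?q = "sobolev_exponent DIM('a)"
  obtain K where K: "K \<ge> 0" "\<And>u :: 'a \<Rightarrow> real. u \<in> L2 \<Longrightarrow> l2.sq u \<le> max M 0 \<Longrightarrow>
      (\<And>h. l2.sq (\<lambda>x. u (x + h) - u x) \<le> M * (norm h)\<^sup>2) \<Longrightarrow>
      (\<integral>\<^sup>+x. ennreal (\<bar>u x\<bar> powr ?q) \<partial>lborel) \<le> ennreal K"
    using critical_bound[OF N, of "max M 0" M] by auto
  have main: "integrable lborel (\<lambda>x. grw ?q (u x)) \<and> (\<integral>x. grw ?q (u x) \<partial>lborel) \<le> max M 0 + K"
    if u: "u \<in> H1" and uM: "h1.sq u \<le> M" for u :: "'a \<Rightarrow> real"
  proof -
    note [measurable] = L2_measurable[OF H1_L2[OF u]]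
    have M': "l2.sq u \<le> max M 0" using uM dirichlet_nonneg[of u] by (simp add: h1_sq)
    have "(\<integral>\<^sup>+x. ennreal (grw ?q (u x)) \<partial>lborel) = (\<integral>\<^sup>+x. ennreal ((norm (u x))\<^sup>2) + ennreal (\<bar>u x\<bar> powr ?q) \<partial>lborel)"
      by (intro nn_integral_cong) (simp add: grw_def)
    also have "\<dots> = (\<integral>\<^sup>+x. ennreal ((norm (u x))\<^sup>2) \<partial>lborel) + (\<integral>\<^sup>+x. ennreal (\<bar>u x\<bar> powr ?q) \<partial>lborel)"
      by (rule nn_integral_add) measurable
    also have "\<dots> \<le> ennreal (max M 0) + ennreal K"
      using L2_nn_integral[OF H1_L2[OF u]] M'
      by (intro add_mono K(2) H1_L2[OF u] M' H1_translation_estimate[OF u uM]) (simp add: l2_sq ennreal_leI)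
    also have "\<dots> = ennreal (max M 0 + K)" using K(1) by (simp add: ennreal_plus)
    finally have le: "(\<integral>\<^sup>+x. ennreal (grw ?q (u x)) \<partial>lborel) \<le> ennreal (max M 0 + K)" .
    have int: "integrable lborel (\<lambda>x. grw ?q (u x))"
      by (rule integrableI_bounded) (use le in \<open>auto simp: grw_nonneg intro: le_less_trans\<close>)
    moreover have "ennreal (\<integral>x. grw ?q (u x) \<partial>lborel) \<le> ennreal (max M 0 + K)"
      using le by (subst (asm) nn_integral_eq_integral[OF int]) (auto simp: grw_nonneg)
    ultimately show ?thesis using K(1) by (subst (asm) ennreal_le_iff) auto
  qed
  show ?thesis by (rule that[of "max M 0 + K"]) (use main K(1) in auto)
qed

lemma tendsto_subseq_criterion:
  fixes a :: "nat \<Rightarrow> 'm::metric_space"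
  assumes "\<And>s. strict_mono (s :: nat \<Rightarrow> nat) \<Longrightarrow> \<exists>r. strict_mono (r :: nat \<Rightarrow> nat) \<and> (\<lambda>n. a (s (r n))) \<longlonglongrightarrow> l"
  shows "a \<longlonglongrightarrow> l"
proof (rule ccontr)
  assume "\<not> a \<longlonglongrightarrow> l"
  then obtain e where e: "e > 0" "\<not> (\<forall>\<^sub>F n in sequentially. dist (a n) l < e)" by (auto simp: tendsto_iff)
  then obtain s :: "nat \<Rightarrow> nat" where s: "strict_mono s" "\<And>n. \<not> dist (a (s n)) l < e"
    using not_eventually_subseq[of "\<lambda>n. dist (a n) l < e"] by blast
  obtain r where r: "strict_mono (r :: nat \<Rightarrow> nat)" "(\<lambda>n. a (s (r n))) \<longlonglongrightarrow> l" using assms[OF s(1)] by blast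
  then have "\<forall>\<^sub>F n in sequentially. dist (a (s (r n))) l < e" using e(1) by (auto simp: tendsto_iff)
  then show False using s(2) by (auto simp: eventually_sequentially)
qed

lemma weak_Brezis_Lieb:
  fixes f :: "nat \<Rightarrow> 'a::euclidean_space \<Rightarrow> real"
  assumes N: "DIM('a) \<ge> 3" and g: "growth_C1 (sobolev_exponent DIM('a)) \<Psi> C" and 0: "\<Psi> 0 = 0"
    and w: "H1_weakly_converges f f0" and M: "\<And>n. h1.sq (f n) \<le> M"
  shows "(\<lambda>n. (\<integral>x. \<Psi> (f n x) \<partial>lborel) - (\<integral>x. \<Psi> (f n x - f0 x) \<partial>lborel)) \<longlonglongrightarrow> (\<integral>x. \<Psi> (f0 x) \<partial>lborel)"
proof (rule tendsto_subseq_criterion)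
  fix s :: "nat \<Rightarrow> nat" assume s: "strict_mono s"
  let ?q = "sobolev_exponent DIM('a)"
  have q: "?q \<ge> 2" using N by (simp add: sobolev_exponent_def divide_simps)
  have f: "f n \<in> H1" for n by (rule weak_H1_mem[OF w])
  have f0: "f0 \<in> H1" by (rule weak_H1_limit_mem[OF w])
  let ?M = "max M (max (h1.sq f0) (2 * M + 2 * h1.sq f0))"
  have d: "(\<lambda>x. f n x - f0 x) \<in> H1" for n by (intro h1.diff_mem f f0)
  have dM: "h1.sq (\<lambda>x. f n x - f0 x) \<le> 2 * M + 2 * h1.sq f0" for n
    using h1.sq_diff_le[OF f f0, of n] M[of n] by linarith
  have w0: "H1_weakly_converges (\<lambda>n x. f (s n) x - f0 x) (\<lambda>x. 0)"
  proof -
    have "H1_weakly_converges (\<lambda>n. f0) f0" using f0 by (auto simp: H1_weakly_converges_def)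
    from weak_diff[OF weak_subseq[OF w s] this] show ?thesis by simp
  qed
  obtain r where r: "strict_mono (r :: nat \<Rightarrow> nat)" "AE x in lborel. (\<lambda>n. f (s (r n)) x - f0 x) \<longlonglongrightarrow> 0"
    using weakly_null_AE_subseq[OF w0 dM] by blast
  obtain K where K:
    "\<And>u :: 'a \<Rightarrow> real. u \<in> H1 \<Longrightarrow> h1.sq u \<le> ?M \<Longrightarrow> integrable lborel (\<lambda>x. grw ?q (u x))"
    "\<And>u :: 'a \<Rightarrow> real. u \<in> H1 \<Longrightarrow> h1.sq u \<le> ?M \<Longrightarrow> (\<integral>x. grw ?q (u x) \<partial>lborel) \<le> K"
    using H1_grw_bound[OF N, of ?M] by metis
  have "(\<lambda>n. (\<integral>x. \<Psi> (f (s (r n)) x) \<partial>lborel) - (\<integral>x. \<Psi> (f (s (r n)) x - f0 x) \<partial>lborel)) \<longlonglongrightarrow> (\<integral>x. \<Psi> (f0 x) \<partial>lborel)"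
  proof (rule Brezis_Lieb[OF g q 0])
    show "AE x in lborel. (\<lambda>n. f (s (r n)) x) \<longlonglongrightarrow> f0 x"
      using r(2) by eventually_elim (rule LIM_zero_cancel)
    show "integrable lborel (\<lambda>x. grw ?q (f (s (r n)) x))" for n by (rule K(1)[OF f]) (use M in \<open>simp add: max.coboundedI1\<close>)
    show "integrable lborel (\<lambda>x. grw ?q (f0 x))" by (rule K(1)[OF f0]) simp
    show "integrable lborel (\<lambda>x. grw ?q (f (s (r n)) x - f0 x))" for n by (rule K(1)[OF d]) (use dM in \<open>simp add: max.coboundedI2\<close>)
    show "(\<integral>x. grw ?q (f (s (r n)) x - f0 x) \<partial>lborel) \<le> K" for n by (rule K(2)[OF d]) (use dM in \<open>simp add: max.coboundedI2\<close>)
  qed (use L2_measurable[OF H1_L2[OF f]] L2_measurable[OF H1_L2[OF f0]] in auto)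
  then show "\<exists>r. strict_mono r \<and> (\<lambda>n. (\<integral>x. \<Psi> (f (s (r n)) x) \<partial>lborel) - (\<integral>x. \<Psi> (f (s (r n)) x - f0 x) \<partial>lborel)) \<longlonglongrightarrow> (\<integral>x. \<Psi> (f0 x) \<partial>lborel)"
    using r(1) by blast
qed

lemma H1_Psi_integrable:
  fixes u :: "'a::euclidean_space \<Rightarrow> real"
  assumes N: "DIM('a) \<ge> 3" and g: "growth_C1 (sobolev_exponent DIM('a)) \<Psi> C" and 0: "\<Psi> 0 = 0" and u: "u \<in> H1"
  shows "integrable lborel (\<lambda>x. \<Psi> (u x))" "Psi_integral \<Psi> u = ennreal (\<integral>x. \<Psi> (u x) \<partial>lborel)"
proof -
  let ?q = "sobolev_exponent DIM('a)"
  note [measurable] = L2_measurable[OF H1_L2[OF u]] growth_C1_measurable[OF g]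
  have q: "?q \<ge> 2" using N by (simp add: sobolev_exponent_def divide_simps)
  have "integrable lborel (\<lambda>x. grw ?q (u x))" using H1_grw_bound[OF N, of "h1.sq u"] u by (metis order_refl)
  then have "integrable lborel (\<lambda>x. C * grw ?q (u x))" by (rule integrable_mult_right)
  then show int: "integrable lborel (\<lambda>x. \<Psi> (u x))"
    by (rule Bochner_Integration.integrable_bound, measurable)
       (intro AE_I2 order_trans[OF growth_C1_le[OF g q 0, folded real_norm_def]], simp)
  show "Psi_integral \<Psi> u = ennreal (\<integral>x. \<Psi> (u x) \<partial>lborel)"
    unfolding Psi_integral_def by (rule nn_integral_eq_integral[OF int]) (use g in \<open>auto simp: growth_C1_def\<close>)
qed

text \<open>A square-integrable function is small outside a set of finite measure, and near 0 the values of \<open>\<Psi>\<close>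
stay away from 0.\<close>
lemma Psi_integral_infinite:
  fixes u :: "'a::euclidean_space \<Rightarrow> real"
  assumes g: "growth_C1 q \<Psi> C" and 0: "\<Psi> 0 \<noteq> 0" and u: "u \<in> L2"
  shows "Psi_integral \<Psi> u = \<infinity>"
proof -
  note [measurable] = L2_measurable[OF u] growth_C1_measurable[OF g]
  have p: "\<Psi> 0 > 0" using g 0 by (simp add: growth_C1_def order_less_le)
  have "isCont \<Psi> 0" using growth_C1_continuous[OF g] by (simp add: continuous_on_eq_continuous_at)
  then have "\<forall>\<^sub>F s in nhds 0. \<Psi> s > \<Psi> 0 / 2" using p
    by (intro order_tendstoD(1)[of _ "\<Psi> 0"]) (auto simp: isCont_def tendsto_at_iff_tendsto_nhds)
  then obtain d where d: "d > 0" "\<And>s. \<bar>s\<bar> < d \<Longrightarrow> \<Psi> s > \<Psi> 0 / 2"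
    by (auto simp: eventually_nhds_metric dist_real_def)
  let ?A = "{x. \<bar>u x\<bar> < d}"
  have "emeasure lborel {x. d \<le> \<bar>u x\<bar>} < \<infinity>" using Chebyshev_L2[OF u d(1)] by (rule le_less_trans) simp
  moreover have "emeasure lborel (UNIV :: 'a set) \<le> emeasure lborel ?A + emeasure lborel {x. d \<le> \<bar>u x\<bar>}"
  proof -
    have "emeasure lborel (UNIV :: 'a set) = emeasure lborel (?A \<union> {x. d \<le> \<bar>u x\<bar>})" by (rule arg_cong[where f="emeasure lborel"]) auto
    also have "\<dots> \<le> emeasure lborel ?A + emeasure lborel {x. d \<le> \<bar>u x\<bar>}" by (rule emeasure_subadditive) measurable
    finally show ?thesis .
  qed
  ultimately have inf: "emeasure lborel ?A = \<infinity>" by (auto simp: emeasure_lborel_UNIV top_unique)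
  have "ennreal (\<Psi> 0 / 2) * emeasure lborel ?A = (\<integral>\<^sup>+x. ennreal (\<Psi> 0 / 2) * indicator ?A x \<partial>lborel)"
    by (rule nn_integral_cmult_indicator[symmetric]) measurable
  also have "\<dots> \<le> Psi_integral \<Psi> u" unfolding Psi_integral_def
    by (intro nn_integral_mono) (auto simp: indicator_def intro!: ennreal_leI less_imp_le[OF d(2)])
  finally show ?thesis using p by (simp add: inf ennreal_mult_top top_unique)
qed

lemma Psi_integral_shift:
  assumes "growth_C1 q \<Psi> C" "u \<in> L2"
  shows "Psi_integral \<Psi> (\<lambda>x. u (x + h)) = Psi_integral \<Psi> u"
proof -
  note [measurable] = L2_measurable[OF assms(2)] growth_C1_measurable[OF assms(1)]
  show ?thesis unfolding Psi_integral_def by (rule nn_integral_shift[of "\<lambda>x. ennreal (\<Psi> (u x))"]) measurable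
qed

lemma subcritical_bound:
  assumes g: "growth_C1 q \<Psi> C"
    and z: "((\<lambda>s. \<Psi> s / \<bar>s\<bar>\<^sup>2) \<longlongrightarrow> 0) (at 0)"
    and i: "((\<lambda>s. \<Psi> s / \<bar>s\<bar> powr q) \<longlongrightarrow> 0) at_infinity"
  shows "\<Psi> 0 = 0"
    and "\<epsilon> > 0 \<Longrightarrow> \<exists>d>0. \<exists>B\<ge>0. \<forall>s. \<Psi> s \<le> \<epsilon> * grw q s + B * indicator {s. d \<le> \<bar>s\<bar>} s"
proof -
  have ic: "isCont \<Psi> 0" using growth_C1_continuous[OF g] by (simp add: continuous_on_eq_continuous_at)
  have "((\<lambda>s. \<Psi> s / \<bar>s\<bar>\<^sup>2 * s\<^sup>2) \<longlongrightarrow> 0 * 0\<^sup>2) (at 0)" by (intro tendsto_intros z)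
  moreover have "\<forall>\<^sub>F s in at 0. \<Psi> s / \<bar>s\<bar>\<^sup>2 * s\<^sup>2 = \<Psi> s" by (auto simp: eventually_at_filter)
  ultimately have "(\<Psi> \<longlongrightarrow> 0 * 0\<^sup>2) (at 0)" by (rule Lim_transform_eventually)
  then have "(\<Psi> \<longlongrightarrow> 0) (at 0)" by simp
  then show 00: "\<Psi> 0 = 0" by (rule LIM_unique[OF ic[unfolded isCont_def]])
  assume \<epsilon>: "\<epsilon> > 0"
  have "\<forall>\<^sub>F s in at 0. \<Psi> s / \<bar>s\<bar>\<^sup>2 < \<epsilon>" by (rule order_tendstoD(2)[OF z \<epsilon>])
  then obtain d where d: "d > 0" "\<And>s. s \<noteq> 0 \<Longrightarrow> \<bar>s\<bar> < d \<Longrightarrow> \<Psi> s / \<bar>s\<bar>\<^sup>2 < \<epsilon>"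
    unfolding eventually_at by (auto simp: dist_real_def simp del: power2_abs)
  have "\<forall>\<^sub>F s in at_infinity. \<Psi> s / \<bar>s\<bar> powr q < \<epsilon>" by (rule order_tendstoD(2)[OF i \<epsilon>])
  then obtain R where R: "\<And>s. R \<le> \<bar>s\<bar> \<Longrightarrow> \<Psi> s / \<bar>s\<bar> powr q < \<epsilon>"
    unfolding eventually_at_infinity real_norm_def by blast
  have "compact (\<Psi> ` {-R..R})"
    by (rule compact_continuous_image[OF continuous_on_subset[OF growth_C1_continuous[OF g]]]) auto
  then obtain B where B: "\<And>s. s \<in> {-R..R} \<Longrightarrow> \<bar>\<Psi> s\<bar> \<le> B"
    using compact_imp_bounded[of "\<Psi> ` {-R..R}"] unfolding bounded_iff by (metis imageI real_norm_def)
  show "\<exists>d>0. \<exists>B\<ge>0. \<forall>s. \<Psi> s \<le> \<epsilon> * grw q s + B * indicator {s. d \<le> \<bar>s\<bar>} s"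
  proof (rule exI[of _ d], rule conjI[OF d(1)], rule exI[of _ "max B 0"], rule conjI, simp, rule allI)
    fix s
    have e0: "0 \<le> \<epsilon> * grw q s" "\<epsilon> * s\<^sup>2 \<le> \<epsilon> * grw q s" "\<epsilon> * \<bar>s\<bar> powr q \<le> \<epsilon> * grw q s"
      using \<epsilon> by (auto simp: grw_def)
    consider "s = 0" | "s \<noteq> 0" "\<bar>s\<bar> < d" | "d \<le> \<bar>s\<bar>" "R \<le> \<bar>s\<bar>" | "d \<le> \<bar>s\<bar>" "\<bar>s\<bar> < R" by linarith
    then show "\<Psi> s \<le> \<epsilon> * grw q s + max B 0 * indicator {s. d \<le> \<bar>s\<bar>} s"
    proof cases
      case 1 then show ?thesis using e0 d(1) by (simp add: 00 indicator_def)
    next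
      case 2
      then have "\<Psi> s < \<epsilon> * s\<^sup>2" using d(2)[of s] by (simp add: pos_divide_less_eq)
      then show ?thesis using e0 2 by (simp add: indicator_def)
    next
      case 3
      then have "\<Psi> s < \<epsilon> * \<bar>s\<bar> powr q" using R[of s] d(1) by (subst (asm) pos_divide_less_eq) auto
      then show ?thesis using e0 3 by (simp add: indicator_def)
    next
      case 4
      then have "s \<in> {-R..R}" by auto
      then have "\<Psi> s \<le> B" using B[of s] by linarith
      then show ?thesis using e0 4 by (simp add: indicator_def)
    qed
  qed
qed

lemma Psi_integral_small:
  fixes v :: "'a::euclidean_space \<Rightarrow> real"
  assumes g: "growth_C1 q \<Psi> C" and v: "v \<in> H1" and M: "h1.sq v \<le> M" "M \<ge> 0"
    and int: "integrable lborel (\<lambda>x. grw q (v x))" and K: "(\<integral>x. grw q (v x) \<partial>lborel) \<le> K"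
    and bd: "\<And>s. \<Psi> s \<le> \<epsilon> * grw q s + B * indicator {s. d \<le> \<bar>s\<bar>} s" "\<epsilon> \<ge> 0" "B \<ge> 0" and d: "d > 0" and e: "e > 0"
    and small: "\<And>x. \<bar>avg e v x\<bar> \<le> d / 2"
  shows "Psi_integral \<Psi> v \<le> ennreal (\<epsilon> * K + B * (4 * M * e\<^sup>2 / d\<^sup>2))"
proof -
  note vL = H1_L2[OF v]
  note [measurable] = L2_measurable[OF vL] growth_C1_measurable[OF g]
  have "0 \<le> (\<integral>x. grw q (v x) \<partial>lborel)" by (intro integral_nonneg_AE AE_I2 grw_nonneg)
  then have K0: "K \<ge> 0" using K by linarith
  have "Psi_integral \<Psi> v \<le> (\<integral>\<^sup>+x. ennreal (\<epsilon> * grw q (v x)) + ennreal B * indicator {x. d \<le> \<bar>v x\<bar>} x \<partial>lborel)"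
    unfolding Psi_integral_def
  proof (rule nn_integral_mono)
    fix x
    have "ennreal (\<Psi> (v x)) \<le> ennreal (\<epsilon> * grw q (v x) + B * indicator {s. d \<le> \<bar>s\<bar>} (v x))" by (rule ennreal_leI[OF bd(1)])
    also have "\<dots> = ennreal (\<epsilon> * grw q (v x)) + ennreal B * indicator {x. d \<le> \<bar>v x\<bar>} x"
      using bd(2,3) by (subst ennreal_plus) (auto simp: grw_nonneg indicator_def)
    finally show "ennreal (\<Psi> (v x)) \<le> ennreal (\<epsilon> * grw q (v x)) + ennreal B * indicator {x. d \<le> \<bar>v x\<bar>} x" .
  qed
  also have "\<dots> = (\<integral>\<^sup>+x. ennreal (\<epsilon> * grw q (v x)) \<partial>lborel) + ennreal B * emeasure lborel {x. d \<le> \<bar>v x\<bar>}"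
    by (subst nn_integral_add) (auto simp: nn_integral_cmult_indicator)
  also have "(\<integral>\<^sup>+x. ennreal (\<epsilon> * grw q (v x)) \<partial>lborel) = ennreal (\<epsilon> * (\<integral>x. grw q (v x) \<partial>lborel))"
    by (subst nn_integral_eq_integral) (auto intro!: integrable_mult_right int simp: bd(2) grw_nonneg)
  also have "\<dots> \<le> ennreal (\<epsilon> * K)" by (intro ennreal_leI mult_left_mono K bd(2))
  also have "emeasure lborel {x. d \<le> \<bar>v x\<bar>} \<le> ennreal (4 * M * e\<^sup>2 / d\<^sup>2)"
    by (rule small_averages_small_levels[OF vL e d H1_translation_estimate[OF v M(1)] small])
  also have "ennreal (\<epsilon> * K) + ennreal B * ennreal (4 * M * e\<^sup>2 / d\<^sup>2) = ennreal (\<epsilon> * K + B * (4 * M * e\<^sup>2 / d\<^sup>2))"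
    using bd(2,3) M(2) K0 by (simp add: ennreal_mult'[symmetric] ennreal_plus[symmetric] del: ennreal_plus)
  finally show ?thesis by (simp add: add_mono mult_left_mono)
qed

section \<open>Splitting along a family of profiles\<close>

lemma limsup_ennreal_split:
  fixes a b :: "nat \<Rightarrow> real"
  assumes a: "\<And>n. a n \<ge> 0" and b: "\<And>n. b n \<ge> 0" and lim: "(\<lambda>n. a n - b n) \<longlonglongrightarrow> c" and c: "c \<ge> 0"
  shows "limsup (\<lambda>n. ennreal (a n)) = ennreal c + limsup (\<lambda>n. ennreal (b n))"
proof (rule antisym)
  have ev: "\<forall>\<^sub>F n in sequentially. \<bar>a n - b n - c\<bar> < e" if "e > 0" for e
    using tendstoD[OF lim that] by (simp add: dist_real_def)
  show "limsup (\<lambda>n. ennreal (a n)) \<le> ennreal c + limsup (\<lambda>n. ennreal (b n))"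
  proof (rule ennreal_le_epsilon)
    fix e :: real assume e: "0 < e"
    have "limsup (\<lambda>n. ennreal (a n)) \<le> limsup (\<lambda>n. ennreal (c + e) + ennreal (b n))"
    proof (rule Limsup_mono)
      show "\<forall>\<^sub>F n in sequentially. ennreal (a n) \<le> ennreal (c + e) + ennreal (b n)"
        using ev[OF e]
      proof eventually_elim
        case (elim n)
        have "ennreal (a n) \<le> ennreal ((c + e) + b n)" by (rule ennreal_leI) (use elim in linarith)
        then show ?case using c e b by (simp add: ennreal_plus)
      qed
    qed
    also have "\<dots> = ennreal (c + e) + limsup (\<lambda>n. ennreal (b n))" by (rule Limsup_const_add) simp
    also have "\<dots> = (ennreal c + limsup (\<lambda>n. ennreal (b n))) + ennreal e"
      using c e by (simp add: ennreal_plus ac_simps)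
    finally show "limsup (\<lambda>n. ennreal (a n)) \<le> (ennreal c + limsup (\<lambda>n. ennreal (b n))) + ennreal e" .
  qed
  show "ennreal c + limsup (\<lambda>n. ennreal (b n)) \<le> limsup (\<lambda>n. ennreal (a n))"
  proof (rule ennreal_le_epsilon)
    fix e :: real assume e: "0 < e"
    have "ennreal c + limsup (\<lambda>n. ennreal (b n)) = limsup (\<lambda>n. ennreal c + ennreal (b n))"
      by (rule Limsup_const_add[symmetric]) simp
    also have "\<dots> \<le> limsup (\<lambda>n. ennreal e + ennreal (a n))"
    proof (rule Limsup_mono)
      show "\<forall>\<^sub>F n in sequentially. ennreal c + ennreal (b n) \<le> ennreal e + ennreal (a n)"
        using ev[OF e]
      proof eventually_elim
        case (elim n)
        have "ennreal (c + b n) \<le> ennreal (e + a n)" by (rule ennreal_leI) (use elim in linarith)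
        then show ?case using a b c e by (simp add: ennreal_plus)
      qed
    qed
    also have "\<dots> = ennreal e + limsup (\<lambda>n. ennreal (a n))" by (rule Limsup_const_add) simp
    finally show "ennreal c + limsup (\<lambda>n. ennreal (b n)) \<le> limsup (\<lambda>n. ennreal (a n)) + ennreal e"
      by (simp add: add.commute)
  qed
qed

lemma H1_weak_compactness:
  assumes f: "\<And>n. f n \<in> H1" and M: "\<And>n. h1.sq (f n) \<le> M"
  obtains r w where "strict_mono (r :: nat \<Rightarrow> nat)" "H1_weakly_converges (\<lambda>n. f (r n)) w"
proof (rule h1.weak_compactness[OF f M])
  fix r :: "nat \<Rightarrow> nat" and g
  assume "strict_mono r" and g: "g \<in> H1" and lim: "\<And>\<phi>. \<phi> \<in> H1 \<Longrightarrow> (\<lambda>n. h1_ip (f (r n)) \<phi>) \<longlonglongrightarrow> h1_ip g \<phi>"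
  then show thesis by (intro that[of r g] H1_weakly_convergesI f g lim)
qed

lemma weak_const: "g \<in> H1 \<Longrightarrow> H1_weakly_converges (\<lambda>n. g) g"
  by (simp add: H1_weakly_converges_def)

lemma not_filterlim_at_top_bounded_subseq:
  fixes f :: "nat \<Rightarrow> real"
  assumes "\<not> filterlim f at_top sequentially"
  obtains Z s where "strict_mono (s :: nat \<Rightarrow> nat)" "\<And>n. f (s n) \<le> Z"
proof -
  obtain Z where "\<not> (\<forall>\<^sub>F n in sequentially. Z < f n)"
    using assms by (auto simp: filterlim_at_top_dense)
  then obtain s :: "nat \<Rightarrow> nat" where "strict_mono s" "\<And>n. \<not> Z < f (s n)"
    using not_eventually_subseq[of "\<lambda>n. Z < f n"] by blast
  then show ?thesis using that[of s Z] by (auto simp: not_less)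
qed

text \<open>A bounded sequence f in H1 with centres z and profiles U. The centre of the k-th profile is \<open>z n k\<close>. The
last assumption says that the profile with index k + 1 has, up to a factor 2, the largest L2 norm among
the weak limits of f along subsequences and centres x that run away from the centres with index at
most k.\<close>
locale profiles =
  fixes f :: "nat \<Rightarrow> 'a::euclidean_space \<Rightarrow> real" and z :: "nat \<Rightarrow> nat \<Rightarrow> 'a" and U :: "nat \<Rightarrow> 'a \<Rightarrow> real" and M :: real
  assumes f: "\<And>n. f n \<in> H1" and fM: "\<And>n. h1.sq (f n) \<le> M"
    and weak: "\<And>k. H1_weakly_converges (\<lambda>n x. f n (x + z n k)) (U k)"
    and sep: "\<And>j k. j \<noteq> k \<Longrightarrow> filterlim (\<lambda>n. norm (z n j - z n k)) at_top sequentially"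
    and near_max: "\<And>k \<tau> x w. strict_mono (\<tau> :: nat \<Rightarrow> nat) \<Longrightarrow>
       (\<And>j. j < Suc k \<Longrightarrow> filterlim (\<lambda>n. norm (x n - z (\<tau> n) j)) at_top sequentially) \<Longrightarrow>
       H1_weakly_converges (\<lambda>n t. f (\<tau> n) (t + x n)) w \<Longrightarrow> l2.sq w \<le> 4 * l2.sq (U (Suc k))"
begin

lemma U_mem: "U k \<in> H1" using weak[of k] by (rule weak_H1_limit_mem)

text \<open>The remainder after the removal of the first k profiles.\<close>
definition R :: "nat \<Rightarrow> nat \<Rightarrow> 'a \<Rightarrow> real" where
  "R k n x = f n x - (\<Sum>j<k. U j (x - z n j))"

lemma R_0: "R 0 n = f n" by (simp add: R_def fun_eq_iff)

lemma U_shift: "(\<lambda>x. U k (x - h)) \<in> H1"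
  using H1_shift[OF U_mem[of k], of "- h"] by simp

lemma R_Suc: "R (Suc k) n = (\<lambda>x. R k n x - U k (x - z n k))"
  by (simp add: R_def fun_eq_iff)

lemma R_mem: "R k n \<in> H1"
  by (induction k) (auto simp: R_0 f R_Suc intro: h1.diff_mem U_shift)

lemma R_weak:
  assumes \<tau>: "H1_weakly_converges (\<lambda>n t. f (\<tau> n) (t + x n)) w"
    and W: "\<And>j. j < k \<Longrightarrow> H1_weakly_converges (\<lambda>n t. U j (t + (x n - z (\<tau> n) j))) (W j)"
  shows "H1_weakly_converges (\<lambda>n t. R k (\<tau> n) (t + x n)) (\<lambda>t. w t - (\<Sum>j<k. W j t))"
  using W
proof (induction k)
  case 0
  then show ?case using \<tau> by (simp add: R_0)
next
  case (Suc k)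
  have "H1_weakly_converges (\<lambda>n t. R k (\<tau> n) (t + x n) - U k (t + (x n - z (\<tau> n) k))) (\<lambda>t. (w t - (\<Sum>j<k. W j t)) - W k t)"
    by (rule weak_diff[OF Suc.IH Suc.prems]) (auto intro: Suc.prems)
  then show ?case by (simp add: R_Suc algebra_simps)
qed

lemma R_weak_far:
  assumes "H1_weakly_converges (\<lambda>n t. f (\<tau> n) (t + x n)) w"
    and "\<And>j. j < k \<Longrightarrow> filterlim (\<lambda>n. norm (x n - z (\<tau> n) j)) at_top sequentially"
  shows "H1_weakly_converges (\<lambda>n t. R k (\<tau> n) (t + x n)) w"
  using R_weak[OF assms(1), of k "\<lambda>j t. 0"] weak_shift_to_0[OF U_mem assms(2)] by simp

lemma R_weak_next: "H1_weakly_converges (\<lambda>n t. R k n (t + z n k)) (U k)"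
  by (rule R_weak_far[where \<tau>="\<lambda>n. n", OF weak]) (use sep in auto)

lemma R_weak_previous:
  assumes j: "j < k" shows "H1_weakly_converges (\<lambda>n t. R k n (t + z n j)) (\<lambda>t. 0)"
proof -
  have "H1_weakly_converges (\<lambda>n t. R k n (t + z n j)) (\<lambda>t. U j t - (\<Sum>i<k. (if i = j then U j else (\<lambda>t. 0)) t))"
  proof (rule R_weak[where \<tau>="\<lambda>n. n", OF weak])
    fix i assume "i < k"
    show "H1_weakly_converges (\<lambda>n t. U i (t + (z n j - z n i))) (if i = j then U j else (\<lambda>t. 0))"
      using weak_const[OF U_mem, of j] weak_shift_to_0[OF U_mem sep] by (cases "i = j") auto
  qed
  moreover have "(\<Sum>i<k. (if i = j then U j else (\<lambda>t. 0)) t) = U j t" for t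
    using j by (subst sum.cong[OF refl, where h="\<lambda>i. if i = j then U j t else 0"]) auto
  ultimately show ?thesis by simp
qed

text \<open>Translation invariance lets the mixed term be evaluated after recentring, where the remainder converges
weakly to the profile that is removed.\<close>
lemma form_split:
  assumes lin: "\<And>u v w. u \<in> H1 \<Longrightarrow> v \<in> H1 \<Longrightarrow> w \<in> H1 \<Longrightarrow> B (\<lambda>x. u x - v x) w = B u w - B v w"
    and sym: "\<And>u v. u \<in> H1 \<Longrightarrow> v \<in> H1 \<Longrightarrow> B u v = (B v u :: real)"
    and shift: "\<And>u v h. u \<in> H1 \<Longrightarrow> v \<in> H1 \<Longrightarrow> B (\<lambda>x. u (x + h)) (\<lambda>x. v (x + h)) = B u v"
    and wc: "\<And>g g0 v. H1_weakly_converges g g0 \<Longrightarrow> v \<in> H1 \<Longrightarrow> (\<lambda>n. B (g n) v) \<longlonglongrightarrow> B g0 v"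
  shows "(\<lambda>n. B (f n) (f n) - B (R k n) (R k n)) \<longlonglongrightarrow> (\<Sum>j<k. B (U j) (U j))"
proof (induction k)
  case (Suc k)
  have step: "B (R k n) (R k n) - B (R (Suc k) n) (R (Suc k) n) = 2 * B (\<lambda>t. R k n (t + z n k)) (U k) - B (U k) (U k)" for n
  proof -
    let ?a = "R k n" and ?b = "\<lambda>x. U k (x - z n k)"
    have ab: "?a \<in> H1" "?b \<in> H1" "(\<lambda>x. ?a x - ?b x) \<in> H1" by (auto intro: R_mem U_shift h1.diff_mem)
    have "B (\<lambda>x. ?a x - ?b x) (\<lambda>x. ?a x - ?b x) = B ?a (\<lambda>x. ?a x - ?b x) - B ?b (\<lambda>x. ?a x - ?b x)"
      by (rule lin[OF ab])
    also have "\<dots> = B (\<lambda>x. ?a x - ?b x) ?a - B (\<lambda>x. ?a x - ?b x) ?b" using ab by (simp add: sym)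
    also have "\<dots> = B ?a ?a - B ?b ?a - B ?a ?b + B ?b ?b" using ab by (simp add: lin)
    also have "B ?b ?a = B ?a ?b" using ab by (simp add: sym)
    also have "B ?b ?b = B (U k) (U k)" using shift[OF U_mem[of k] U_mem[of k], of "- z n k"] by simp
    also have "B ?a ?b = B (\<lambda>t. R k n (t + z n k)) (U k)"
      using shift[OF ab(1,2), of "z n k"] by simp
    finally show ?thesis by (simp add: R_Suc)
  qed
  have "(\<lambda>n. (B (f n) (f n) - B (R k n) (R k n)) + (2 * B (\<lambda>t. R k n (t + z n k)) (U k) - B (U k) (U k)))
     \<longlonglongrightarrow> (\<Sum>j<k. B (U j) (U j)) + (2 * B (U k) (U k) - B (U k) (U k))"
    by (intro tendsto_intros Suc wc R_weak_next U_mem)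
  then show ?case unfolding step[symmetric] by simp
qed (simp add: R_0)

lemma dirichlet_split:
  "(\<lambda>n. dirichlet_integral (f n) - dirichlet_integral (R k n)) \<longlonglongrightarrow> (\<Sum>j<k. dirichlet_integral (U j))"
  unfolding dirichlet_eq
proof (rule form_split[where B=dir_ip])
  show "dir_ip (\<lambda>x. u x - v x) w = dir_ip u w - dir_ip v w" if "u \<in> H1" "v \<in> H1" "w \<in> H1" for u v w :: "'a \<Rightarrow> real"
    using dir_ip_lin[OF that, of 1 "-1"] by simp
qed (auto intro: dir_ip_commute dir_ip_shift weakD_dir)

lemma l2_split: "(\<lambda>n. l2.sq (f n) - l2.sq (R k n)) \<longlonglongrightarrow> (\<Sum>j<k. l2.sq (U j))"
  unfolding l2.sq_def
  by (rule form_split[where B=l2_ip]) (auto intro: l2_ip_commute l2_ip_shift weakD_l2 l2.ip_diff H1_L2)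

lemma h1_split: "(\<lambda>n. h1.sq (f n) - h1.sq (R k n)) \<longlonglongrightarrow> (\<Sum>j<k. h1.sq (U j))"
proof -
  have "(\<lambda>n. (l2.sq (f n) - l2.sq (R k n)) + (dirichlet_integral (f n) - dirichlet_integral (R k n)))
    \<longlonglongrightarrow> (\<Sum>j<k. l2.sq (U j)) + (\<Sum>j<k. dirichlet_integral (U j))"
    by (intro tendsto_add l2_split dirichlet_split)
  then show ?thesis by (simp add: h1_sq sum.distrib algebra_simps)
qed

lemma M_nonneg: "M \<ge> 0" using fM[of 0] h1_sq_nonneg[of "f 0"] by linarith

lemma R_eventually_bounded: "\<forall>\<^sub>F n in sequentially. h1.sq (R k n) \<le> M + 1"
proof -
  have "\<forall>\<^sub>F n in sequentially. -1 < h1.sq (f n) - h1.sq (R k n)"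
  proof (rule order_tendstoD(1)[OF h1_split])
    have "0 \<le> (\<Sum>j<k. h1.sq (U j))" by (intro sum_nonneg h1_sq_nonneg)
    then show "- 1 < (\<Sum>j<k. h1.sq (U j))" by linarith
  qed
  then show ?thesis by eventually_elim (use fM in \<open>smt (verit)\<close>)
qed

lemma R_bounded: "\<exists>L. \<forall>n. h1.sq (R k n) \<le> L"
proof (induction k)
  case 0 then show ?case using fM by (auto simp: R_0)
next
  case (Suc k)
  then obtain L where L: "\<And>n. h1.sq (R k n) \<le> L" by blast
  have shift: "h1.sq (\<lambda>x. U k (x - h)) = h1.sq (U k)" for h
    using h1_sq_shift[OF U_mem[of k], of "- h"] by simp
  have "h1.sq (R (Suc k) n) \<le> 2 * L + 2 * h1.sq (U k)" for n
    using h1.sq_diff_le[OF R_mem[of k n] U_shift[of k "z n k"]] L[of n] shift[of "z n k"] unfolding R_Suc by linarith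
  then show ?case by blast
qed

text \<open>Bessel's inequality: the squared norms of the profiles have a finite sum.\<close>
lemma profiles_vanish: "(\<lambda>k. l2.sq (U k)) \<longlonglongrightarrow> 0"
proof -
  have "(\<Sum>j<k. l2.sq (U j)) \<le> M" for k
  proof (rule LIMSEQ_le_const2[OF l2_split])
    show "\<exists>N. \<forall>n\<ge>N. l2.sq (f n) - l2.sq (R k n) \<le> M"
    proof (intro exI allI impI)
      fix n
      show "l2.sq (f n) - l2.sq (R k n) \<le> M"
        using fM[of n] dirichlet_nonneg[of "f n"] l2_sq_nonneg[of "R k n"] by (simp add: h1_sq)
    qed
  qed
  then have "summable (\<lambda>k. l2.sq (U k))"
    by (intro summableI_nonneg_bounded[where x=M] l2_sq_nonneg)
  then show ?thesis by (rule summable_LIMSEQ_zero)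
qed

text \<open>If \<open>\<Psi> 0 > 0\<close>, both sides are infinite. Otherwise the profiles are removed one after the other by the
Brezis-Lieb lemma.\<close>
lemma Psi_split:
  assumes N: "DIM('a) \<ge> 3" and g: "growth_C1 (sobolev_exponent DIM('a)) \<Psi> C"
  shows "limsup (\<lambda>n. Psi_integral \<Psi> (f n)) = (\<Sum>j\<le>i. Psi_integral \<Psi> (U j)) + limsup (\<lambda>n. Psi_integral \<Psi> (R (Suc i) n))"
proof (cases "\<Psi> 0 = 0")
  case False
  have inf: "Psi_integral \<Psi> v = \<infinity>" if "v \<in> H1" for v :: "'a \<Rightarrow> real"
    by (rule Psi_integral_infinite[OF g False H1_L2[OF that]])
  have S: "(\<Sum>j\<le>i. Psi_integral \<Psi> (U j)) = \<infinity>"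
  proof -
    have "Psi_integral \<Psi> (U 0) \<le> (\<Sum>j\<le>i. Psi_integral \<Psi> (U j))" by (rule member_le_sum) auto
    then show ?thesis by (simp add: inf U_mem top_unique)
  qed
  show ?thesis unfolding S inf[OF f] by (simp add: Limsup_const)
next
  case True
  note [measurable] = growth_C1_measurable[OF g]
  have nn: "\<Psi> s \<ge> 0" for s using g by (simp add: growth_C1_def)
  note PI = H1_Psi_integrable(2)[OF N g True]
  have step: "limsup (\<lambda>n. Psi_integral \<Psi> (R k n)) = Psi_integral \<Psi> (U k) + limsup (\<lambda>n. Psi_integral \<Psi> (R (Suc k) n))" for k
  proof -
    let ?g = "\<lambda>n t. R k n (t + z n k)"
    obtain L where L: "\<And>n. h1.sq (R k n) \<le> L" using R_bounded by blast
    have gL: "h1.sq (?g n) \<le> L" for n using L by (simp add: h1_sq_shift R_mem)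
    have lim: "(\<lambda>n. (\<integral>x. \<Psi> (?g n x) \<partial>lborel) - (\<integral>x. \<Psi> (?g n x - U k x) \<partial>lborel)) \<longlonglongrightarrow> (\<integral>x. \<Psi> (U k x) \<partial>lborel)"
      by (rule weak_Brezis_Lieb[OF N g True R_weak_next gL])
    have "limsup (\<lambda>n. ennreal (\<integral>x. \<Psi> (?g n x) \<partial>lborel))
      = ennreal (\<integral>x. \<Psi> (U k x) \<partial>lborel) + limsup (\<lambda>n. ennreal (\<integral>x. \<Psi> (?g n x - U k x) \<partial>lborel))"
      by (rule limsup_ennreal_split[OF _ _ lim]) (auto intro!: integral_nonneg_AE nn)
    moreover have "ennreal (\<integral>x. \<Psi> (?g n x) \<partial>lborel) = Psi_integral \<Psi> (R k n)" for n
      unfolding PI[OF H1_shift[OF R_mem], symmetric] by (rule Psi_integral_shift[OF g H1_L2[OF R_mem]])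
    moreover have "ennreal (\<integral>x. \<Psi> (?g n x - U k x) \<partial>lborel) = Psi_integral \<Psi> (R (Suc k) n)" for n
    proof -
      have "Psi_integral \<Psi> (R (Suc k) n) = Psi_integral \<Psi> (\<lambda>t. R (Suc k) n (t + z n k))"
        by (rule Psi_integral_shift[OF g H1_L2[OF R_mem], symmetric])
      also have "(\<lambda>t. R (Suc k) n (t + z n k)) = (\<lambda>x. ?g n x - U k x)" by (simp add: R_Suc)
      finally show ?thesis by (simp add: PI h1.diff_mem H1_shift R_mem U_mem)
    qed
    ultimately show ?thesis by (simp add: PI U_mem)
  qed
  have "limsup (\<lambda>n. Psi_integral \<Psi> (f n)) = (\<Sum>j<k. Psi_integral \<Psi> (U j)) + limsup (\<lambda>n. Psi_integral \<Psi> (R k n))" for k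
  proof (induction k)
    case (Suc k)
    then show ?case unfolding step[of k] by (simp add: add.assoc)
  qed (simp add: R_0)
  from this[of "Suc i"] show ?thesis by (simp only: lessThan_Suc_atMost)
qed

text \<open>Suppose that the averages at points \<open>x n\<close> stay above c. If these points run away from the centres of all
removed profiles, then a weak limit of f recentred at them is admissible in the choice of the next
profile, so its norm is at most twice the norm of that profile. Otherwise they stay, along a
subsequence, at bounded distance from one of those centres, where the remainder converges weakly to 0.\<close>
lemma R_averages_small:
  fixes e c :: real
  assumes e: "e > 0"
    and c: "c > 2 * sqrt (l2.sq (U (Suc k))) * (sqrt (measure lborel (ball 0 e :: 'a set)) / measure lborel (ball 0 e :: 'a set))"
  shows "\<forall>\<^sub>F n in sequentially. \<forall>x. \<bar>avg e (R (Suc k) n) x\<bar> \<le> c"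
proof (rule ccontr)
  let ?\<kappa> = "sqrt (measure lborel (ball 0 e :: 'a set)) / measure lborel (ball 0 e :: 'a set)"
  let ?v = "R (Suc k)"
  have \<kappa>: "?\<kappa> \<ge> 0" by simp
  have c0: "c > 0" using c by (rule le_less_trans[rotated]) (simp add: l2_sq_nonneg)
  assume "\<not> ?thesis"
  then obtain s :: "nat \<Rightarrow> nat" where s: "strict_mono s" "\<And>n. \<not> (\<forall>x. \<bar>avg e (?v (s n)) x\<bar> \<le> c)"
    using not_eventually_subseq[of "\<lambda>n. \<forall>x. \<bar>avg e (?v n) x\<bar> \<le> c"] by blast
  then have "\<forall>n. \<exists>x. \<not> \<bar>avg e (?v (s n)) x\<bar> \<le> c" by blast
  then obtain x where x: "\<And>n. c < \<bar>avg e (?v (s n)) (x n)\<bar>" unfolding not_le by metis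
  show False
  proof (cases "\<forall>j<Suc k. filterlim (\<lambda>n. norm (x n - z (s n) j)) at_top sequentially")
    case True
    have fs: "(\<lambda>t. f (s n) (t + x n)) \<in> H1" for n by (rule H1_shift[OF f])
    have fsM: "h1.sq (\<lambda>t. f (s n) (t + x n)) \<le> M" for n using fM by (simp add: h1_sq_shift f)
    obtain r w where r: "strict_mono (r :: nat \<Rightarrow> nat)"
      and fw: "H1_weakly_converges (\<lambda>n t. f (s (r n)) (t + x (r n))) w"
      by (rule H1_weak_compactness[OF fs fsM])
    have w: "w \<in> H1" by (rule weak_H1_limit_mem[OF fw])
    have far: "filterlim (\<lambda>n. norm (x (r n) - z (s (r n)) j)) at_top sequentially" if "j < Suc k" for j
      by (rule filterlim_compose[OF True[rule_format, OF that] filterlim_subseq[OF r]])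
    have sr: "strict_mono (\<lambda>n. s (r n))" using strict_mono_o[OF s(1) r] by (simp add: o_def)
    have wU: "l2.sq w \<le> 4 * l2.sq (U (Suc k))" by (rule near_max[OF sr far fw])
    have "H1_weakly_converges (\<lambda>n t. ?v (s (r n)) (t + x (r n))) w"
      by (rule R_weak_far[OF fw far])
    from weakD_l2[OF this L2_indicator_ball[of e]]
    have "(\<lambda>n. avg e (?v (s (r n))) (x (r n))) \<longlonglongrightarrow> l2_ip w (indicator (ball 0 e)) / measure lborel (ball 0 e :: 'a set)"
      unfolding avg_def by (rule tendsto_divide[OF _ tendsto_const]) (use content_ball_pos[OF e] in auto)
    moreover have "avg e w 0 = l2_ip w (indicator (ball 0 e)) / measure lborel (ball 0 e :: 'a set)" by (simp add: avg_def)
    ultimately have lim: "(\<lambda>n. \<bar>avg e (?v (s (r n))) (x (r n))\<bar>) \<longlonglongrightarrow> \<bar>avg e w 0\<bar>"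
      by (simp only: tendsto_rabs)
    have "c \<le> \<bar>avg e w 0\<bar>" by (rule LIMSEQ_le_const[OF lim]) (use x in \<open>auto intro: less_imp_le\<close>)
    also have "\<dots> \<le> sqrt (l2.sq w) * ?\<kappa>" by (rule avg_bound[OF H1_L2[OF w]])
    also have "\<dots> \<le> sqrt (4 * l2.sq (U (Suc k))) * ?\<kappa>" using wU \<kappa> by (intro mult_right_mono) auto
    also have "\<dots> = 2 * sqrt (l2.sq (U (Suc k))) * ?\<kappa>" by (simp add: real_sqrt_mult)
    finally show False using c by simp
  next
    case False
    then obtain j where j: "j < Suc k" "\<not> filterlim (\<lambda>n. norm (x n - z (s n) j)) at_top sequentially" by blast
    obtain Z a where a: "strict_mono (a :: nat \<Rightarrow> nat)" "\<And>n. norm (x (a n) - z (s (a n)) j) \<le> Z"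
      using not_filterlim_at_top_bounded_subseq[OF j(2)] by blast
    have "bounded (range (\<lambda>n. x (a n) - z (s (a n)) j))" using a(2) by (auto simp: bounded_iff)
    then obtain y b where b: "strict_mono (b :: nat \<Rightarrow> nat)" "((\<lambda>n. x (a n) - z (s (a n)) j) \<circ> b) \<longlonglongrightarrow> y"
      using bounded_imp_convergent_subsequence by blast
    define m where "m n = s (a (b n))" for n
    define d where "d n = x (a (b n)) - z (m n) j" for n
    have m: "strict_mono m" unfolding m_def using s(1) a(1) b(1) by (simp add: strict_mono_def)
    have d: "d \<longlonglongrightarrow> y" using b(2) unfolding d_def[abs_def] m_def by (simp add: o_def)
    obtain L where L: "\<And>n. h1.sq (?v n) \<le> L" using R_bounded by blast
    have L0: "L \<ge> 0" using L[of 0] h1_sq_nonneg[of "?v 0"] by linarith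
    have "H1_weakly_converges (\<lambda>n t. ?v (m n) (t + z (m n) j)) (\<lambda>t. 0)"
      by (rule weak_subseq[OF R_weak_previous[OF j(1)] m])
    from weakD_l2[OF this L2_shift[OF L2_indicator_ball[of e], of "- y"]]
    have "(\<lambda>n. l2_ip (\<lambda>t. ?v (m n) (t + z (m n) j)) (\<lambda>t. indicator (ball 0 e) (t + - y))) \<longlonglongrightarrow> 0"
      by (simp add: l2_ip_def)
    moreover have "l2_ip (\<lambda>t. ?v (m n) (t + z (m n) j)) (\<lambda>t. indicator (ball 0 e) (t + - y))
        = l2_ip (\<lambda>t. ?v (m n) (t + (y + z (m n) j))) (indicator (ball 0 e))" for n
      using l2_ip_shift[OF L2_shift[OF H1_L2[OF R_mem[of "Suc k" "m n"]], of "y + z (m n) j"] L2_indicator_ball[of e], of "- y"]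
      by (simp add: algebra_simps)
    ultimately have "(\<lambda>n. l2_ip (\<lambda>t. ?v (m n) (t + (y + z (m n) j))) (indicator (ball 0 e))) \<longlonglongrightarrow> 0" by simp
    then have lim1: "(\<lambda>n. avg e (?v (m n)) (y + z (m n) j)) \<longlonglongrightarrow> 0"
      unfolding avg_def by (rule tendsto_divide_zero)
    have diff: "\<bar>avg e (?v (m n)) (x (a (b n))) - avg e (?v (m n)) (y + z (m n) j)\<bar> \<le> sqrt L * norm (d n - y) * ?\<kappa>" for n
    proof -
      let ?w = "?v (m n)" and ?p = "x (a (b n))" and ?o = "y + z (m n) j"
      have wL: "?w \<in> L2" by (rule H1_L2[OF R_mem])
      let ?D = "\<lambda>t. ?w (t + (?p - ?o)) - ?w t"
      have DL: "?D \<in> L2" by (intro l2.diff_mem L2_shift wL)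
      have po: "?p - ?o = d n - y" by (simp add: d_def)
      have eq: "avg e ?w ?p - avg e ?w ?o = avg e ?D ?o"
      proof -
        have "(\<lambda>h. ?w (h + ?p) - ?w (h + ?o)) = (\<lambda>h. ?D (h + ?o))" by (simp add: algebra_simps)
        then have "l2_ip (\<lambda>h. ?w (h + ?p)) (indicator (ball 0 e)) - l2_ip (\<lambda>h. ?w (h + ?o)) (indicator (ball 0 e))
          = l2_ip (\<lambda>h. ?D (h + ?o)) (indicator (ball 0 e))"
          using l2.ip_diff[OF L2_shift[OF wL, of ?p] L2_shift[OF wL, of ?o] L2_indicator_ball[of e]] by simp
        then show ?thesis unfolding avg_def by (simp add: diff_divide_distrib[symmetric])
      qed
      have "\<bar>avg e ?D ?o\<bar> \<le> sqrt (l2.sq ?D) * ?\<kappa>" by (rule avg_bound[OF DL])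
      also have "\<dots> \<le> sqrt (L * (norm (d n - y))\<^sup>2) * ?\<kappa>"
        using H1_translation_estimate[OF R_mem[of "Suc k" "m n"] L[of "m n"], of "?p - ?o"] \<kappa> unfolding po
        by (intro mult_right_mono real_sqrt_le_mono) auto
      also have "\<dots> = sqrt L * norm (d n - y) * ?\<kappa>" by (simp add: real_sqrt_mult)
      finally show ?thesis unfolding eq .
    qed
    have "(\<lambda>n. sqrt L * norm (d n - y) * ?\<kappa>) \<longlonglongrightarrow> sqrt L * norm (y - y) * ?\<kappa>" by (intro tendsto_intros d)
    then have "(\<lambda>n. sqrt L * norm (d n - y) * ?\<kappa>) \<longlonglongrightarrow> 0" by simp
    then have "(\<lambda>n. avg e (?v (m n)) (x (a (b n))) - avg e (?v (m n)) (y + z (m n) j)) \<longlonglongrightarrow> 0"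
      by (rule Lim_null_comparison[rotated]) (use diff in auto)
    from tendsto_add[OF this lim1] have "(\<lambda>n. \<bar>avg e (?v (m n)) (x (a (b n)))\<bar>) \<longlonglongrightarrow> 0"
      by (simp add: tendsto_rabs_zero)
    then have "c \<le> 0" by (rule LIMSEQ_le_const) (use x[of "a (b _)"] in \<open>auto intro: less_imp_le simp: m_def\<close>)
    then show False using c0 by simp
  qed
qed

text \<open>The constants are chosen in the order \<open>\<epsilon>\<close>, then d and B from the subcriticality of \<open>\<Psi>\<close>, then the radius e
of the balls, and finally the number of profiles.\<close>
theorem Psi_remainder_vanishes:
  assumes N: "DIM('a) \<ge> 3" and g: "growth_C1 (sobolev_exponent DIM('a)) \<Psi> C"
    and z0: "((\<lambda>s. \<Psi> s / \<bar>s\<bar>\<^sup>2) \<longlongrightarrow> 0) (at 0)"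
    and inf: "((\<lambda>s. \<Psi> s / \<bar>s\<bar> powr sobolev_exponent DIM('a)) \<longlongrightarrow> 0) at_infinity"
  shows "(\<lambda>i. limsup (\<lambda>n. Psi_integral \<Psi> (R (Suc i) n))) \<longlonglongrightarrow> 0"
proof -
  let ?q = "sobolev_exponent DIM('a)"
  obtain K where K: "K \<ge> 0"
    "\<And>u :: 'a \<Rightarrow> real. u \<in> H1 \<Longrightarrow> h1.sq u \<le> M + 1 \<Longrightarrow> integrable lborel (\<lambda>x. grw ?q (u x))"
    "\<And>u :: 'a \<Rightarrow> real. u \<in> H1 \<Longrightarrow> h1.sq u \<le> M + 1 \<Longrightarrow> (\<integral>x. grw ?q (u x) \<partial>lborel) \<le> K"
    using H1_grw_bound[OF N, of "M + 1"] by metis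
  have main: "\<forall>\<^sub>F i in sequentially. limsup (\<lambda>n. Psi_integral \<Psi> (R (Suc i) n)) \<le> ennreal t" if t: "t > 0" for t
  proof -
    define \<epsilon> where "\<epsilon> = t / (2 * (K + 1))"
    have \<epsilon>: "\<epsilon> > 0" using t K(1) by (simp add: \<epsilon>_def)
    have "\<epsilon> * K \<le> \<epsilon> * (K + 1)" using \<epsilon> by (intro mult_left_mono) auto
    also have "\<dots> = t / 2" using K(1) by (simp add: \<epsilon>_def divide_simps)
    finally have \<epsilon>K: "\<epsilon> * K \<le> t / 2" .
    obtain d B where d: "d > 0" and B: "B \<ge> 0" and bd: "\<And>s. \<Psi> s \<le> \<epsilon> * grw ?q s + B * indicator {s. d \<le> \<bar>s\<bar>} s"
      using subcritical_bound(2)[OF g z0 inf \<epsilon>] by blast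
    define A where "A = B * (4 * (M + 1)) / d\<^sup>2"
    have A: "A \<ge> 0" using B M_nonneg by (simp add: A_def)
    define e where "e = sqrt (t / (2 * (A + 1)))"
    have e: "e > 0" "e\<^sup>2 = t / (2 * (A + 1))" using t A by (auto simp: e_def)
    have "A * e\<^sup>2 \<le> (A + 1) * e\<^sup>2" by (intro mult_right_mono) auto
    also have "\<dots> = t / 2" using A by (subst e(2)) (simp add: divide_simps)
    finally have Ae: "B * (4 * (M + 1) * e\<^sup>2 / d\<^sup>2) \<le> t / 2" by (simp add: A_def)
    let ?\<kappa> = "sqrt (measure lborel (ball 0 e :: 'a set)) / measure lborel (ball 0 e :: 'a set)"
    have "(\<lambda>k. 2 * sqrt (l2.sq (U (Suc k))) * ?\<kappa>) \<longlonglongrightarrow> 2 * sqrt 0 * ?\<kappa>"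
      by (intro tendsto_intros LIMSEQ_Suc profiles_vanish)
    then have "\<forall>\<^sub>F k in sequentially. 2 * sqrt (l2.sq (U (Suc k))) * ?\<kappa> < d / 2"
      using d by (intro order_tendstoD) auto
    then show ?thesis
    proof eventually_elim
      case (elim k)
      show ?case
      proof (rule Limsup_bounded)
        show "\<forall>\<^sub>F n in sequentially. Psi_integral \<Psi> (R (Suc k) n) \<le> ennreal t"
          using R_averages_small[OF e(1) elim] R_eventually_bounded[of "Suc k"]
        proof eventually_elim
          case (elim n)
          have "Psi_integral \<Psi> (R (Suc k) n) \<le> ennreal (\<epsilon> * K + B * (4 * (M + 1) * e\<^sup>2 / d\<^sup>2))"
            by (rule Psi_integral_small[OF g R_mem elim(2) _ K(2)[OF R_mem elim(2)] K(3)[OF R_mem elim(2)] bd _ B d e(1)])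
               (use elim(1) \<epsilon> M_nonneg in auto)
          also have "\<dots> \<le> ennreal t" using \<epsilon>K Ae by (intro ennreal_leI) linarith
          finally show ?case .
        qed
      qed
    qed
  qed
  show ?thesis
  proof (rule order_tendstoI)
    fix a :: ennreal assume "0 < a"
    then obtain b where b: "0 < b" "b < a" using dense by blast
    then obtain t where t: "b = ennreal t" "t > 0" by (cases b) (auto simp: top_unique)
    show "\<forall>\<^sub>F i in sequentially. limsup (\<lambda>n. Psi_integral \<Psi> (R (Suc i) n)) < a"
      using main[OF t(2)] by eventually_elim (use b t in auto)
  qed simp
qed

end

section \<open>Extraction of the profiles\<close>

text \<open>The function w is a weak limit of the sequence \<open>u \<circ> s\<close> along the subsequence \<open>\<tau>\<close>, recentred at points x
that run away from the first k families Y of centres. The centres Y are indexed by the original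
sequence, so that they need no change when a further subsequence is taken.\<close>
definition profile_limit ::
  "(nat \<Rightarrow> 'a::euclidean_space \<Rightarrow> real) \<Rightarrow> (nat \<Rightarrow> nat) \<Rightarrow> (nat \<Rightarrow> nat \<Rightarrow> 'a) \<Rightarrow> nat \<Rightarrow>
    (nat \<Rightarrow> nat) \<Rightarrow> (nat \<Rightarrow> 'a) \<Rightarrow> ('a \<Rightarrow> real) \<Rightarrow> bool" where
  "profile_limit u s Y k \<tau> x w \<longleftrightarrow> strict_mono \<tau> \<and>
     (\<forall>j<k. filterlim (\<lambda>n. norm (x n - Y j (s (\<tau> n)))) at_top sequentially) \<and>
     H1_weakly_converges (\<lambda>n t. u (s (\<tau> n)) (t + x n)) w"

lemma profile_limit_exists:
  fixes u :: "nat \<Rightarrow> 'a::euclidean_space \<Rightarrow> real"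
  assumes u: "\<And>n. u n \<in> H1" and M: "\<And>n. h1.sq (u n) \<le> M"
  shows "\<exists>\<tau> x w. profile_limit u s Y k \<tau> x w"
proof -
  obtain b :: 'a where b: "b \<in> Basis" using nonempty_Basis by blast
  define x where "x n = (real n + (\<Sum>j<k. norm (Y j (s n)))) *\<^sub>R b" for n
  have far: "real n \<le> norm (x n - Y j (s n))" if "j < k" for j n
  proof -
    have "norm (Y j (s n)) \<le> (\<Sum>j<k. norm (Y j (s n)))" using that by (intro member_le_sum) auto
    moreover have "norm (x n) = real n + (\<Sum>j<k. norm (Y j (s n)))" using b by (simp add: x_def sum_nonneg)
    ultimately show ?thesis using norm_triangle_ineq2[of "x n" "Y j (s n)"] by linarith
  qed
  have "h1.sq (\<lambda>t. u (s n) (t + x n)) \<le> M" for n using M u by (simp add: h1_sq_shift)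
  with H1_shift[OF u] obtain \<tau> w where \<tau>: "strict_mono (\<tau> :: nat \<Rightarrow> nat)"
      "H1_weakly_converges (\<lambda>n t. u (s (\<tau> n)) (t + x (\<tau> n))) w"
    by (rule H1_weak_compactness[of "\<lambda>n t. u (s n) (t + x n)"])
  have "filterlim (\<lambda>n. norm (x (\<tau> n) - Y j (s (\<tau> n)))) at_top sequentially" if "j < k" for j
  proof (rule filterlim_at_top_mono[OF filterlim_compose[OF filterlim_real_sequentially filterlim_subseq[OF \<tau>(1)]]])
    show "\<forall>\<^sub>F n in sequentially. real (\<tau> n) \<le> norm (x (\<tau> n) - Y j (s (\<tau> n)))"
      by (intro always_eventually allI far that)
  qed
  then show ?thesis using \<tau> unfolding profile_limit_def by (intro exI[of _ \<tau>] exI[of _ "\<lambda>n. x (\<tau> n)"] exI[of _ w]) auto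
qed

lemma profile_limit_sq_le:
  assumes u: "\<And>n. u n \<in> H1" and M: "\<And>n. h1.sq (u n) \<le> M" and pl: "profile_limit u s Y k \<tau> x w"
  shows "l2.sq w \<le> M"
proof -
  have wk: "H1_weakly_converges (\<lambda>n t. u (s (\<tau> n)) (t + x n)) w" using pl by (simp add: profile_limit_def)
  have w: "w \<in> L2" by (rule H1_L2[OF weak_H1_limit_mem[OF wk]])
  have M0: "M \<ge> 0" using M[of 0] h1_sq_nonneg[of "u 0"] by linarith
  have "l2_ip w w \<le> sqrt M * sqrt (l2.sq w)"
  proof (rule LIMSEQ_le_const2[OF weakD_l2[OF wk w]], intro exI allI impI)
    fix n
    let ?g = "\<lambda>t. u (s (\<tau> n)) (t + x n)"
    have g: "?g \<in> H1" by (rule H1_shift[OF u])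
    have "l2.sq ?g \<le> M"
      using M[of "s (\<tau> n)"] h1_sq_shift[OF u, of "s (\<tau> n)" "x n"] dirichlet_nonneg[of ?g] h1_sq[of ?g] by linarith
    then have "sqrt (l2.sq ?g) * sqrt (l2.sq w) \<le> sqrt M * sqrt (l2.sq w)"
      by (intro mult_right_mono) (auto simp: l2_sq_nonneg)
    then show "l2_ip ?g w \<le> sqrt M * sqrt (l2.sq w)"
      using l2.Cauchy_Schwarz[OF H1_L2[OF g] w] by linarith
  qed
  then have "sqrt (l2.sq w) \<le> sqrt M"
    using M0 l2_sq_nonneg[of w] by (intro le_mult_sqrt_imp_sqrt_le) (auto simp: l2.sq_def)
  then show ?thesis by simp
qed

lemma profile_limit_near_maximal:
  fixes u :: "nat \<Rightarrow> 'a::euclidean_space \<Rightarrow> real"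
  assumes u: "\<And>n. u n \<in> H1" and M: "\<And>n. h1.sq (u n) \<le> M"
  obtains \<tau> x w where "profile_limit u s Y k \<tau> x w"
    "\<And>\<tau>' x' w'. profile_limit u s Y k \<tau>' x' w' \<Longrightarrow> l2.sq w' \<le> 4 * l2.sq w"
proof -
  define S where "S = {l2.sq w | \<tau> x w. profile_limit u s Y k \<tau> x w}"
  have S0: "S \<noteq> {}" using profile_limit_exists[where u=u and s=s and Y=Y and k=k, OF u M] by (auto simp: S_def)
  have bdd: "bdd_above S" using profile_limit_sq_le[where u=u, OF u M] by (intro bdd_aboveI[of _ M]) (auto simp: S_def)
  have up: "l2.sq w \<le> Sup S" if "profile_limit u s Y k \<tau> x w" for \<tau> x w
    by (rule cSup_upper[OF _ bdd]) (use that in \<open>auto simp: S_def\<close>)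
  obtain \<tau> x w where pl: "profile_limit u s Y k \<tau> x w" "Sup S \<le> 4 * l2.sq w"
  proof (cases "Sup S > 0")
    case True
    then have "Sup S / 4 < Sup S" by simp
    then obtain a where "a \<in> S" "Sup S / 4 < a" using less_cSup_iff[OF S0 bdd] by blast
    then show ?thesis using that by (auto simp: S_def)
  next
    case False
    obtain \<tau> x w where pl: "profile_limit u s Y k \<tau> x w" using profile_limit_exists[where u=u and s=s and Y=Y and k=k, OF u M] by blast
    show ?thesis by (rule that[OF pl]) (use False l2_sq_nonneg[of w] in linarith)
  qed
  show ?thesis by (rule that[OF pl(1)]) (use up pl(2) in \<open>meson order_trans\<close>)
qed

lemma filterlim_offset:
  "filterlim (\<lambda>n. f (n + k)) F sequentially \<longleftrightarrow> filterlim f F sequentially"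
  unfolding filterlim_iff by (subst eventually_sequentially_seg) simp

lemma weak_offset:
  assumes f: "\<And>n. f n \<in> H1" and w: "H1_weakly_converges (\<lambda>n. f (n + k)) g"
  shows "H1_weakly_converges f g"
  using f w unfolding H1_weakly_converges_def by (auto intro: LIMSEQ_offset[of "\<lambda>n. L (f n)" k for L])

text \<open>The states of the recursion consist of a subsequence s, the families Y of centres and the profiles U
chosen so far. The predicate P collects the properties of a state with profiles \<open>0, ..., k\<close>, and Q says
that the next state refines the subsequence, keeps what was chosen and adds a near-maximal profile.\<close>
theorem profiles_exist:
  fixes u :: "nat \<Rightarrow> 'a::euclidean_space \<Rightarrow> real"
  assumes u: "\<And>n. u n \<in> H1" and M: "\<And>n. h1.sq (u n) \<le> M"
  obtains r Y U where "strict_mono (r :: nat \<Rightarrow> nat)" "Y 0 = (\<lambda>m. 0)"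
    "convergent (\<lambda>n. dirichlet_integral (u (r n)))"
    "profiles (\<lambda>n. u (r n)) (\<lambda>n j. Y j (r n)) U M"
proof -
  define P where "P k st \<longleftrightarrow> (case st of (s :: nat \<Rightarrow> nat, Y :: nat \<Rightarrow> nat \<Rightarrow> 'a, U :: nat \<Rightarrow> 'a \<Rightarrow> real) \<Rightarrow>
     strict_mono s \<and> Y 0 = (\<lambda>m. 0) \<and> convergent (\<lambda>n. dirichlet_integral (u (s n))) \<and>
     (\<forall>j\<le>k. H1_weakly_converges (\<lambda>n t. u (s n) (t + Y j (s n))) (U j)) \<and>
     (\<forall>i\<le>k. \<forall>j\<le>k. i \<noteq> j \<longrightarrow> filterlim (\<lambda>n. norm (Y i (s n) - Y j (s n))) at_top sequentially))" for k :: nat and st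
  define Q where "Q k st st' \<longleftrightarrow> (case st of (s :: nat \<Rightarrow> nat, Y :: nat \<Rightarrow> nat \<Rightarrow> 'a, U :: nat \<Rightarrow> 'a \<Rightarrow> real) \<Rightarrow>
     case st' of (s' :: nat \<Rightarrow> nat, Y' :: nat \<Rightarrow> nat \<Rightarrow> 'a, U' :: nat \<Rightarrow> 'a \<Rightarrow> real) \<Rightarrow>
     (\<exists>\<sigma>. strict_mono \<sigma> \<and> s' = s \<circ> \<sigma>) \<and> (\<forall>j\<le>k. Y' j = Y j \<and> U' j = U j) \<and>
     (\<forall>\<tau> x w. profile_limit u s Y (Suc k) \<tau> x w \<longrightarrow> l2.sq w \<le> 4 * l2.sq (U' (Suc k))))" for k :: nat and st st'
  have base: "\<exists>st. P 0 st"
  proof -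
    obtain s w where s: "strict_mono (s :: nat \<Rightarrow> nat)" "H1_weakly_converges (\<lambda>n. u (s n)) w"
      by (rule H1_weak_compactness[OF u M])
    have "bounded (range (\<lambda>n. dirichlet_integral (u (s n))))"
    proof (rule boundedI[of _ M])
      fix d assume "d \<in> range (\<lambda>n. dirichlet_integral (u (s n)))"
      then obtain n where d: "d = dirichlet_integral (u (s n))" by blast
      show "norm d \<le> M" unfolding d
        using M[of "s n"] dirichlet_nonneg[of "u (s n)"] l2_sq_nonneg[of "u (s n)"] by (simp add: h1_sq)
    qed
    then obtain l \<sigma> where \<sigma>: "strict_mono (\<sigma> :: nat \<Rightarrow> nat)" "((\<lambda>n. dirichlet_integral (u (s n))) \<circ> \<sigma>) \<longlonglongrightarrow> l"
      using bounded_imp_convergent_subsequence by blast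
    have "P 0 (s \<circ> \<sigma>, \<lambda>j m. 0, \<lambda>j. w)"
      using \<sigma> s weak_subseq[OF s(2) \<sigma>(1)] by (auto simp: P_def o_def strict_mono_def convergent_def)
    then show ?thesis by blast
  qed
  have step: "\<exists>st'. P (Suc k) st' \<and> Q k st st'" if st: "P k st" for k st
  proof -
    obtain s Y U where [simp]: "st = (s, Y, U)" by (cases st)
    have s: "strict_mono s" and Y0: "Y 0 = (\<lambda>m. 0)" and c: "convergent (\<lambda>n. dirichlet_integral (u (s n)))"
      and wk: "\<And>j. j \<le> k \<Longrightarrow> H1_weakly_converges (\<lambda>n t. u (s n) (t + Y j (s n))) (U j)"
      and sep: "\<And>i j. i \<le> k \<Longrightarrow> j \<le> k \<Longrightarrow> i \<noteq> j \<Longrightarrow> filterlim (\<lambda>n. norm (Y i (s n) - Y j (s n))) at_top sequentially"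
      using st by (auto simp: P_def)
    obtain \<tau> x w where pl: "profile_limit u s Y (Suc k) \<tau> x w"
      and nm: "\<And>\<tau>' x' w'. profile_limit u s Y (Suc k) \<tau>' x' w' \<Longrightarrow> l2.sq w' \<le> 4 * l2.sq w"
      by (rule profile_limit_near_maximal[where u=u and s=s and Y=Y and k="Suc k", OF u M], rule that)
    have \<tau>: "strict_mono \<tau>" and far: "\<And>j. j < Suc k \<Longrightarrow> filterlim (\<lambda>n. norm (x n - Y j (s (\<tau> n)))) at_top sequentially"
      and ww: "H1_weakly_converges (\<lambda>n t. u (s (\<tau> n)) (t + x n)) w" using pl by (auto simp: profile_limit_def)
    have s\<tau>: "strict_mono (s \<circ> \<tau>)" by (rule strict_mono_o[OF s \<tau>])
    then have inj: "inj (s \<circ> \<tau>)" by (rule strict_mono_imp_inj_on)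
    define Y' where "Y' = Y(Suc k := \<lambda>m. x (inv (s \<circ> \<tau>) m))"
    define U' where "U' = U(Suc k := w)"
    have Yn: "Y' (Suc k) (s (\<tau> n)) = x n" for n using inv_f_f[OF inj, of n] by (simp add: Y'_def)
    have old: "Y' j = Y j" "U' j = U j" if "j \<le> k" for j using that by (auto simp: Y'_def U'_def)
    have "P (Suc k) (s \<circ> \<tau>, Y', U')"
      unfolding P_def prod.case
    proof (intro conjI allI impI s\<tau>)
      show "Y' 0 = (\<lambda>m. 0)" using Y0 old(1)[of 0] by simp
      show "convergent (\<lambda>n. dirichlet_integral (u ((s \<circ> \<tau>) n)))"
        using convergent_subseq_convergent[OF c \<tau>] by (simp add: o_def)
      show "H1_weakly_converges (\<lambda>n t. u ((s \<circ> \<tau>) n) (t + Y' j ((s \<circ> \<tau>) n))) (U' j)" if "j \<le> Suc k" for j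
      proof (cases "j = Suc k")
        case True then show ?thesis using ww by (simp add: Yn U'_def)
      next
        case False
        then have "j \<le> k" using that by simp
        then show ?thesis using weak_subseq[OF wk[OF \<open>j \<le> k\<close>] \<tau>] by (simp add: old)
      qed
      fix i j assume ij: "i \<le> Suc k" "j \<le> Suc k" "i \<noteq> j"
      have new: "filterlim (\<lambda>n. norm (Y' (Suc k) ((s \<circ> \<tau>) n) - Y' j ((s \<circ> \<tau>) n))) at_top sequentially" if "j \<le> k" for j
        using far[of j] that by (simp add: Yn old)
      consider "i = Suc k" "j \<le> k" | "j = Suc k" "i \<le> k" | "i \<le> k" "j \<le> k" using ij by linarith
      then show "filterlim (\<lambda>n. norm (Y' i ((s \<circ> \<tau>) n) - Y' j ((s \<circ> \<tau>) n))) at_top sequentially"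
      proof cases
        case 1 then show ?thesis using new by simp
      next
        case 2 then show ?thesis using new[of i] by (simp add: norm_minus_commute)
      next
        case 3 then show ?thesis
          using filterlim_compose[OF sep[OF 3 ij(3)] filterlim_subseq[OF \<tau>]] by (simp add: old)
      qed
    qed
    moreover have "Q k st (s \<circ> \<tau>, Y', U')"
      unfolding Q_def using \<tau> old nm by (auto simp: U'_def)
    ultimately show ?thesis by blast
  qed
  from dependent_nat_choice[of P Q, OF base step]
  obtain F where F: "\<And>k. P k (F k)" "\<And>k. Q k (F k) (F (Suc k))" by blast
  define S where "S k = fst (F k)" for k
  define Y where "Y k = fst (snd (F k))" for k
  define V where "V k = snd (snd (F k))" for k
  have F_eq: "F k = (S k, Y k, V k)" for k by (simp add: S_def Y_def V_def)
  have S: "strict_mono (S k)" and Y0: "Y k 0 = (\<lambda>m. 0)" and c: "convergent (\<lambda>n. dirichlet_integral (u (S k n)))"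
    and wk: "\<And>j. j \<le> k \<Longrightarrow> H1_weakly_converges (\<lambda>n t. u (S k n) (t + Y k j (S k n))) (V k j)"
    and sep: "\<And>i j. i \<le> k \<Longrightarrow> j \<le> k \<Longrightarrow> i \<noteq> j \<Longrightarrow> filterlim (\<lambda>n. norm (Y k i (S k n) - Y k j (S k n))) at_top sequentially" for k
    using F(1)[of k] unfolding F_eq by (auto simp: P_def)
  have sub: "\<exists>\<sigma>. strict_mono \<sigma> \<and> S (Suc k) = S k \<circ> \<sigma>" and stab: "\<And>j. j \<le> k \<Longrightarrow> Y (Suc k) j = Y k j \<and> V (Suc k) j = V k j"
    and nm: "\<And>\<tau> x w. profile_limit u (S k) (Y k) (Suc k) \<tau> x w \<Longrightarrow> l2.sq w \<le> 4 * l2.sq (V (Suc k) (Suc k))" for k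
    using F(2)[of k] unfolding F_eq by (auto simp: Q_def)
  have Ystab: "Y k j = Y j j" "V k j = V j j" if "j \<le> k" for k j
    using that by (induction k rule: dec_induct) (auto simp: stab)
  have mono: "range (S k') \<subseteq> range (S k)" if "k \<le> k'" for k k'
    using that
  proof (induction k' rule: dec_induct)
    case (step m)
    obtain \<sigma> where "S (Suc m) = S m \<circ> \<sigma>" using sub by blast
    then show ?case using step by auto
  qed simp
  \<comment> \<open>The diagonal subsequence; from index k on it is a subsequence of S k.\<close>
  define r where "r k = S k k" for k
  have "r k < r (Suc k)" for k
  proof -
    obtain \<sigma> where \<sigma>: "strict_mono \<sigma>" "S (Suc k) = S k \<circ> \<sigma>" using sub by blast
    have "k < \<sigma> (Suc k)" using seq_suble[OF \<sigma>(1), of "Suc k"] by simp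
    then show ?thesis using strict_monoD[OF S[of k]] by (simp add: r_def \<sigma>(2))
  qed
  then have r: "strict_mono r" by (simp add: strict_mono_Suc_iff)
  have "\<exists>\<rho>. strict_mono \<rho> \<and> (\<forall>n. r (n + k) = S k (\<rho> n))" for k
  proof -
    have "\<exists>m. r (n + k) = S k m" for n using mono[of k "n + k"] by (auto simp: r_def)
    then obtain \<rho> where \<rho>: "\<And>n. r (n + k) = S k (\<rho> n)" by metis
    have "strict_mono \<rho>"
    proof (rule strict_monoI)
      fix a b :: nat assume "a < b"
      then have "S k (\<rho> a) < S k (\<rho> b)" unfolding \<rho>[symmetric] by (intro strict_monoD[OF r]) simp
      then show "\<rho> a < \<rho> b" using strict_mono_less[OF S] by blast
    qed
    with \<rho> show ?thesis by blast
  qed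
  then obtain \<rho> where \<rho>: "\<And>k. strict_mono (\<rho> k)" and r\<rho>: "\<And>k n. r (n + k) = S k (\<rho> k n)" by metis
  have conv: "convergent (\<lambda>n. dirichlet_integral (u (r n)))"
    using convergent_subseq_convergent[OF c[of 0] \<rho>[of 0]] r\<rho>[of _ 0] by (simp add: o_def)
  have prof: "profiles (\<lambda>n. u (r n)) (\<lambda>n j. Y j j (r n)) (\<lambda>j. V j j) M"
  proof
    show "u (r n) \<in> H1" "h1.sq (u (r n)) \<le> M" for n by (rule u, rule M)
    show "H1_weakly_converges (\<lambda>n x. u (r n) (x + Y k k (r n))) (V k k)" for k
    proof (rule weak_offset[where k=k])
      show "(\<lambda>x. u (r n) (x + Y k k (r n))) \<in> H1" for n by (rule H1_shift[OF u])
      show "H1_weakly_converges (\<lambda>n x. u (r (n + k)) (x + Y k k (r (n + k)))) (V k k)"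
        unfolding r\<rho> by (rule weak_subseq[OF wk[OF order_refl] \<rho>])
    qed
    show "filterlim (\<lambda>n. norm (Y j j (r n) - Y k k (r n))) at_top sequentially" if jk: "j \<noteq> k" for j k
    proof -
      let ?m = "max j k"
      have "filterlim (\<lambda>n. norm (Y ?m j (S ?m (\<rho> ?m n)) - Y ?m k (S ?m (\<rho> ?m n)))) at_top sequentially"
        by (rule filterlim_compose[OF sep[OF _ _ jk] filterlim_subseq[OF \<rho>]]) auto
      then have "filterlim (\<lambda>n. norm (Y j j (r (n + ?m)) - Y k k (r (n + ?m)))) at_top sequentially"
        unfolding r\<rho> by (simp add: Ystab[of j ?m] Ystab[of k ?m])
      then show ?thesis by (subst (asm) filterlim_offset[of "\<lambda>n. norm (Y j j (r n) - Y k k (r n))"])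
    qed
    fix k \<tau> x w
    assume \<tau>: "strict_mono (\<tau> :: nat \<Rightarrow> nat)"
      and far: "\<And>j. j < Suc k \<Longrightarrow> filterlim (\<lambda>n. norm (x n - Y j j (r (\<tau> n)))) at_top sequentially"
      and ww: "H1_weakly_converges (\<lambda>n t. u (r (\<tau> n)) (t + x n)) w"
    define \<tau>' where "\<tau>' n = \<rho> k (\<tau> (n + k) - k)" for n
    have ge: "k \<le> \<tau> (n + k)" for n using seq_suble[OF \<tau>, of "n + k"] by simp
    have r\<tau>: "S k (\<tau>' n) = r (\<tau> (n + k))" for n
      using r\<rho>[of "\<tau> (n + k) - k" k] ge[of n] by (simp add: \<tau>'_def)
    have \<tau>': "strict_mono \<tau>'"
    proof (rule strict_monoI)
      fix a b :: nat assume "a < b"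
      then have "\<tau> (a + k) < \<tau> (b + k)" using strict_monoD[OF \<tau>] by simp
      then have "\<tau> (a + k) - k < \<tau> (b + k) - k" using ge[of a] by linarith
      then show "\<tau>' a < \<tau>' b" unfolding \<tau>'_def by (rule strict_monoD[OF \<rho>])
    qed
    have "profile_limit u (S k) (Y k) (Suc k) \<tau>' (\<lambda>n. x (n + k)) w"
      unfolding profile_limit_def r\<tau>
    proof (intro conjI allI impI \<tau>')
      show "filterlim (\<lambda>n. norm (x (n + k) - Y k j (r (\<tau> (n + k))))) at_top sequentially" if "j < Suc k" for j
      proof -
        have eq: "Y k j = Y j j" by (rule Ystab(1)) (use that in simp)
        show ?thesis unfolding eq
          using far[OF that] by (subst filterlim_offset[of "\<lambda>n. norm (x n - Y j j (r (\<tau> n)))" k])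
      qed
      show "H1_weakly_converges (\<lambda>n t. u (r (\<tau> (n + k))) (t + x (n + k))) w"
        by (rule weak_subseq[OF ww, of "\<lambda>n. n + k"]) (simp add: strict_mono_def)
    qed
    then show "l2.sq w \<le> 4 * l2.sq (V (Suc k) (Suc k))" by (rule nm)
  qed
  show ?thesis by (rule that[where Y="\<lambda>j. Y j j", OF r Y0 conv prof])
qed

theorem theorem1p4:
  fixes u :: "nat \<Rightarrow> real ^ 'n \<Rightarrow> real"
  assumes dim: "CARD('n) \<ge> 3"
    and u_H1: "\<And>n. u n \<in> H1"
    and u_bounded: "\<exists>B. \<forall>n. H1_norm (u n) \<le> B"
  shows "\<exists>(U :: nat \<Rightarrow> real ^ 'n \<Rightarrow> real) (y :: nat \<Rightarrow> nat \<Rightarrow> real ^ 'n) (r :: nat \<Rightarrow> nat).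
    (\<forall>i. U i \<in> H1) \<and>
    (\<forall>n. y n 0 = 0) \<and>
    (\<forall>i j. i \<noteq> j \<longrightarrow> filterlim (\<lambda>n. norm (y n i - y n j)) at_top sequentially) \<and>
    strict_mono r \<and>
    (\<forall>i. H1_weakly_converges (\<lambda>n x. u (r n) (x + y (r n) i)) (U i)) \<and>
    (\<forall>i. convergent (\<lambda>n. dirichlet_integral (u (r n))) \<and>
         convergent (\<lambda>n. dirichlet_integral (profile_remainder u U y (r n) i)) \<and>
         lim (\<lambda>n. dirichlet_integral (u (r n))) =
           (\<Sum>j\<le>i. dirichlet_integral (U j)) +
           lim (\<lambda>n. dirichlet_integral (profile_remainder u U y (r n) i))) \<and>
    (\<forall>\<Psi> :: real \<Rightarrow> real.
       (\<forall>s. 0 \<le> \<Psi> s) \<longrightarrow>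
       \<Psi> C1_differentiable_on UNIV \<longrightarrow>
       (\<exists>C>0. \<forall>s. \<bar>deriv \<Psi> s\<bar> \<le> C * (\<bar>s\<bar> + \<bar>s\<bar> powr (sobolev_exponent CARD('n) - 1))) \<longrightarrow>
       (\<forall>i. limsup (\<lambda>n. Psi_integral \<Psi> (u (r n))) =
              (\<Sum>j\<le>i. Psi_integral \<Psi> (U j)) +
              limsup (\<lambda>n. Psi_integral \<Psi> (profile_remainder u U y (r n) i))) \<and>
       (((\<lambda>s. \<Psi> s / \<bar>s\<bar>\<^sup>2) \<longlongrightarrow> 0) (at 0) \<longrightarrow>
        ((\<lambda>s. \<Psi> s / \<bar>s\<bar> powr sobolev_exponent CARD('n)) \<longlongrightarrow> 0) at_infinity \<longrightarrow>
        (\<lambda>i. limsup (\<lambda>n. Psi_integral \<Psi> (profile_remainder u U y (r n) i))) \<longlonglongrightarrow> 0))"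
proof -
  have D: "DIM(real ^ 'n) = CARD('n)" by simp
  then have N: "DIM(real ^ 'n) \<ge> 3" using dim by simp
  obtain B where B: "\<And>n. H1_norm (u n) \<le> B" using u_bounded by blast
  have M: "h1.sq (u n) \<le> B\<^sup>2" for n
  proof -
    have "sqrt (h1.sq (u n)) \<le> B" using B[of n] by (simp add: H1_norm_eq)
    then have "(sqrt (h1.sq (u n)))\<^sup>2 \<le> B\<^sup>2" by (rule power_mono) (simp add: h1_sq_nonneg)
    then show ?thesis by (simp add: h1_sq_nonneg)
  qed
  obtain r Y U where r: "strict_mono (r :: nat \<Rightarrow> nat)" and Y0: "Y 0 = (\<lambda>m. 0)"
    and conv: "convergent (\<lambda>n. dirichlet_integral (u (r n)))"
    and prof: "profiles (\<lambda>n. u (r n)) (\<lambda>n j. Y j (r n)) U (B\<^sup>2)"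
    by (rule profiles_exist[OF u_H1 M])
  interpret profiles "\<lambda>n. u (r n)" "\<lambda>n j. Y j (r n)" U "B\<^sup>2" by (rule prof)
  obtain b :: "real ^ 'n" where b: "b \<in> Basis" using nonempty_Basis by blast
  \<comment> \<open>The centres must separate along the whole sequence, so off the subsequence they are placed by hand.\<close>
  define y where "y m i = (if m \<in> range r then Y i m else (real i * real m) *\<^sub>R b)" for m i
  have yr: "y (r n) i = Y i (r n)" for n i by (simp add: y_def)
  have rem: "profile_remainder u U y (r n) i = R (Suc i) n" for n i
    by (simp add: profile_remainder_def R_def fun_eq_iff yr lessThan_Suc_atMost)
  have y_sep: "filterlim (\<lambda>m. norm (y m i - y m j)) at_top sequentially" if ij: "i \<noteq> j" for i j
    unfolding filterlim_at_top
  proof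
    fix Z :: real
    have "\<forall>\<^sub>F n in sequentially. Z \<le> norm (Y i (r n) - Y j (r n))"
      using sep[OF ij] unfolding filterlim_at_top by blast
    then obtain n0 where n0: "\<And>n. n \<ge> n0 \<Longrightarrow> Z \<le> norm (Y i (r n) - Y j (r n))"
      by (auto simp: eventually_sequentially)
    show "\<forall>\<^sub>F m in sequentially. Z \<le> norm (y m i - y m j)"
      using eventually_ge_at_top[of "max (r n0) (nat \<lceil>Z\<rceil>)"]
    proof eventually_elim
      case (elim m)
      show ?case
      proof (cases "m \<in> range r")
        case True
        then obtain n where n: "m = r n" by blast
        then have "n0 \<le> n" using elim strict_mono_less_eq[OF r] by simp
        then show ?thesis using n0 by (simp add: n yr)
      next
        case False
        have "y m i - y m j = ((real i - real j) * real m) *\<^sub>R b"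
          using False by (simp add: y_def scaleR_left_diff_distrib left_diff_distrib)
        then have "norm (y m i - y m j) = \<bar>real i - real j\<bar> * real m" using b by (simp add: abs_mult)
        moreover have "1 * real m \<le> \<bar>real i - real j\<bar> * real m" using ij by (intro mult_right_mono) auto
        moreover have "Z \<le> real m" using elim by linarith
        ultimately show ?thesis by simp
      qed
    qed
  qed
  have dir: "convergent (\<lambda>n. dirichlet_integral (R (Suc i) n)) \<and>
     lim (\<lambda>n. dirichlet_integral (u (r n))) = (\<Sum>j\<le>i. dirichlet_integral (U j)) + lim (\<lambda>n. dirichlet_integral (R (Suc i) n))" for i
  proof -
    obtain l where l: "(\<lambda>n. dirichlet_integral (u (r n))) \<longlonglongrightarrow> l" using conv by (auto simp: convergent_def)
    from tendsto_diff[OF l dirichlet_split[of "Suc i"]]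
    have "(\<lambda>n. dirichlet_integral (R (Suc i) n)) \<longlonglongrightarrow> l - (\<Sum>j\<le>i. dirichlet_integral (U j))"
      by (simp add: lessThan_Suc_atMost)
    then have "convergent (\<lambda>n. dirichlet_integral (R (Suc i) n))"
      "lim (\<lambda>n. dirichlet_integral (R (Suc i) n)) = l - (\<Sum>j\<le>i. dirichlet_integral (U j))"
      by (auto simp: convergent_def limI)
    then show ?thesis using limI[OF l] by simp
  qed
  have growth: "(\<forall>i. limsup (\<lambda>n. Psi_integral \<Psi> (u (r n))) =
              (\<Sum>j\<le>i. Psi_integral \<Psi> (U j)) + limsup (\<lambda>n. Psi_integral \<Psi> (R (Suc i) n))) \<and>
       (((\<lambda>s. \<Psi> s / \<bar>s\<bar>\<^sup>2) \<longlongrightarrow> 0) (at 0) \<longrightarrow>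
        ((\<lambda>s. \<Psi> s / \<bar>s\<bar> powr sobolev_exponent CARD('n)) \<longlongrightarrow> 0) at_infinity \<longrightarrow>
        (\<lambda>i. limsup (\<lambda>n. Psi_integral \<Psi> (R (Suc i) n))) \<longlonglongrightarrow> 0)"
    if \<Psi>: "\<forall>s. 0 \<le> \<Psi> s" "\<Psi> C1_differentiable_on UNIV"
      "\<exists>C>0. \<forall>s. \<bar>deriv \<Psi> s\<bar> \<le> C * (\<bar>s\<bar> + \<bar>s\<bar> powr (sobolev_exponent CARD('n) - 1))" for \<Psi>
  proof -
    obtain C where "C > 0" "\<forall>s. \<bar>deriv \<Psi> s\<bar> \<le> C * (\<bar>s\<bar> + \<bar>s\<bar> powr (sobolev_exponent CARD('n) - 1))"
      using \<Psi>(3) by blast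
    then have g: "growth_C1 (sobolev_exponent DIM(real ^ 'n)) \<Psi> C"
      using \<Psi>(1,2) unfolding growth_C1_def D by simp
    show ?thesis
      by (intro conjI allI impI Psi_split[OF N g] Psi_remainder_vanishes[OF N g, unfolded D])
  qed
  show ?thesis
  proof (intro exI[of _ U] exI[of _ y] exI[of _ r] conjI)
    show "\<forall>i. U i \<in> H1" using U_mem by blast
    show "\<forall>n. y n 0 = 0" by (simp add: y_def Y0)
    show "\<forall>i j. i \<noteq> j \<longrightarrow> filterlim (\<lambda>n. norm (y n i - y n j)) at_top sequentially" using y_sep by blast
    show "strict_mono r" by (rule r)
    show "\<forall>i. H1_weakly_converges (\<lambda>n x. u (r n) (x + y (r n) i)) (U i)" using weak by (simp add: yr)
  qed (use conv dir growth in \<open>auto simp: rem\<close>)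
qed

end
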